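(* If $[\![M]\!] = [\![N]\!]$ in every $\lambda_{\mathrm{eff}}^{\mathcal{E}}$-model, then $\Gamma \vdash M = N : A\,!\,\Sigma/\mathcal{E}$ is derivable in $\lambda_{\mathrm{eff}}^{\mathcal{E}}$.
   Context: Ground types $\hat A ::= b \mid \hat A_1\times\dots\times\hat A_n \mid \hat A_1+\dots+\hat A_n$; signatures $\Sigma$ are finite sets of entries $\mathtt{op}:\hat A\to\hat B$ with ground types (the arrow denotes an operation signature: argument type to result type). Effect theory terms $\hat M ::= \mathtt{return}\ \hat V \mid \mathtt{let}\ x\Leftarrow\mathtt{op}(\hat V)\ \mathtt{in}\ \hat M \mid \mathtt{case}\ \hat V\ \mathtt{of}\ \{\iota_i\,x_i\mapsto\hat M_i\}$; an effect theory $(\Sigma,\mathcal{E})$ has a set $\mathcal{E}$ of equational axioms $\hat\Delta\vdash\hat M\sim\hat N:\hat A!\Sigma$. The calculus $\lambda_{\mathrm{eff}}^{\mathcal{E}}$ is a fine-grain call-by-value calculus with functions, products, sums, base types, operations $\mathtt{op}(V)$, and $\mathtt{handle}\ M\ \mathtt{with}\ H\ \mathtt{to}\ x.N$, with computation types $A!\Sigma/\mathcal{E}$; handle-with is typeable only when $H$ respects $\mathcal{E}$, i.e. $\hat M[H,k]=\hat N[H,k]$ is derivable for every axiom, where $\hat M[H,k]$ replaces each $\mathtt{let}\ x\Leftarrow\mathtt{op}(\hat V)\ \mathtt{in}\ \hat N$ by $M_{\mathtt{op}}[\hat V/x,\lambda x.\hat N[H,k]/k']$ and $\mathtt{return}\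 \hat V$ by $k\ \hat V$. Equations: beta/eta, monad laws, the three handler laws (handle of $\mathtt{return}\ V$ gives $M[V/x]$; handle of a $\mathtt{let}$ gives nested handles; handle of $\mathtt{op}(V)$ gives $M_{\mathtt{op}}[V/x,\lambda x.M/k]$), and instantiation of axioms of $\mathcal{E}$ along substitutions. A $\lambda_{\mathrm{eff}}^{\mathcal{E}}$-model consists of a cartesian category $\mathcal{C}$, strong monads $T_{(\Sigma,\mathcal{E})}$ per effect theory with Kleisli exponentials $(Y\Rightarrow_T Z)$ and joint distributive Kleisli coproducts, interpretations $[\![\mathtt{op}]\!]:[\![\hat A_{\mathtt{op}}]\!]\to T_{(\Sigma,\mathcal{E})}[\![\hat B_{\mathtt{op}}]\!]$ validating every axiom of $\mathcal{E}$ (under the evident monadic interpretation of effect theory terms), and natural transformations $\mathrm{handle}_{\mathcal{T},\mathcal{T}',X}:H_{\mathcal{T}}\times\mathbf{y}(T_{\mathcal{T}}T_{\mathcal{T}'}X)\to\mathbf{y}(T_{\mathcal{T}'}X)$ ($\mathbf{y}$ Yoneda embedding), where $H_{\mathcal{T}}(Z)$ is the set of morphisms $Z\to\mathcal{H}_\Sigma(X)=\prod_{\mathtt{op}}(([\![\hat A_{\mathtt{op}}]\!]\times([\![\hat B_{\mathtt{op}}]\!]\Rightarrow_{T_{\mathcal{T}'}}X))\Rightarrow_{T_{\mathcal{T}'}}X)$ that satisfy the axioms of $\mathcal{E}$ when effect theory terms are interpreted as operations on handler objects, satisfying the unit, multiplication and operation equations: $\mathrm{handle}(h,\eta\circ f)=f$,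 $\mathrm{handle}(h,\mu\circ f)=\mathrm{handle}(h,T\,\mathrm{handle}(h\circ\pi_1,\pi_2)\circ\mathrm{st}\circ\langle\mathrm{id},f\rangle)$, $\mathrm{handle}(h,T\mathrm{ev}\circ\mathrm{st}\circ\mathrm{swap}\circ([\![\mathtt{op}]\!]\times\mathrm{id})\circ f)=\mathrm{ev}\circ\langle\pi_{\mathtt{op}}\circ h,f\rangle$. Handle-with is interpreted as $\mathrm{handle}([\![H]\!],T[\![N]\!]\circ\mathrm{st}\circ\langle\mathrm{id},[\![M]\!]\rangle)$. *)

theory Defs
  imports Main "HOL-Library.Finite_Map"
begin

section \<open>Effect theories\<close>

datatype 'b gty = GBase 'b | GProd "'b gty list" | GSum "'b gty list"

type_synonym ('b, 'op) signature = "('op, 'b gty \<times> 'b gty) fmap"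

text \<open>
  All binding is by de Bruijn indices; a context is a list of types whose head is the type of
  the most recently bound variable (index 0). Injections carry the list of summands.
\<close>

datatype 'b gval =
    GVar nat
  | GTup "'b gval list"
  | GProj nat "'b gval"
  | GInj "'b gty list" nat "'b gval"

text \<open>
  \<open>GLet op V M\<close> is \<open>let x \<Leftarrow> op(V) in M\<close> and binds one variable in \<open>M\<close>;
  \<open>GCase V Ms\<close> binds one variable in each branch.
\<close>

datatype ('b, 'op) gcomp =
    GRet "'b gval"
  | GLet 'op "'b gval" "('b, 'op) gcomp"
  | GCase "'b gval" "('b, 'op) gcomp list"

inductive gvtyp :: "'b gty list \<Rightarrow> 'b gval \<Rightarrow> 'b gty \<Rightarrow> bool" for \<Delta> where
  gv_var: "n < length \<Delta> \<Longrightarrow> gvtyp \<Delta> (GVar n) (\<Delta> ! n)"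
| gv_tup: "list_all2 (gvtyp \<Delta>) Vs As \<Longrightarrow> gvtyp \<Delta> (GTup Vs) (GProd As)"
| gv_proj: "gvtyp \<Delta> V (GProd As) \<Longrightarrow> i < length As \<Longrightarrow> gvtyp \<Delta> (GProj i V) (As ! i)"
| gv_inj: "i < length As \<Longrightarrow> gvtyp \<Delta> V (As ! i) \<Longrightarrow> gvtyp \<Delta> (GInj As i V) (GSum As)"

inductive gctyp ::
  "('b, 'op) signature \<Rightarrow> 'b gty list \<Rightarrow> ('b, 'op) gcomp \<Rightarrow> 'b gty \<Rightarrow> bool" for \<Sigma> where
  gc_ret: "gvtyp \<Delta> V A \<Longrightarrow> gctyp \<Sigma> \<Delta> (GRet V) A"
| gc_let: "fmlookup \<Sigma> op = Some (A, B) \<Longrightarrow> gvtyp \<Delta> V A \<Longrightarrow> gctyp \<Sigma> (B # \<Delta>) M C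
    \<Longrightarrow> gctyp \<Sigma> \<Delta> (GLet op V M) C"
| gc_case: "gvtyp \<Delta> V (GSum As) \<Longrightarrow> list_all2 (\<lambda>A M. gctyp \<Sigma> (A # \<Delta>) M C) As Ms
    \<Longrightarrow> gctyp \<Sigma> \<Delta> (GCase V Ms) C"

text \<open>An axiom \<open>(\<Delta>, M, N, A)\<close> stands for \<open>\<Delta> \<turnstile> M \<sim> N : A!\<Sigma>\<close>.\<close>

type_synonym ('b, 'op) gaxiom =
  "'b gty list \<times> ('b, 'op) gcomp \<times> ('b, 'op) gcomp \<times> 'b gty"

typedef ('b, 'op) effthy =
  "{(\<Sigma> :: ('b, 'op) signature, E :: ('b, 'op) gaxiom set).
      \<forall>(\<Delta>, M, N, A) \<in> E. gctyp \<Sigma> \<Delta> M A \<and> gctyp \<Sigma> \<Delta> N A}"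
  by (rule exI[of _ "(fmempty, {})"]) simp

definition sig :: "('b, 'op) effthy \<Rightarrow> ('b, 'op) signature" where
  "sig \<T> = fst (Rep_effthy \<T>)"

definition axs :: "('b, 'op) effthy \<Rightarrow> ('b, 'op) gaxiom set" where
  "axs \<T> = snd (Rep_effthy \<T>)"


section \<open>Syntax of the calculus\<close>

text \<open>\<open>TFun A B \<T>\<close> is the function type \<open>A \<rightarrow> B!\<T>\<close>.\<close>

datatype ('b, 'op) ty =
    TBase 'b
  | TProd "('b, 'op) ty list"
  | TSum "('b, 'op) ty list"
  | TFun "('b, 'op) ty" "('b, 'op) ty" "('b, 'op) effthy"

primrec ty_of :: "'b gty \<Rightarrow> ('b, 'op) ty" where
  "ty_of (GBase b) = TBase b"
| "ty_of (GProd As) = TProd (map ty_of As)"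
| "ty_of (GSum As) = TSum (map ty_of As)"

text \<open>
  Terms are in Church style, so that a typable term has exactly one typing derivation:
  \<open>VLam A B \<T> M\<close> is \<open>\<lambda>x:A. (M : B!\<T>)\<close>, \<open>CLet A M N\<close> is \<open>let x:A \<Leftarrow> M in N\<close>, and
  \<open>CHandle A \<T> M H N\<close> is \<open>handle (M : A!\<T>) with H to x. N\<close>. The clause of \<open>H\<close> at \<open>op\<close> binds
  two variables: the parameter \<open>x\<close> (index 1) and the continuation \<open>k\<close> (index 0).
\<close>

datatype ('b, 'op) val =
    VVar nat
  | VTup "('b, 'op) val list"
  | VProj nat "('b, 'op) val"
  | VInj "('b, 'op) ty list" nat "('b, 'op) val"
  | VLam "('b, 'op) ty" "('b, 'op) ty" "('b, 'op) effthy" "('b, 'op) comp"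
and ('b, 'op) comp =
    CRet "('b, 'op) val"
  | CLet "('b, 'op) ty" "('b, 'op) comp" "('b, 'op) comp"
  | CApp "('b, 'op) val" "('b, 'op) val"
  | CCase "('b, 'op) val" "('b, 'op) comp list"
  | COp 'op "('b, 'op) val"
  | CHandle "('b, 'op) ty" "('b, 'op) effthy" "('b, 'op) comp"
      "('op, ('b, 'op) comp) fmap" "('b, 'op) comp"

type_synonym ('b, 'op) handler = "('op, ('b, 'op) comp) fmap"

definition upr :: "(nat \<Rightarrow> nat) \<Rightarrow> nat \<Rightarrow> nat" where
  "upr \<xi> = case_nat 0 (\<lambda>n. Suc (\<xi> n))"

primrec vren :: "(nat \<Rightarrow> nat) \<Rightarrow> ('b, 'op) val \<Rightarrow> ('b, 'op) val"
  and cren :: "(nat \<Rightarrow> nat) \<Rightarrow> ('b, 'op) comp \<Rightarrow> ('b, 'op) comp" where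
  "vren \<xi> (VVar n) = VVar (\<xi> n)"
| "vren \<xi> (VTup Vs) = VTup (map (vren \<xi>) Vs)"
| "vren \<xi> (VProj i V) = VProj i (vren \<xi> V)"
| "vren \<xi> (VInj As i V) = VInj As i (vren \<xi> V)"
| "vren \<xi> (VLam A B \<T> M) = VLam A B \<T> (cren (upr \<xi>) M)"
| "cren \<xi> (CRet V) = CRet (vren \<xi> V)"
| "cren \<xi> (CLet A M N) = CLet A (cren \<xi> M) (cren (upr \<xi>) N)"
| "cren \<xi> (CApp V W) = CApp (vren \<xi> V) (vren \<xi> W)"
| "cren \<xi> (CCase V Ms) = CCase (vren \<xi> V) (map (cren (upr \<xi>)) Ms)"
| "cren \<xi> (COp op V) = COp op (vren \<xi> V)"
| "cren \<xi> (CHandle A \<T> M H N) =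
     CHandle A \<T> (cren \<xi> M) (fmmap (cren (upr (upr \<xi>))) H) (cren (upr \<xi>) N)"

definition up :: "(nat \<Rightarrow> ('b, 'op) val) \<Rightarrow> nat \<Rightarrow> ('b, 'op) val" where
  "up \<sigma> = case_nat (VVar 0) (\<lambda>n. vren Suc (\<sigma> n))"

primrec vsubst :: "(nat \<Rightarrow> ('b, 'op) val) \<Rightarrow> ('b, 'op) val \<Rightarrow> ('b, 'op) val"
  and csubst :: "(nat \<Rightarrow> ('b, 'op) val) \<Rightarrow> ('b, 'op) comp \<Rightarrow> ('b, 'op) comp" where
  "vsubst \<sigma> (VVar n) = \<sigma> n"
| "vsubst \<sigma> (VTup Vs) = VTup (map (vsubst \<sigma>) Vs)"
| "vsubst \<sigma> (VProj i V) = VProj i (vsubst \<sigma> V)"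
| "vsubst \<sigma> (VInj As i V) = VInj As i (vsubst \<sigma> V)"
| "vsubst \<sigma> (VLam A B \<T> M) = VLam A B \<T> (csubst (up \<sigma>) M)"
| "csubst \<sigma> (CRet V) = CRet (vsubst \<sigma> V)"
| "csubst \<sigma> (CLet A M N) = CLet A (csubst \<sigma> M) (csubst (up \<sigma>) N)"
| "csubst \<sigma> (CApp V W) = CApp (vsubst \<sigma> V) (vsubst \<sigma> W)"
| "csubst \<sigma> (CCase V Ms) = CCase (vsubst \<sigma> V) (map (csubst (up \<sigma>)) Ms)"
| "csubst \<sigma> (COp op V) = COp op (vsubst \<sigma> V)"
| "csubst \<sigma> (CHandle A \<T> M H N) =
     CHandle A \<T> (csubst \<sigma> M) (fmmap (csubst (up (up \<sigma>))) H) (csubst (up \<sigma>) N)"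

definition scons :: "('b, 'op) val \<Rightarrow> (nat \<Rightarrow> ('b, 'op) val) \<Rightarrow> nat \<Rightarrow> ('b, 'op) val" where
  "scons V \<sigma> = case_nat V \<sigma>"

definition csubst1 :: "('b, 'op) val \<Rightarrow> ('b, 'op) comp \<Rightarrow> ('b, 'op) comp" where
  "csubst1 V M = csubst (scons V VVar) M"

text \<open>\<open>clause_subst V W M\<close> is \<open>M[V/x, W/k]\<close> for a handler clause \<open>M\<close>.\<close>

definition clause_subst ::
  "('b, 'op) val \<Rightarrow> ('b, 'op) val \<Rightarrow> ('b, 'op) comp \<Rightarrow> ('b, 'op) comp" where
  "clause_subst V W M = csubst (scons W (scons V VVar)) M"

definition hren :: "(nat \<Rightarrow> nat) \<Rightarrow> ('b, 'op) handler \<Rightarrow> ('b, 'op) handler" where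
  "hren \<xi> H = fmmap (cren (upr (upr \<xi>))) H"


section \<open>Effect theory terms in the calculus\<close>

definition argty :: "('b, 'op) effthy \<Rightarrow> 'op \<Rightarrow> 'b gty" where
  "argty \<T> op = fst (the (fmlookup (sig \<T>) op))"

definition resty :: "('b, 'op) effthy \<Rightarrow> 'op \<Rightarrow> 'b gty" where
  "resty \<T> op = snd (the (fmlookup (sig \<T>) op))"

primrec val_of :: "'b gval \<Rightarrow> ('b, 'op) val" where
  "val_of (GVar n) = VVar n"
| "val_of (GTup Vs) = VTup (map val_of Vs)"
| "val_of (GProj i V) = VProj i (val_of V)"
| "val_of (GInj As i V) = VInj (map ty_of As) i (val_of V)"

primrec comp_of :: "('b, 'op) effthy \<Rightarrow> ('b, 'op) gcomp \<Rightarrow> ('b, 'op) comp" where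
  "comp_of \<T> (GRet V) = CRet (val_of V)"
| "comp_of \<T> (GLet op V M) = CLet (ty_of (resty \<T> op)) (COp op (val_of V)) (comp_of \<T> M)"
| "comp_of \<T> (GCase V Ms) = CCase (val_of V) (map (comp_of \<T>) Ms)"

text \<open>
  \<open>hinst \<T> X \<T>' H k M\<close> is \<open>M[H,k]\<close>, where \<open>H\<close> handles the operations of \<open>\<T>\<close> by computations
  of type \<open>X!\<T>'\<close>. The variables of \<open>M\<close>, of the clauses of \<open>H\<close> (apart from the two variables
  bound there) and of \<open>k\<close> all refer to the same context, so \<open>H\<close> and \<open>k\<close> are weakened under
  the binders of \<open>M\<close>.
\<close>

primrec hinst ::
  "('b, 'op) effthy \<Rightarrow> ('b, 'op) ty \<Rightarrow> ('b, 'op) effthy \<Rightarrow> ('b, 'op) handler \<Rightarrow>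
   ('b, 'op) val \<Rightarrow> ('b, 'op) gcomp \<Rightarrow> ('b, 'op) comp" where
  "hinst \<T> X \<T>' H k (GRet V) = CApp k (val_of V)"
| "hinst \<T> X \<T>' H k (GLet op V M) =
     clause_subst (val_of V)
       (VLam (ty_of (resty \<T> op)) X \<T>' (hinst \<T> X \<T>' (hren Suc H) (vren Suc k) M))
       (the (fmlookup H op))"
| "hinst \<T> X \<T>' H k (GCase V Ms) =
     CCase (val_of V) (map (hinst \<T> X \<T>' (hren Suc H) (vren Suc k)) Ms)"


section \<open>Typing and equational theory\<close>

text \<open>
  Typing and equality are mutually inductive, because a handler is well typed only if it
  respects the axioms of the effect theory it handles.
  \<^item> \<open>vtyp \<Gamma> V A\<close> is \<open>\<Gamma> \<turnstile> V : A\<close> and \<open>ctyp \<Gamma> M A \<T>\<close> is \<open>\<Gamma> \<turnstile> M : A!\<T>\<close>;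
  \<^item> \<open>htyp \<Gamma> H \<T> X \<T>'\<close> says that \<open>H\<close> handles \<open>\<T>\<close> into \<open>X!\<T>'\<close> and respects the axioms of
    \<open>\<T>\<close>. For an axiom \<open>\<Delta> \<turnstile> M \<sim> N : A\<close> the equation \<open>M[H,k] = N[H,k]\<close> is in context
    \<open>\<Gamma>, k : A \<rightarrow> X!\<T>', \<Delta>\<close>, whence the index of \<open>k\<close> and the weakening of \<open>H\<close>;
  \<^item> \<open>veq \<Gamma> V W A\<close> is \<open>\<Gamma> \<turnstile> V = W : A\<close> and \<open>ceq \<Gamma> M N A \<T>\<close> is \<open>\<Gamma> \<turnstile> M = N : A!\<T>\<close>.
\<close>

inductive
      vtyp :: "('b, 'op) ty list \<Rightarrow> ('b, 'op) val \<Rightarrow> ('b, 'op) ty \<Rightarrow> bool"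
  and ctyp :: "('b, 'op) ty list \<Rightarrow> ('b, 'op) comp \<Rightarrow> ('b, 'op) ty \<Rightarrow> ('b, 'op) effthy \<Rightarrow> bool"
  and htyp :: "('b, 'op) ty list \<Rightarrow> ('b, 'op) handler \<Rightarrow> ('b, 'op) effthy \<Rightarrow> ('b, 'op) ty \<Rightarrow>
      ('b, 'op) effthy \<Rightarrow> bool"
  and veq :: "('b, 'op) ty list \<Rightarrow> ('b, 'op) val \<Rightarrow> ('b, 'op) val \<Rightarrow> ('b, 'op) ty \<Rightarrow> bool"
  and ceq :: "('b, 'op) ty list \<Rightarrow> ('b, 'op) comp \<Rightarrow> ('b, 'op) comp \<Rightarrow> ('b, 'op) ty \<Rightarrow>
      ('b, 'op) effthy \<Rightarrow> bool"
where
  vt_var: "n < length \<Gamma> \<Longrightarrow> vtyp \<Gamma> (VVar n) (\<Gamma> ! n)"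
| vt_tup: "list_all2 (vtyp \<Gamma>) Vs As \<Longrightarrow> vtyp \<Gamma> (VTup Vs) (TProd As)"
| vt_proj: "vtyp \<Gamma> V (TProd As) \<Longrightarrow> i < length As \<Longrightarrow> vtyp \<Gamma> (VProj i V) (As ! i)"
| vt_inj: "i < length As \<Longrightarrow> vtyp \<Gamma> V (As ! i) \<Longrightarrow> vtyp \<Gamma> (VInj As i V) (TSum As)"
| vt_lam: "ctyp (A # \<Gamma>) M B \<T> \<Longrightarrow> vtyp \<Gamma> (VLam A B \<T> M) (TFun A B \<T>)"

| ct_ret: "vtyp \<Gamma> V A \<Longrightarrow> ctyp \<Gamma> (CRet V) A \<T>"
| ct_let: "ctyp \<Gamma> M A \<T> \<Longrightarrow> ctyp (A # \<Gamma>) N B \<T> \<Longrightarrow> ctyp \<Gamma> (CLet A M N) B \<T>"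
| ct_app: "vtyp \<Gamma> V (TFun A B \<T>) \<Longrightarrow> vtyp \<Gamma> W A \<Longrightarrow> ctyp \<Gamma> (CApp V W) B \<T>"
| ct_case: "vtyp \<Gamma> V (TSum As) \<Longrightarrow> list_all2 (\<lambda>A M. ctyp (A # \<Gamma>) M B \<T>) As Ms
    \<Longrightarrow> ctyp \<Gamma> (CCase V Ms) B \<T>"
| ct_op: "fmlookup (sig \<T>) op = Some (A, B) \<Longrightarrow> vtyp \<Gamma> V (ty_of A)
    \<Longrightarrow> ctyp \<Gamma> (COp op V) (ty_of B) \<T>"
| ct_handle: "ctyp \<Gamma> M A \<T> \<Longrightarrow> htyp \<Gamma> H \<T> B \<T>' \<Longrightarrow> ctyp (A # \<Gamma>) N B \<T>'
    \<Longrightarrow> ctyp \<Gamma> (CHandle A \<T> M H N) B \<T>'"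

| ht: "fmdom H = fmdom (sig \<T>)
    \<Longrightarrow> (\<And>op A B M. fmlookup (sig \<T>) op = Some (A, B) \<Longrightarrow> fmlookup H op = Some M
          \<Longrightarrow> ctyp (TFun (ty_of B) X \<T>' # ty_of A # \<Gamma>) M X \<T>')
    \<Longrightarrow> (\<And>\<Delta> M N A. (\<Delta>, M, N, A) \<in> axs \<T>
          \<Longrightarrow> ceq (map ty_of \<Delta> @ TFun (ty_of A) X \<T>' # \<Gamma>)
                (hinst \<T> X \<T>' (hren ((+) (Suc (length \<Delta>))) H) (VVar (length \<Delta>)) M)
                (hinst \<T> X \<T>' (hren ((+) (Suc (length \<Delta>))) H) (VVar (length \<Delta>)) N)
                X \<T>')
    \<Longrightarrow> htyp \<Gamma> H \<T> X \<T>'"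

| ve_refl: "vtyp \<Gamma> V A \<Longrightarrow> veq \<Gamma> V V A"
| ve_sym: "veq \<Gamma> V W A \<Longrightarrow> veq \<Gamma> W V A"
| ve_trans: "veq \<Gamma> U V A \<Longrightarrow> veq \<Gamma> V W A \<Longrightarrow> veq \<Gamma> U W A"
| ve_tup: "length Vs = length As \<Longrightarrow> length Ws = length As
    \<Longrightarrow> (\<And>i. i < length As \<Longrightarrow> veq \<Gamma> (Vs ! i) (Ws ! i) (As ! i))
    \<Longrightarrow> veq \<Gamma> (VTup Vs) (VTup Ws) (TProd As)"
| ve_proj: "veq \<Gamma> V W (TProd As) \<Longrightarrow> i < length As \<Longrightarrow> veq \<Gamma> (VProj i V) (VProj i W) (As ! i)"
| ve_inj: "i < length As \<Longrightarrow> veq \<Gamma> V W (As ! i) \<Longrightarrow> veq \<Gamma> (VInj As i V) (VInj As i W) (TSum As)"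
| ve_lam: "ceq (A # \<Gamma>) M N B \<T> \<Longrightarrow> veq \<Gamma> (VLam A B \<T> M) (VLam A B \<T> N) (TFun A B \<T>)"
| ve_prod_beta: "list_all2 (vtyp \<Gamma>) Vs As \<Longrightarrow> i < length As
    \<Longrightarrow> veq \<Gamma> (VProj i (VTup Vs)) (Vs ! i) (As ! i)"
| ve_prod_eta: "vtyp \<Gamma> V (TProd As)
    \<Longrightarrow> veq \<Gamma> V (VTup (map (\<lambda>i. VProj i V) [0..<length As])) (TProd As)"
| ve_fun_eta: "vtyp \<Gamma> V (TFun A B \<T>)
    \<Longrightarrow> veq \<Gamma> V (VLam A B \<T> (CApp (vren Suc V) (VVar 0))) (TFun A B \<T>)"

| ce_refl: "ctyp \<Gamma> M A \<T> \<Longrightarrow> ceq \<Gamma> M M A \<T>"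
| ce_sym: "ceq \<Gamma> M N A \<T> \<Longrightarrow> ceq \<Gamma> N M A \<T>"
| ce_trans: "ceq \<Gamma> M N A \<T> \<Longrightarrow> ceq \<Gamma> N P A \<T> \<Longrightarrow> ceq \<Gamma> M P A \<T>"
| ce_ret: "veq \<Gamma> V W A \<Longrightarrow> ceq \<Gamma> (CRet V) (CRet W) A \<T>"
| ce_let: "ceq \<Gamma> M M' A \<T> \<Longrightarrow> ceq (A # \<Gamma>) N N' B \<T> \<Longrightarrow> ceq \<Gamma> (CLet A M N) (CLet A M' N') B \<T>"
| ce_app: "veq \<Gamma> V V' (TFun A B \<T>) \<Longrightarrow> veq \<Gamma> W W' A \<Longrightarrow> ceq \<Gamma> (CApp V W) (CApp V' W') B \<T>"
| ce_case: "veq \<Gamma> V V' (TSum As) \<Longrightarrow> length Ms = length As \<Longrightarrow> length Ms' = length As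
    \<Longrightarrow> (\<And>i. i < length As \<Longrightarrow> ceq (As ! i # \<Gamma>) (Ms ! i) (Ms' ! i) B \<T>)
    \<Longrightarrow> ceq \<Gamma> (CCase V Ms) (CCase V' Ms') B \<T>"
| ce_op: "fmlookup (sig \<T>) op = Some (A, B) \<Longrightarrow> veq \<Gamma> V W (ty_of A)
    \<Longrightarrow> ceq \<Gamma> (COp op V) (COp op W) (ty_of B) \<T>"
| ce_handle: "ceq \<Gamma> M M' A \<T> \<Longrightarrow> htyp \<Gamma> H \<T> B \<T>' \<Longrightarrow> htyp \<Gamma> H' \<T> B \<T>'
    \<Longrightarrow> (\<And>op A' B' P P'. fmlookup (sig \<T>) op = Some (A', B')
          \<Longrightarrow> fmlookup H op = Some P \<Longrightarrow> fmlookup H' op = Some P'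
          \<Longrightarrow> ceq (TFun (ty_of B') B \<T>' # ty_of A' # \<Gamma>) P P' B \<T>')
    \<Longrightarrow> ceq (A # \<Gamma>) N N' B \<T>'
    \<Longrightarrow> ceq \<Gamma> (CHandle A \<T> M H N) (CHandle A \<T> M' H' N') B \<T>'"
| ce_fun_beta: "ctyp (A # \<Gamma>) M B \<T> \<Longrightarrow> vtyp \<Gamma> V A
    \<Longrightarrow> ceq \<Gamma> (CApp (VLam A B \<T> M) V) (csubst1 V M) B \<T>"
| ce_sum_beta: "i < length As \<Longrightarrow> vtyp \<Gamma> V (As ! i)
    \<Longrightarrow> list_all2 (\<lambda>A M. ctyp (A # \<Gamma>) M B \<T>) As Ms
    \<Longrightarrow> ceq \<Gamma> (CCase (VInj As i V) Ms) (csubst1 V (Ms ! i)) B \<T>"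
| ce_sum_eta: "vtyp \<Gamma> V (TSum As) \<Longrightarrow> ctyp (TSum As # \<Gamma>) M B \<T>
    \<Longrightarrow> ceq \<Gamma> (csubst1 V M)
          (CCase V (map (\<lambda>i. csubst (scons (VInj As i (VVar 0)) (\<lambda>n. VVar (Suc n))) M)
                     [0..<length As])) B \<T>"
| ce_let_ret: "vtyp \<Gamma> V A \<Longrightarrow> ctyp (A # \<Gamma>) M B \<T> \<Longrightarrow> ceq \<Gamma> (CLet A (CRet V) M) (csubst1 V M) B \<T>"
| ce_let_eta: "ctyp \<Gamma> M A \<T> \<Longrightarrow> ceq \<Gamma> (CLet A M (CRet (VVar 0))) M A \<T>"
| ce_let_let: "ctyp \<Gamma> M A \<T> \<Longrightarrow> ctyp (A # \<Gamma>) N B \<T> \<Longrightarrow> ctyp (B # \<Gamma>) P C \<T>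
    \<Longrightarrow> ceq \<Gamma> (CLet B (CLet A M N) P) (CLet A M (CLet B N (cren (upr Suc) P))) C \<T>"
| ce_handle_ret: "vtyp \<Gamma> V A \<Longrightarrow> htyp \<Gamma> H \<T> B \<T>' \<Longrightarrow> ctyp (A # \<Gamma>) N B \<T>'
    \<Longrightarrow> ceq \<Gamma> (CHandle A \<T> (CRet V) H N) (csubst1 V N) B \<T>'"
| ce_handle_let: "ctyp \<Gamma> M A \<T> \<Longrightarrow> ctyp (A # \<Gamma>) N B \<T> \<Longrightarrow> htyp \<Gamma> H \<T> C \<T>'
    \<Longrightarrow> ctyp (B # \<Gamma>) P C \<T>'
    \<Longrightarrow> ceq \<Gamma> (CHandle B \<T> (CLet A M N) H P)
          (CHandle A \<T> M H (CHandle B \<T> N (hren Suc H) (cren (upr Suc) P))) C \<T>'"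
| ce_handle_op: "fmlookup (sig \<T>) op = Some (A, B) \<Longrightarrow> vtyp \<Gamma> V (ty_of A) \<Longrightarrow> htyp \<Gamma> H \<T> C \<T>'
    \<Longrightarrow> ctyp (ty_of B # \<Gamma>) N C \<T>' \<Longrightarrow> fmlookup H op = Some M
    \<Longrightarrow> ceq \<Gamma> (CHandle (ty_of B) \<T> (COp op V) H N)
          (clause_subst V (VLam (ty_of B) C \<T>' N) M) C \<T>'"
| ce_axiom: "(\<Delta>, M, N, A) \<in> axs \<T>
    \<Longrightarrow> (\<And>i. i < length \<Delta> \<Longrightarrow> vtyp \<Gamma> (\<sigma> i) (ty_of (\<Delta> ! i)))
    \<Longrightarrow> ceq \<Gamma> (csubst \<sigma> (comp_of \<T> M)) (csubst \<sigma> (comp_of \<T> N)) (ty_of A) \<T>"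

text \<open>The interpretation below needs the (unique) type of a well-typed value.\<close>

fun parts :: "('b, 'op) ty \<Rightarrow> ('b, 'op) ty list" where
  "parts (TProd As) = As"
| "parts (TSum As) = As"
| "parts _ = []"

fun gparts :: "'b gty \<Rightarrow> 'b gty list" where
  "gparts (GProd As) = As"
| "gparts (GSum As) = As"
| "gparts _ = []"

fun vty :: "('b, 'op) ty list \<Rightarrow> ('b, 'op) val \<Rightarrow> ('b, 'op) ty" where
  "vty \<Gamma> (VVar n) = \<Gamma> ! n"
| "vty \<Gamma> (VTup Vs) = TProd (map (vty \<Gamma>) Vs)"
| "vty \<Gamma> (VProj i V) = parts (vty \<Gamma> V) ! i"
| "vty \<Gamma> (VInj As i V) = TSum As"
| "vty \<Gamma> (VLam A B \<T> M) = TFun A B \<T>"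

primrec gvty :: "'b gty list \<Rightarrow> 'b gval \<Rightarrow> 'b gty" where
  "gvty \<Delta> (GVar n) = \<Delta> ! n"
| "gvty \<Delta> (GTup Vs) = GProd (map (gvty \<Delta>) Vs)"
| "gvty \<Delta> (GProj i V) = gparts (gvty \<Delta> V) ! i"
| "gvty \<Delta> (GInj As i V) = GSum As"


section \<open>Models\<close>

text \<open>
  The data of a model, with arrows carrying their domain and codomain.
  \<^item> \<open>Prd\<close>, \<open>Prj\<close>, \<open>Tup\<close>: chosen finite products, projections, and tupling
    (the first argument of \<open>Tup\<close> is the domain, needed for the empty tuple).
  \<^item> \<open>Cop\<close>, \<open>Inc\<close>: coproduct objects and injections, shared by all the monads;
    \<open>Cot \<T> Z Xs Y fs\<close> is the copairing \<open>Z \<times> Cop Xs \<rightarrow> T\<^sub>\<T> Y\<close>.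
  \<^item> \<open>TO\<close>, \<open>TM\<close>, \<open>Eta\<close>, \<open>Mu\<close>, \<open>St\<close>: the strong monads; \<open>St \<T> X Y : X \<times> T\<^sub>\<T> Y \<rightarrow> T\<^sub>\<T> (X \<times> Y)\<close>.
  \<^item> \<open>KExp \<T> Y Z\<close>, \<open>KEv \<T> Y Z\<close>: the Kleisli exponential \<open>Y \<Rightarrow>\<^sub>\<T> Z\<close> and its evaluation
    \<open>(Y \<Rightarrow>\<^sub>\<T> Z) \<times> Y \<rightarrow> T\<^sub>\<T> Z\<close>; \<open>KCur \<T> X Y Z f : X \<rightarrow> (Y \<Rightarrow>\<^sub>\<T> Z)\<close> is the transpose of
    \<open>f : X \<times> Y \<rightarrow> T\<^sub>\<T> Z\<close>.
  \<^item> \<open>Bas\<close>, \<open>Opn\<close>: the interpretations of base types and operations.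
  \<^item> \<open>Hdl \<T> \<T>' X h f\<close>: the component of \<open>handle\<close> at the common domain of \<open>h\<close> and \<open>f\<close>.
\<close>

record ('o, 'm, 'b, 'op) eff_structure =
  Ob :: "'o set"
  Arr :: "'m set"
  Dom :: "'m \<Rightarrow> 'o"
  Cod :: "'m \<Rightarrow> 'o"
  Ide :: "'o \<Rightarrow> 'm"
  Cmp :: "'m \<Rightarrow> 'm \<Rightarrow> 'm"
  Prd :: "'o list \<Rightarrow> 'o"
  Prj :: "'o list \<Rightarrow> nat \<Rightarrow> 'm"
  Tup :: "'o \<Rightarrow> 'm list \<Rightarrow> 'm"
  Cop :: "'o list \<Rightarrow> 'o"
  Inc :: "'o list \<Rightarrow> nat \<Rightarrow> 'm"
  Cot :: "('b, 'op) effthy \<Rightarrow> 'o \<Rightarrow> 'o list \<Rightarrow> 'o \<Rightarrow> 'm list \<Rightarrow> 'm"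
  TO :: "('b, 'op) effthy \<Rightarrow> 'o \<Rightarrow> 'o"
  TM :: "('b, 'op) effthy \<Rightarrow> 'm \<Rightarrow> 'm"
  Eta :: "('b, 'op) effthy \<Rightarrow> 'o \<Rightarrow> 'm"
  Mu :: "('b, 'op) effthy \<Rightarrow> 'o \<Rightarrow> 'm"
  St :: "('b, 'op) effthy \<Rightarrow> 'o \<Rightarrow> 'o \<Rightarrow> 'm"
  KExp :: "('b, 'op) effthy \<Rightarrow> 'o \<Rightarrow> 'o \<Rightarrow> 'o"
  KEv :: "('b, 'op) effthy \<Rightarrow> 'o \<Rightarrow> 'o \<Rightarrow> 'm"
  KCur :: "('b, 'op) effthy \<Rightarrow> 'o \<Rightarrow> 'o \<Rightarrow> 'o \<Rightarrow> 'm \<Rightarrow> 'm"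
  Bas :: "'b \<Rightarrow> 'o"
  Opn :: "('b, 'op) effthy \<Rightarrow> 'op \<Rightarrow> 'm"
  Hdl :: "('b, 'op) effthy \<Rightarrow> ('b, 'op) effthy \<Rightarrow> 'o \<Rightarrow> 'm \<Rightarrow> 'm \<Rightarrow> 'm"

text \<open>The factors of the finite product over the operations of a signature are listed in an
  arbitrary but fixed order.\<close>

definition ops :: "('b, 'op) effthy \<Rightarrow> 'op list" where
  "ops \<T> = (SOME xs. distinct xs \<and> set xs = fset (fmdom (sig \<T>)))"

definition op_index :: "('b, 'op) effthy \<Rightarrow> 'op \<Rightarrow> nat" where
  "op_index \<T> op = length (takeWhile (\<lambda>op'. op' \<noteq> op) (ops \<T>))"

context
  fixes \<MM> :: "('o, 'm, 'b, 'op) eff_structure"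
begin

abbreviation cmp (infixr "\<cdot>" 65) where "g \<cdot> f \<equiv> Cmp \<MM> g f"
abbreviation bprd (infixr "\<otimes>" 75) where "X \<otimes> Y \<equiv> Prd \<MM> [X, Y]"
abbreviation fst_arr ("\<pi>\<^sub>1") where "\<pi>\<^sub>1 X Y \<equiv> Prj \<MM> [X, Y] 0"
abbreviation snd_arr ("\<pi>\<^sub>2") where "\<pi>\<^sub>2 X Y \<equiv> Prj \<MM> [X, Y] 1"
abbreviation unit_ob ("\<one>") where "\<one> \<equiv> Prd \<MM> []"

definition hom :: "'o \<Rightarrow> 'o \<Rightarrow> 'm set" where
  "hom X Y = {f \<in> Arr \<MM>. Dom \<MM> f = X \<and> Cod \<MM> f = Y}"

definition pair :: "'m \<Rightarrow> 'm \<Rightarrow> 'm" where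
  "pair f g = Tup \<MM> (Dom \<MM> f) [f, g]"

definition cross :: "'m \<Rightarrow> 'm \<Rightarrow> 'm" where
  "cross f g = pair (f \<cdot> \<pi>\<^sub>1 (Dom \<MM> f) (Dom \<MM> g)) (g \<cdot> \<pi>\<^sub>2 (Dom \<MM> f) (Dom \<MM> g))"

definition swap :: "'o \<Rightarrow> 'o \<Rightarrow> 'm" where
  "swap X Y = pair (\<pi>\<^sub>2 X Y) (\<pi>\<^sub>1 X Y)"

text \<open>\<open>assoc_r X Y Z : (X \<times> Y) \<times> Z \<rightarrow> X \<times> (Y \<times> Z)\<close>, with inverse \<open>assoc_l X Y Z\<close>.\<close>

definition assoc_r :: "'o \<Rightarrow> 'o \<Rightarrow> 'o \<Rightarrow> 'm" where
  "assoc_r X Y Z = pair (\<pi>\<^sub>1 X Y \<cdot> \<pi>\<^sub>1 (X \<otimes> Y) Z) (pair (\<pi>\<^sub>2 X Y \<cdot> \<pi>\<^sub>1 (X \<otimes> Y) Z) (\<pi>\<^sub>2 (X \<otimes> Y) Z))"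

definition assoc_l :: "'o \<Rightarrow> 'o \<Rightarrow> 'o \<Rightarrow> 'm" where
  "assoc_l X Y Z = pair (pair (\<pi>\<^sub>1 X (Y \<otimes> Z)) (\<pi>\<^sub>1 Y Z \<cdot> \<pi>\<^sub>2 X (Y \<otimes> Z))) (\<pi>\<^sub>2 Y Z \<cdot> \<pi>\<^sub>2 X (Y \<otimes> Z))"

definition is_category :: bool where
  "is_category \<longleftrightarrow>
    (\<forall>f \<in> Arr \<MM>. Dom \<MM> f \<in> Ob \<MM> \<and> Cod \<MM> f \<in> Ob \<MM>) \<and>
    (\<forall>X \<in> Ob \<MM>. Ide \<MM> X \<in> hom X X) \<and>
    (\<forall>X Y Z. \<forall>f \<in> hom X Y. \<forall>g \<in> hom Y Z. g \<cdot> f \<in> hom X Z) \<and>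
    (\<forall>X Y. \<forall>f \<in> hom X Y. f \<cdot> Ide \<MM> X = f \<and> Ide \<MM> Y \<cdot> f = f) \<and>
    (\<forall>W X Y Z. \<forall>f \<in> hom W X. \<forall>g \<in> hom X Y. \<forall>h \<in> hom Y Z. (h \<cdot> g) \<cdot> f = h \<cdot> (g \<cdot> f))"

definition has_products :: bool where
  "has_products \<longleftrightarrow>
    (\<forall>Xs. set Xs \<subseteq> Ob \<MM> \<longrightarrow>
      Prd \<MM> Xs \<in> Ob \<MM> \<and>
      (\<forall>i < length Xs. Prj \<MM> Xs i \<in> hom (Prd \<MM> Xs) (Xs ! i)) \<and>
      (\<forall>Z \<in> Ob \<MM>. \<forall>fs. list_all2 (\<lambda>f X. f \<in> hom Z X) fs Xs \<longrightarrow>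
        Tup \<MM> Z fs \<in> hom Z (Prd \<MM> Xs) \<and>
        (\<forall>i < length Xs. Prj \<MM> Xs i \<cdot> Tup \<MM> Z fs = fs ! i) \<and>
        (\<forall>g \<in> hom Z (Prd \<MM> Xs).
          (\<forall>i < length Xs. Prj \<MM> Xs i \<cdot> g = fs ! i) \<longrightarrow> g = Tup \<MM> Z fs)))"

definition is_strong_monad :: "('b, 'op) effthy \<Rightarrow> bool" where
  "is_strong_monad \<T> \<longleftrightarrow>
    \<comment> \<open>functor\<close>
    (\<forall>X \<in> Ob \<MM>. TO \<MM> \<T> X \<in> Ob \<MM> \<and> TM \<MM> \<T> (Ide \<MM> X) = Ide \<MM> (TO \<MM> \<T> X)) \<and>
    (\<forall>X Y. \<forall>f \<in> hom X Y. TM \<MM> \<T> f \<in> hom (TO \<MM> \<T> X) (TO \<MM> \<T> Y)) \<and>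
    (\<forall>X Y Z. \<forall>f \<in> hom X Y. \<forall>g \<in> hom Y Z. TM \<MM> \<T> (g \<cdot> f) = TM \<MM> \<T> g \<cdot> TM \<MM> \<T> f) \<and>
    \<comment> \<open>monad\<close>
    (\<forall>X \<in> Ob \<MM>. Eta \<MM> \<T> X \<in> hom X (TO \<MM> \<T> X) \<and>
                 Mu \<MM> \<T> X \<in> hom (TO \<MM> \<T> (TO \<MM> \<T> X)) (TO \<MM> \<T> X)) \<and>
    (\<forall>X Y. \<forall>f \<in> hom X Y.
      Eta \<MM> \<T> Y \<cdot> f = TM \<MM> \<T> f \<cdot> Eta \<MM> \<T> X \<and>
      Mu \<MM> \<T> Y \<cdot> TM \<MM> \<T> (TM \<MM> \<T> f) = TM \<MM> \<T> f \<cdot> Mu \<MM> \<T> X) \<and>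
    (\<forall>X \<in> Ob \<MM>.
      Mu \<MM> \<T> X \<cdot> Eta \<MM> \<T> (TO \<MM> \<T> X) = Ide \<MM> (TO \<MM> \<T> X) \<and>
      Mu \<MM> \<T> X \<cdot> TM \<MM> \<T> (Eta \<MM> \<T> X) = Ide \<MM> (TO \<MM> \<T> X) \<and>
      Mu \<MM> \<T> X \<cdot> Mu \<MM> \<T> (TO \<MM> \<T> X) = Mu \<MM> \<T> X \<cdot> TM \<MM> \<T> (Mu \<MM> \<T> X)) \<and>
    \<comment> \<open>strength\<close>
    (\<forall>X \<in> Ob \<MM>. \<forall>Y \<in> Ob \<MM>. St \<MM> \<T> X Y \<in> hom (X \<otimes> TO \<MM> \<T> Y) (TO \<MM> \<T> (X \<otimes> Y))) \<and>
    (\<forall>X X' Y Y'. \<forall>f \<in> hom X X'. \<forall>g \<in> hom Y Y'.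
      St \<MM> \<T> X' Y' \<cdot> cross f (TM \<MM> \<T> g) = TM \<MM> \<T> (cross f g) \<cdot> St \<MM> \<T> X Y) \<and>
    (\<forall>Y \<in> Ob \<MM>. TM \<MM> \<T> (\<pi>\<^sub>2 \<one> Y) \<cdot> St \<MM> \<T> \<one> Y = \<pi>\<^sub>2 \<one> (TO \<MM> \<T> Y)) \<and>
    (\<forall>X \<in> Ob \<MM>. \<forall>Y \<in> Ob \<MM>. \<forall>Z \<in> Ob \<MM>.
      TM \<MM> \<T> (assoc_r X Y Z) \<cdot> St \<MM> \<T> (X \<otimes> Y) Z =
      St \<MM> \<T> X (Y \<otimes> Z) \<cdot> cross (Ide \<MM> X) (St \<MM> \<T> Y Z) \<cdot> assoc_r X Y (TO \<MM> \<T> Z)) \<and>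
    (\<forall>X \<in> Ob \<MM>. \<forall>Y \<in> Ob \<MM>.
      St \<MM> \<T> X Y \<cdot> cross (Ide \<MM> X) (Eta \<MM> \<T> Y) = Eta \<MM> \<T> (X \<otimes> Y) \<and>
      St \<MM> \<T> X Y \<cdot> cross (Ide \<MM> X) (Mu \<MM> \<T> Y) =
      Mu \<MM> \<T> (X \<otimes> Y) \<cdot> TM \<MM> \<T> (St \<MM> \<T> X Y) \<cdot> St \<MM> \<T> X (TO \<MM> \<T> Y))"

definition has_kleisli_exponentials :: "('b, 'op) effthy \<Rightarrow> bool" where
  "has_kleisli_exponentials \<T> \<longleftrightarrow>
    (\<forall>Y \<in> Ob \<MM>. \<forall>Z \<in> Ob \<MM>.
      KExp \<MM> \<T> Y Z \<in> Ob \<MM> \<and>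
      KEv \<MM> \<T> Y Z \<in> hom (KExp \<MM> \<T> Y Z \<otimes> Y) (TO \<MM> \<T> Z) \<and>
      (\<forall>X \<in> Ob \<MM>. \<forall>f \<in> hom (X \<otimes> Y) (TO \<MM> \<T> Z).
        KCur \<MM> \<T> X Y Z f \<in> hom X (KExp \<MM> \<T> Y Z) \<and>
        KEv \<MM> \<T> Y Z \<cdot> cross (KCur \<MM> \<T> X Y Z f) (Ide \<MM> Y) = f \<and>
        (\<forall>g \<in> hom X (KExp \<MM> \<T> Y Z).
          KEv \<MM> \<T> Y Z \<cdot> cross g (Ide \<MM> Y) = f \<longrightarrow> g = KCur \<MM> \<T> X Y Z f)))"

text \<open>
  Joint distributive Kleisli coproducts: \<open>Cop Xs\<close> with the injections \<open>Inc Xs i\<close> does not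
  depend on the monad, and for every monad the arrows \<open>Z \<times> Inc Xs i\<close> form a coproduct
  diagram in the Kleisli category.
\<close>

definition has_kleisli_coproducts :: bool where
  "has_kleisli_coproducts \<longleftrightarrow>
    (\<forall>Xs. set Xs \<subseteq> Ob \<MM> \<longrightarrow>
      Cop \<MM> Xs \<in> Ob \<MM> \<and>
      (\<forall>i < length Xs. Inc \<MM> Xs i \<in> hom (Xs ! i) (Cop \<MM> Xs)) \<and>
      (\<forall>\<T>. \<forall>Z \<in> Ob \<MM>. \<forall>Y \<in> Ob \<MM>. \<forall>fs.
        list_all2 (\<lambda>f X. f \<in> hom (Z \<otimes> X) (TO \<MM> \<T> Y)) fs Xs \<longrightarrow>
        Cot \<MM> \<T> Z Xs Y fs \<in> hom (Z \<otimes> Cop \<MM> Xs) (TO \<MM> \<T> Y) \<and>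
        (\<forall>i < length Xs. Cot \<MM> \<T> Z Xs Y fs \<cdot> cross (Ide \<MM> Z) (Inc \<MM> Xs i) = fs ! i) \<and>
        (\<forall>g \<in> hom (Z \<otimes> Cop \<MM> Xs) (TO \<MM> \<T> Y).
          (\<forall>i < length Xs. g \<cdot> cross (Ide \<MM> Z) (Inc \<MM> Xs i) = fs ! i) \<longrightarrow>
          g = Cot \<MM> \<T> Z Xs Y fs)))"

primrec tyI :: "('b, 'op) ty \<Rightarrow> 'o" where
  "tyI (TBase b) = Bas \<MM> b"
| "tyI (TProd As) = Prd \<MM> (map tyI As)"
| "tyI (TSum As) = Cop \<MM> (map tyI As)"
| "tyI (TFun A B \<T>) = KExp \<MM> \<T> (tyI A) (tyI B)"

abbreviation gtyI :: "'b gty \<Rightarrow> 'o" where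
  "gtyI A \<equiv> tyI (ty_of A)"

text \<open>
  \<open>ctxI Z [X\<^sub>0, \<dots>, X\<^sub>n]\<close> is \<open>(Z \<times> X\<^sub>n) \<times> \<dots> \<times> X\<^sub>0\<close>. Contexts of the calculus are interpreted over
  \<open>Z = 1\<close>; other base objects \<open>Z\<close> occur in the interpretation of effect theory terms
  as operations on handlers.
\<close>

primrec ctxI :: "'o \<Rightarrow> 'o list \<Rightarrow> 'o" where
  "ctxI Z [] = Z"
| "ctxI Z (X # Xs) = ctxI Z Xs \<otimes> X"

primrec baseI :: "'o \<Rightarrow> 'o list \<Rightarrow> 'm" where
  "baseI Z [] = Ide \<MM> Z"
| "baseI Z (X # Xs) = baseI Z Xs \<cdot> \<pi>\<^sub>1 (ctxI Z Xs) X"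

primrec varI :: "'o \<Rightarrow> 'o list \<Rightarrow> nat \<Rightarrow> 'm" where
  "varI Z [] n = undefined"
| "varI Z (X # Xs) n =
    (case n of 0 \<Rightarrow> \<pi>\<^sub>2 (ctxI Z Xs) X | Suc m \<Rightarrow> varI Z Xs m \<cdot> \<pi>\<^sub>1 (ctxI Z Xs) X)"

text \<open>Given \<open>f : G \<rightarrow> T\<^sub>\<T> X\<close> and \<open>g : G \<times> X \<rightarrow> Y\<close>, this is \<open>T\<^sub>\<T> g \<circ> st \<circ> \<langle>id, f\<rangle> : G \<rightarrow> T\<^sub>\<T> Y\<close>.\<close>

definition strmap :: "('b, 'op) effthy \<Rightarrow> 'o \<Rightarrow> 'o \<Rightarrow> 'm \<Rightarrow> 'm \<Rightarrow> 'm" where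
  "strmap \<T> G X f g = TM \<MM> \<T> g \<cdot> St \<MM> \<T> G X \<cdot> pair (Ide \<MM> G) f"


subsection \<open>Effect theory terms in a model\<close>

primrec gvI :: "'o \<Rightarrow> 'b gty list \<Rightarrow> 'b gval \<Rightarrow> 'm" where
  "gvI Z \<Delta> (GVar n) = varI Z (map gtyI \<Delta>) n"
| "gvI Z \<Delta> (GTup Vs) = Tup \<MM> (ctxI Z (map gtyI \<Delta>)) (map (gvI Z \<Delta>) Vs)"
| "gvI Z \<Delta> (GProj i V) = Prj \<MM> (map gtyI (gparts (gvty \<Delta> V))) i \<cdot> gvI Z \<Delta> V"
| "gvI Z \<Delta> (GInj As i V) = Inc \<MM> (map gtyI As) i \<cdot> gvI Z \<Delta> V"

text \<open>The monadic interpretation \<open>gcI \<T> C M \<Delta> : \<lbrakk>\<Delta>\<rbrakk> \<rightarrow> T\<^sub>\<T> \<lbrakk>C\<rbrakk>\<close> of \<open>\<Delta> \<turnstile> M : C!\<Sigma>\<close>.\<close>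

primrec gcI :: "('b, 'op) effthy \<Rightarrow> 'b gty \<Rightarrow> ('b, 'op) gcomp \<Rightarrow> 'b gty list \<Rightarrow> 'm" where
  "gcI \<T> C (GRet V) = (\<lambda>\<Delta>. Eta \<MM> \<T> (gtyI C) \<cdot> gvI \<one> \<Delta> V)"
| "gcI \<T> C (GLet op V M) = (\<lambda>\<Delta>.
     Mu \<MM> \<T> (gtyI C) \<cdot>
     strmap \<T> (ctxI \<one> (map gtyI \<Delta>)) (gtyI (resty \<T> op))
       (Opn \<MM> \<T> op \<cdot> gvI \<one> \<Delta> V) (gcI \<T> C M (resty \<T> op # \<Delta>)))"
| "gcI \<T> C (GCase V Ms) = (\<lambda>\<Delta>.
     (let G = ctxI \<one> (map gtyI \<Delta>); As = gparts (gvty \<Delta> V) in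
      Cot \<MM> \<T> G (map gtyI As) (gtyI C) (map2 (\<lambda>A m. m (A # \<Delta>)) As (map (gcI \<T> C) Ms))
      \<cdot> pair (Ide \<MM> G) (gvI \<one> \<Delta> V)))"

text \<open>The factor of the handler object at \<open>op\<close>, \<open>(A\<^sub>o\<^sub>p \<times> (B\<^sub>o\<^sub>p \<Rightarrow>\<^sub>\<T>' X)) \<Rightarrow>\<^sub>\<T>' X\<close>, is the Kleisli
  exponential from \<open>clause_dom\<close> to \<open>X\<close>.\<close>

definition clause_dom :: "('b, 'op) effthy \<Rightarrow> ('b, 'op) effthy \<Rightarrow> 'o \<Rightarrow> 'op \<Rightarrow> 'o" where
  "clause_dom \<T> \<T>' X op = gtyI (argty \<T> op) \<otimes> KExp \<MM> \<T>' (gtyI (resty \<T> op)) X"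

definition handler_factors :: "('b, 'op) effthy \<Rightarrow> ('b, 'op) effthy \<Rightarrow> 'o \<Rightarrow> 'o list" where
  "handler_factors \<T> \<T>' X = map (\<lambda>op. KExp \<MM> \<T>' (clause_dom \<T> \<T>' X op) X) (ops \<T>)"

definition handler_ob :: "('b, 'op) effthy \<Rightarrow> ('b, 'op) effthy \<Rightarrow> 'o \<Rightarrow> 'o" where
  "handler_ob \<T> \<T>' X = Prd \<MM> (handler_factors \<T> \<T>' X)"

definition handler_proj :: "('b, 'op) effthy \<Rightarrow> ('b, 'op) effthy \<Rightarrow> 'o \<Rightarrow> 'op \<Rightarrow> 'm" where
  "handler_proj \<T> \<T>' X op = Prj \<MM> (handler_factors \<T> \<T>' X) (op_index \<T> op)"

text \<open>
  Effect theory terms as operations on handlers: for \<open>h : Z \<rightarrow> handler_ob \<T> \<T>' X\<close>,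
  \<open>k : Z \<rightarrow> (\<lbrakk>C\<rbrakk> \<Rightarrow>\<^sub>\<T>' X)\<close> and \<open>\<Delta> \<turnstile> M : C!\<Sigma>\<close>, this is an arrow \<open>ctxI Z \<lbrakk>\<Delta>\<rbrakk> \<rightarrow> T\<^sub>\<T>' X\<close>, the
  semantic counterpart of \<^const>\<open>hinst\<close>.
\<close>

primrec hcI ::
  "('b, 'op) effthy \<Rightarrow> ('b, 'op) effthy \<Rightarrow> 'o \<Rightarrow> 'o \<Rightarrow> 'm \<Rightarrow> 'm \<Rightarrow> 'b gty \<Rightarrow>
   ('b, 'op) gcomp \<Rightarrow> 'b gty list \<Rightarrow> 'm" where
  "hcI \<T> \<T>' X Z h k C (GRet V) = (\<lambda>\<Delta>.
     KEv \<MM> \<T>' (gtyI C) X \<cdot> pair (k \<cdot> baseI Z (map gtyI \<Delta>)) (gvI Z \<Delta> V))"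
| "hcI \<T> \<T>' X Z h k C (GLet op V M) = (\<lambda>\<Delta>.
     KEv \<MM> \<T>' (clause_dom \<T> \<T>' X op) X \<cdot>
     pair (handler_proj \<T> \<T>' X op \<cdot> h \<cdot> baseI Z (map gtyI \<Delta>))
       (pair (gvI Z \<Delta> V)
         (KCur \<MM> \<T>' (ctxI Z (map gtyI \<Delta>)) (gtyI (resty \<T> op)) X
           (hcI \<T> \<T>' X Z h k C M (resty \<T> op # \<Delta>)))))"
| "hcI \<T> \<T>' X Z h k C (GCase V Ms) = (\<lambda>\<Delta>.
     (let G = ctxI Z (map gtyI \<Delta>); As = gparts (gvty \<Delta> V) in
      Cot \<MM> \<T>' G (map gtyI As) X
        (map2 (\<lambda>A m. m (A # \<Delta>)) As (map (hcI \<T> \<T>' X Z h k C) Ms))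
      \<cdot> pair (Ide \<MM> G) (gvI Z \<Delta> V)))"

text \<open>
  \<open>handlers \<T> \<T>' X Z\<close> is the value at \<open>Z\<close> of the presheaf of handlers satisfying the axioms
  of \<open>\<T>\<close>. The continuation of an axiom of type \<open>A\<close> is the generic one, over
  \<open>Z \<times> (\<lbrakk>A\<rbrakk> \<Rightarrow>\<^sub>\<T>' X)\<close>.
\<close>

definition handlers :: "('b, 'op) effthy \<Rightarrow> ('b, 'op) effthy \<Rightarrow> 'o \<Rightarrow> 'o \<Rightarrow> 'm set" where
  "handlers \<T> \<T>' X Z =
    {h \<in> hom Z (handler_ob \<T> \<T>' X).
      \<forall>(\<Delta>, M, N, A) \<in> axs \<T>.
        let K = KExp \<MM> \<T>' (gtyI A) X in
        hcI \<T> \<T>' X (Z \<otimes> K) (h \<cdot> \<pi>\<^sub>1 Z K) (\<pi>\<^sub>2 Z K) A M \<Delta> =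
        hcI \<T> \<T>' X (Z \<otimes> K) (h \<cdot> \<pi>\<^sub>1 Z K) (\<pi>\<^sub>2 Z K) A N \<Delta>}"

definition interprets_ops :: "('b, 'op) effthy \<Rightarrow> bool" where
  "interprets_ops \<T> \<longleftrightarrow>
    (\<forall>op A B. fmlookup (sig \<T>) op = Some (A, B) \<longrightarrow>
      Opn \<MM> \<T> op \<in> hom (gtyI A) (TO \<MM> \<T> (gtyI B))) \<and>
    (\<forall>(\<Delta>, M, N, A) \<in> axs \<T>. gcI \<T> A M \<Delta> = gcI \<T> A N \<Delta>)"

definition has_handle :: "('b, 'op) effthy \<Rightarrow> ('b, 'op) effthy \<Rightarrow> bool" where
  "has_handle \<T> \<T>' \<longleftrightarrow>
    (\<forall>X \<in> Ob \<MM>. \<forall>Z \<in> Ob \<MM>. \<forall>h \<in> handlers \<T> \<T>' X Z.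
      \<comment> \<open>typing and naturality\<close>
      (\<forall>f \<in> hom Z (TO \<MM> \<T> (TO \<MM> \<T>' X)).
        Hdl \<MM> \<T> \<T>' X h f \<in> hom Z (TO \<MM> \<T>' X) \<and>
        (\<forall>Z'. \<forall>g \<in> hom Z' Z. Hdl \<MM> \<T> \<T>' X (h \<cdot> g) (f \<cdot> g) = Hdl \<MM> \<T> \<T>' X h f \<cdot> g)) \<and>
      \<comment> \<open>unit\<close>
      (\<forall>f \<in> hom Z (TO \<MM> \<T>' X). Hdl \<MM> \<T> \<T>' X h (Eta \<MM> \<T> (TO \<MM> \<T>' X) \<cdot> f) = f) \<and>
      \<comment> \<open>multiplication\<close>
      (\<forall>f \<in> hom Z (TO \<MM> \<T> (TO \<MM> \<T> (TO \<MM> \<T>' X))).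
        let Y = TO \<MM> \<T> (TO \<MM> \<T>' X) in
        Hdl \<MM> \<T> \<T>' X h (Mu \<MM> \<T> (TO \<MM> \<T>' X) \<cdot> f) =
        Hdl \<MM> \<T> \<T>' X h (strmap \<T> Z Y f (Hdl \<MM> \<T> \<T>' X (h \<cdot> \<pi>\<^sub>1 Z Y) (\<pi>\<^sub>2 Z Y)))) \<and>
      \<comment> \<open>operations\<close>
      (\<forall>op A B. fmlookup (sig \<T>) op = Some (A, B) \<longrightarrow>
        (let K = KExp \<MM> \<T>' (gtyI B) X in
         \<forall>f \<in> hom Z (gtyI A \<otimes> K).
          Hdl \<MM> \<T> \<T>' X h
            (TM \<MM> \<T> (KEv \<MM> \<T>' (gtyI B) X) \<cdot> St \<MM> \<T> K (gtyI B) \<cdot> swap (TO \<MM> \<T> (gtyI B)) K \<cdot>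
             cross (Opn \<MM> \<T> op) (Ide \<MM> K) \<cdot> f) =
          KEv \<MM> \<T>' (gtyI A \<otimes> K) X \<cdot> pair (handler_proj \<T> \<T>' X op \<cdot> h) f)))"

definition eff_model :: bool where
  "eff_model \<longleftrightarrow>
    is_category \<and> has_products \<and> has_kleisli_coproducts \<and>
    (\<forall>\<T>. is_strong_monad \<T> \<and> has_kleisli_exponentials \<T>) \<and>
    (\<forall>b. Bas \<MM> b \<in> Ob \<MM>) \<and>
    (\<forall>\<T>. interprets_ops \<T>) \<and> (\<forall>\<T> \<T>'. has_handle \<T> \<T>')"


subsection \<open>Interpretation of the calculus\<close>

text \<open>
  For \<open>\<Gamma> \<turnstile> V : A\<close> and \<open>\<Gamma> \<turnstile> M : C!\<T>\<close> we get \<open>vI V \<Gamma> : \<lbrakk>\<Gamma>\<rbrakk> \<rightarrow> \<lbrakk>A\<rbrakk>\<close> and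
  \<open>cI M \<Gamma> C \<T> : \<lbrakk>\<Gamma>\<rbrakk> \<rightarrow> T\<^sub>\<T> \<lbrakk>C\<rbrakk>\<close>.
\<close>

abbreviation envI :: "('b, 'op) ty list \<Rightarrow> 'o" where
  "envI \<Gamma> \<equiv> ctxI \<one> (map tyI \<Gamma>)"

primrec vI :: "('b, 'op) val \<Rightarrow> ('b, 'op) ty list \<Rightarrow> 'm"
  and cI :: "('b, 'op) comp \<Rightarrow> ('b, 'op) ty list \<Rightarrow> ('b, 'op) ty \<Rightarrow> ('b, 'op) effthy \<Rightarrow> 'm" where
  "vI (VVar n) = (\<lambda>\<Gamma>. varI \<one> (map tyI \<Gamma>) n)"
| "vI (VTup Vs) = (\<lambda>\<Gamma>. Tup \<MM> (envI \<Gamma>) (map (\<lambda>v. v \<Gamma>) (map vI Vs)))"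
| "vI (VProj i V) = (\<lambda>\<Gamma>. Prj \<MM> (map tyI (parts (vty \<Gamma> V))) i \<cdot> vI V \<Gamma>)"
| "vI (VInj As i V) = (\<lambda>\<Gamma>. Inc \<MM> (map tyI As) i \<cdot> vI V \<Gamma>)"
| "vI (VLam A B \<T> M) = (\<lambda>\<Gamma>. KCur \<MM> \<T> (envI \<Gamma>) (tyI A) (tyI B) (cI M (A # \<Gamma>) B \<T>))"
| "cI (CRet V) = (\<lambda>\<Gamma> C \<T>. Eta \<MM> \<T> (tyI C) \<cdot> vI V \<Gamma>)"
| "cI (CLet A M N) = (\<lambda>\<Gamma> C \<T>.
     Mu \<MM> \<T> (tyI C) \<cdot> strmap \<T> (envI \<Gamma>) (tyI A) (cI M \<Gamma> A \<T>) (cI N (A # \<Gamma>) C \<T>))"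
| "cI (CApp V W) = (\<lambda>\<Gamma> C \<T>. KEv \<MM> \<T> (tyI (vty \<Gamma> W)) (tyI C) \<cdot> pair (vI V \<Gamma>) (vI W \<Gamma>))"
| "cI (CCase V Ms) = (\<lambda>\<Gamma> C \<T>.
     (let As = parts (vty \<Gamma> V) in
      Cot \<MM> \<T> (envI \<Gamma>) (map tyI As) (tyI C) (map2 (\<lambda>A m. m (A # \<Gamma>) C \<T>) As (map cI Ms))
      \<cdot> pair (Ide \<MM> (envI \<Gamma>)) (vI V \<Gamma>)))"
| "cI (COp op V) = (\<lambda>\<Gamma> C \<T>. Opn \<MM> \<T> op \<cdot> vI V \<Gamma>)"
| "cI (CHandle A \<T> M H N) = (\<lambda>\<Gamma> C \<T>'.
     Hdl \<MM> \<T> \<T>' (tyI C)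
       (Tup \<MM> (envI \<Gamma>)
         (map (\<lambda>op.
            let P = ty_of (argty \<T> op); K = TFun (ty_of (resty \<T> op)) C \<T>' in
            KCur \<MM> \<T>' (envI \<Gamma>) (clause_dom \<T> \<T>' (tyI C) op) (tyI C)
              (the (fmlookup (fmmap cI H) op) (K # P # \<Gamma>) C \<T>'
               \<cdot> assoc_l (envI \<Gamma>) (tyI P) (tyI K)))
          (ops \<T>)))
       (strmap \<T> (envI \<Gamma>) (tyI A) (cI M \<Gamma> A \<T>) (cI N (A # \<Gamma>) C \<T>')))"

end

end

(*
  Completeness by a term model. Objects are types, arrows from A to B are values of type B in the
  context [A] modulo provable equality, and composition is substitution. The monad of an effect
  theory sends A to the thunk type 1 -> A!T, Kleisli exponentials are function types, and handle
  is interpreted by the syntactic handler: a semantic handler h in the model is a tuple of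
  functions, which yields a handler whose clauses apply these functions. The semantic action of
  effect theory terms on h agrees with the syntactic one, so if h satisfies the axioms then its
  syntactic handler is well typed. A computation M in context Gamma is then interpreted by
  the thunk of M with its variables replaced by the projections from the product of Gamma;
  equality of interpretations is thus provable equality of these thunks, and substituting the
  tuple of the variables and forcing gives M = N.
*)
theory Submission
  imports Defs
begin

section \<open>Substitution calculus\<close>

text \<open>The obstacle is that typing and equality form one mutual induction: a handler is typable
  only if its axiom equations are provable. Substitution lemmas must therefore treat typing and
  equality at once, and the operation \<open>Hdl\<close> behaves well only where those provable
  equations can be recovered from the semantic axiom condition. Recovery is possible because Kleisli
  exponentials are function types: the handler object is itself a type of the calculus, a semantic
  handler is a value of it, and the generic continuation in \<open>handlers\<close> is a projection.
  A second mismatch is that the calculus has flat contexts while the model has nested binary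
  products. \<open>ebs\<close> reads variables off a nested tuple and \<open>vtup\<close> builds the
  tuple of variables; every comparison of syntax with semantics passes through these two. The thunk
  type has unit domain because a computation is not a value; since every value of unit type equals
  the empty tuple, thunking and forcing are mutually inverse up to provable equality. Equality
  classes are given by chosen representatives, so every operation on arrows must be shown to respect
  provable equality, in particular handling.\<close>

lemma upr_simps [simp]: "upr \<xi> 0 = 0" "upr \<xi> (Suc n) = Suc (\<xi> n)"
  by (simp_all add: upr_def)

lemma up_simps [simp]: "up \<sigma> 0 = VVar 0" "up \<sigma> (Suc n) = vren Suc (\<sigma> n)"
  by (simp_all add: up_def)

lemma scons_simps [simp]: "scons V \<sigma> 0 = V" "scons V \<sigma> (Suc n) = \<sigma> n"
  by (simp_all add: scons_def)

lemma upr_upr: "upr \<xi> \<circ> upr \<zeta> = upr (\<xi> \<circ> \<zeta>)"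
  by (rule ext) (simp add: upr_def split: nat.split)

text \<open>The four composition laws come in a fixed order: renaming after renaming, the two mixed
  laws, substitution after substitution. Each induction must commute the composite with lifting
  under a binder; \<open>upr_up\<close> uses the first law for this and \<open>up_up\<close> uses
  both mixed ones.\<close>

lemma
  fixes V :: "('b, 'op) val" and M :: "('b, 'op) comp"
  shows vren_vren: "vren \<xi> (vren \<zeta> V) = vren (\<xi> \<circ> \<zeta>) V"
  and cren_cren: "cren \<xi> (cren \<zeta> M) = cren (\<xi> \<circ> \<zeta>) M"
  by (induction V and M arbitrary: \<xi> \<zeta> and \<xi> \<zeta>)
    (auto simp: upr_upr fmap.map_comp intro!: fmap.map_cong0)

lemma up_upr: "up \<sigma> \<circ> upr \<xi> = up (\<sigma> \<circ> \<xi>)"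
  by (rule ext) (simp add: up_def upr_def split: nat.split)

lemma vsubst_vren: "vsubst \<sigma> (vren \<xi> V) = vsubst (\<sigma> \<circ> \<xi>) V"
  and csubst_cren: "csubst \<sigma> (cren \<xi> M) = csubst (\<sigma> \<circ> \<xi>) M"
  by (induction V and M arbitrary: \<sigma> \<xi> and \<sigma> \<xi>)
    (auto simp: up_upr fmap.map_comp intro!: fmap.map_cong0)

lemma upr_up: "vren (upr \<xi>) \<circ> up \<sigma> = up (vren \<xi> \<circ> \<sigma>)"
  by (rule ext) (simp add: up_def upr_def vren_vren comp_def split: nat.split)

lemma vren_vsubst: "vren \<xi> (vsubst \<sigma> V) = vsubst (vren \<xi> \<circ> \<sigma>) V"
  and cren_csubst: "cren \<xi> (csubst \<sigma> M) = csubst (vren \<xi> \<circ> \<sigma>) M"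
  by (induction V and M arbitrary: \<sigma> \<xi> and \<sigma> \<xi>)
    (auto simp: upr_up fmap.map_comp intro!: fmap.map_cong0)

lemma vsubst_up_vren: "vsubst (up \<sigma>) (vren Suc V) = vren Suc (vsubst \<sigma> V)"
  by (simp add: vsubst_vren vren_vsubst) (simp add: comp_def)

lemma up_up: "vsubst (up \<sigma>) \<circ> up \<tau> = up (vsubst \<sigma> \<circ> \<tau>)"
  by (rule ext) (simp add: vsubst_up_vren up_def[of \<tau>] up_def[of "\<lambda>a. vsubst \<sigma> (\<tau> a)"] comp_def split: nat.split)

lemma vsubst_vsubst: "vsubst \<sigma> (vsubst \<tau> V) = vsubst (vsubst \<sigma> \<circ> \<tau>) V"
  and csubst_csubst: "csubst \<sigma> (csubst \<tau> M) = csubst (vsubst \<sigma> \<circ> \<tau>) M"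
  by (induction V and M arbitrary: \<sigma> \<tau> and \<sigma> \<tau>)
    (auto simp: up_up fmap.map_comp intro!: fmap.map_cong0)

lemma up_var: "up (\<lambda>n. VVar (\<xi> n)) = (\<lambda>n. VVar (upr \<xi> n))"
  by (rule ext) (simp add: up_def upr_def split: nat.split)

lemma
  fixes V :: "('b, 'op) val" and M :: "('b, 'op) comp"
  shows vsubst_var: "vsubst (\<lambda>n. VVar (\<xi> n)) V = vren \<xi> V"
  and csubst_var: "csubst (\<lambda>n. VVar (\<xi> n)) M = cren \<xi> M"
  by (induction V and M arbitrary: \<xi> and \<xi>)
    (auto simp: up_var intro!: fmap.map_cong0)

lemma fmmap_idI: "(\<And>x. x \<in> fmran' H \<Longrightarrow> f x = x) \<Longrightarrow> fmmap f H = H"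
  using fmap.map_cong0[of H f id] by (simp add: fmap.map_id)

lemma up_VVar [simp]: "up VVar = VVar"
  by (rule ext) (simp add: up_def split: nat.split)

lemma
  fixes V :: "('b, 'op) val" and M :: "('b, 'op) comp"
  shows vsubst_VVar [simp]: "vsubst VVar V = V"
  and csubst_VVar [simp]: "csubst VVar M = M"
  by (induction V and M)
    (auto simp: map_idI intro!: fmmap_idI)

lemma
  fixes V :: "('b, 'op) val" and M :: "('b, 'op) comp"
  shows vren_id [simp]: "vren (\<lambda>n. n) V = V"
  and cren_id [simp]: "cren (\<lambda>n. n) M = M"
  using vsubst_var[of "\<lambda>n. n" V] csubst_var[of "\<lambda>n. n" M] by auto

text \<open>Kept folded, like \<open>hren\<close>, so that equations about \<open>CHandle\<close>
  move a handler as a whole instead of exposing the finite map of its clauses.\<close>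

definition hsubst :: "(nat \<Rightarrow> ('b, 'op) val) \<Rightarrow> ('b, 'op) handler \<Rightarrow> ('b, 'op) handler" where
  "hsubst \<sigma> H = fmmap (csubst (up (up \<sigma>))) H"

lemma csubst_handle:
  "csubst \<sigma> (CHandle A \<T> M H N) = CHandle A \<T> (csubst \<sigma> M) (hsubst \<sigma> H) (csubst (up \<sigma>) N)"
  by (simp add: hsubst_def)

lemma cren_handle:
  "cren \<xi> (CHandle A \<T> M H N) = CHandle A \<T> (cren \<xi> M) (hren \<xi> H) (cren (upr \<xi>) N)"
  by (simp add: hren_def)

declare csubst.simps(6) [simp del] csubst_handle [simp] cren.simps(6) [simp del] cren_handle [simp]

lemma fmlookup_hsubst [simp]:
    "fmlookup (hsubst \<sigma> H) op = map_option (csubst (up (up \<sigma>))) (fmlookup H op)"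
  and fmdom_hsubst [simp]: "fmdom (hsubst \<sigma> H) = fmdom H"
  by (simp_all add: hsubst_def)

lemma fmlookup_hren [simp]:
    "fmlookup (hren \<xi> H) op = map_option (cren (upr (upr \<xi>))) (fmlookup H op)"
  and fmdom_hren [simp]: "fmdom (hren \<xi> H) = fmdom H"
  by (simp_all add: hren_def)

lemma hsubst_hren: "hsubst \<sigma> (hren \<xi> H) = hsubst (\<sigma> \<circ> \<xi>) H"
  by (simp add: hren_def hsubst_def fmap.map_comp comp_def csubst_cren up_upr[unfolded comp_def])

lemma hren_hsubst: "hren \<xi> (hsubst \<sigma> H) = hsubst (vren \<xi> \<circ> \<sigma>) H"
  by (simp add: hren_def hsubst_def fmap.map_comp comp_def cren_csubst upr_up[unfolded comp_def])

lemma hsubst_var: "hsubst (\<lambda>n. VVar (\<xi> n)) H = hren \<xi> H"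
  by (auto simp: hsubst_def hren_def up_var csubst_var intro!: fmap.map_cong0)

lemma hsubst_VVar [simp]: "hsubst VVar H = H"
  by (simp add: hsubst_def fmmap_idI)

lemma vsubst_scons: "vsubst \<sigma> \<circ> scons V \<tau> = scons (vsubst \<sigma> V) (vsubst \<sigma> \<circ> \<tau>)"
  by (rule ext) (simp add: scons_def split: nat.split)

lemma scons_up: "vsubst (scons V \<sigma>) \<circ> up \<tau> = scons V (vsubst \<sigma> \<circ> \<tau>)"
  by (rule ext) (simp add: up_def scons_def vsubst_vren comp_def split: nat.split)

lemma scons_Suc [simp]: "scons V \<sigma> \<circ> Suc = \<sigma>"
  by (rule ext) simp

lemma vsubst_scons_shift [simp]: "vsubst (scons V \<sigma>) (vren Suc W) = vsubst \<sigma> W"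
  by (simp add: vsubst_vren)

lemma csubst1_cren [simp]: "csubst1 V (cren Suc M) = M"
  by (simp add: csubst1_def csubst_cren)

lemma csubst_csubst1: "csubst \<sigma> (csubst1 V M) = csubst1 (vsubst \<sigma> V) (csubst (up \<sigma>) M)"
  by (simp add: csubst1_def csubst_csubst vsubst_scons scons_up) (simp add: comp_def)

lemma csubst_clause_subst:
  "csubst \<sigma> (clause_subst V W M) = clause_subst (vsubst \<sigma> V) (vsubst \<sigma> W) (csubst (up (up \<sigma>)) M)"
  by (simp add: clause_subst_def csubst_csubst vsubst_scons scons_up) (simp add: comp_def)

section \<open>Typing and substitution\<close>

lemma axs_typed:
  assumes "(\<Delta>, M, N, A) \<in> axs \<T>"
  shows "gctyp (sig \<T>) \<Delta> M A" "gctyp (sig \<T>) \<Delta> N A"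
  using assms Rep_effthy[of \<T>] unfolding sig_def axs_def by (auto simp: case_prod_unfold)

text \<open>A value typed in \<open>\<Delta>\<close> mentions only indices below
  \<open>length \<Delta>\<close>, so what \<open>\<sigma>\<close> does to the surrounding context is
  invisible to it.\<close>

lemma vsubst_val_of:
  "gvtyp \<Delta> V A \<Longrightarrow> (\<And>n. n < length \<Delta> \<Longrightarrow> \<sigma> n = VVar n) \<Longrightarrow> vsubst \<sigma> (val_of V) = val_of V"
  by (induction rule: gvtyp.induct) (auto simp: list_all2_conv_all_nth in_set_conv_nth)

lemma hsubst_up_hren: "hsubst (up \<sigma>) (hren Suc H) = hren Suc (hsubst \<sigma> H)"
  by (simp add: hsubst_hren hren_hsubst) (simp add: comp_def)

lemma csubst_up_cren: "csubst (up \<sigma>) (cren Suc M) = cren Suc (csubst \<sigma> M)"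
  by (simp add: csubst_cren cren_csubst) (simp add: comp_def)

lemma csubst_up_up_cren:
  "csubst (up (up \<sigma>)) (cren (upr Suc) M) = cren (upr Suc) (csubst (up \<sigma>) M)"
  by (simp add: csubst_cren cren_csubst up_upr upr_up) (simp add: comp_def)

text \<open>The variables of the axiom are fixed by \<open>\<sigma>\<close>, so only
  \<open>H\<close> and \<open>k\<close> see the substitution. The domain condition guarantees that
  each lookup in \<open>H\<close> succeeds: \<open>the\<close> commutes with
  \<open>map_option\<close> only at a present key.\<close>

lemma csubst_hinst:
  "gctyp (sig \<T>) \<Delta> M A \<Longrightarrow> fmdom H = fmdom (sig \<T>) \<Longrightarrow> (\<And>n. n < length \<Delta> \<Longrightarrow> \<sigma> n = VVar n) \<Longrightarrow>
    csubst \<sigma> (hinst \<T> X \<T>' H k M) = hinst \<T> X \<T>' (hsubst \<sigma> H) (vsubst \<sigma> k) M"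
proof (induction arbitrary: \<sigma> H k rule: gctyp.induct)
  case (gc_ret \<Delta> V A)
  then show ?case by (simp add: vsubst_val_of)
next
  case (gc_let op A B \<Delta> V M C)
  have "up \<sigma> n = VVar n" if "n < length (B # \<Delta>)" for n
    using that gc_let.prems by (cases n) auto
  moreover obtain P where "fmlookup H op = Some P"
    using gc_let.hyps(1) gc_let.prems(1) by (metis fmdomI fmdom_notI not_Some_eq)
  ultimately show ?case
    using gc_let by (simp add: csubst_clause_subst vsubst_val_of hsubst_up_hren vsubst_up_vren)
next
  case (gc_case \<Delta> V As C Ms)
  have "up \<sigma> n = VVar n" if "n < length (B # \<Delta>)" for n B
    using that gc_case.prems by (cases n) auto
  then show ?case using gc_case
    by (auto simp: vsubst_val_of hsubst_up_hren vsubst_up_vren list_all2_conv_all_nth in_set_conv_nth)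
qed

text \<open>Lifting under a block of binders; for an axiom equation the block consists of the
  variables of \<open>\<Delta>\<close> and the continuation, hence the later use at
  \<open>Suc (length \<Delta>)\<close>.\<close>

definition upn :: "nat \<Rightarrow> (nat \<Rightarrow> ('b, 'op) val) \<Rightarrow> nat \<Rightarrow> ('b, 'op) val" where
  "upn n \<sigma> = (up ^^ n) \<sigma>"

lemma upn_less: "i < n \<Longrightarrow> upn n \<sigma> i = VVar i"
proof (induction n arbitrary: i)
  case (Suc n) then show ?case by (cases i) (auto simp: upn_def)
qed simp

lemma upn_add: "upn n \<sigma> (n + i) = vren ((+) n) (\<sigma> i)"
  by (induction n) (auto simp: upn_def vren_vren comp_def)

lemma csubst_hinst_upn:
  assumes "gctyp (sig \<T>) \<Delta> M A" "fmdom H = fmdom (sig \<T>)"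
  shows "csubst (upn (Suc (length \<Delta>)) \<sigma>)
      (hinst \<T> X \<T>' (hren ((+) (Suc (length \<Delta>))) H) (VVar (length \<Delta>)) M) =
    hinst \<T> X \<T>' (hren ((+) (Suc (length \<Delta>))) (hsubst \<sigma> H)) (VVar (length \<Delta>)) M"
proof -
  have "upn (Suc (length \<Delta>)) \<sigma> \<circ> (+) (Suc (length \<Delta>)) = vren ((+) (Suc (length \<Delta>))) \<circ> \<sigma>"
    unfolding comp_def upn_add ..
  then show ?thesis
    using csubst_hinst[OF assms(1), of "hren ((+) (Suc (length \<Delta>))) H" "upn (Suc (length \<Delta>)) \<sigma>"] assms(2)
    by (simp add: upn_less hsubst_hren hren_hsubst)
qed

lemma list_all2_map2I: "list_all2 P xs ys \<Longrightarrow> (\<And>x y. P x y \<Longrightarrow> Q x (f y)) \<Longrightarrow> list_all2 Q xs (map f ys)"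
  by (auto simp: list_all2_conv_all_nth)

lemma list_all2_map1I: "list_all2 P xs ys \<Longrightarrow> (\<And>x y. P x y \<Longrightarrow> Q (f x) y) \<Longrightarrow> list_all2 Q (map f xs) ys"
  by (auto simp: list_all2_conv_all_nth)

text \<open>Renamings and well-typed substitutions are the two instances of \<open>S\<close>; the second needs
  the first to be closed under \<^const>\<open>up\<close>.\<close>

lemma subst_closed:
  fixes S :: "('b, 'op) ty list \<Rightarrow> (nat \<Rightarrow> ('b, 'op) val) \<Rightarrow> ('b, 'op) ty list \<Rightarrow> bool"
  assumes S_var: "\<And>\<Gamma> \<sigma> \<Gamma>' i. S \<Gamma> \<sigma> \<Gamma>' \<Longrightarrow> i < length \<Gamma> \<Longrightarrow> vtyp \<Gamma>' (\<sigma> i) (\<Gamma> ! i)"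
    and S_up: "\<And>\<Gamma> \<sigma> \<Gamma>' A. S \<Gamma> \<sigma> \<Gamma>' \<Longrightarrow> S (A # \<Gamma>) (up \<sigma>) (A # \<Gamma>')"
  shows "vtyp \<Gamma> V A \<Longrightarrow> S \<Gamma> \<sigma> \<Gamma>' \<Longrightarrow> vtyp \<Gamma>' (vsubst \<sigma> V) A"
    and "ctyp \<Gamma> M A \<T> \<Longrightarrow> S \<Gamma> \<sigma> \<Gamma>' \<Longrightarrow> ctyp \<Gamma>' (csubst \<sigma> M) A \<T>"
    and "htyp \<Gamma> H \<T> A \<T>' \<Longrightarrow> S \<Gamma> \<sigma> \<Gamma>' \<Longrightarrow> htyp \<Gamma>' (hsubst \<sigma> H) \<T> A \<T>'"
    and "veq \<Gamma> V W A \<Longrightarrow> S \<Gamma> \<sigma> \<Gamma>' \<Longrightarrow> veq \<Gamma>' (vsubst \<sigma> V) (vsubst \<sigma> W) A"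
    and "ceq \<Gamma> M N A \<T> \<Longrightarrow> S \<Gamma> \<sigma> \<Gamma>' \<Longrightarrow> ceq \<Gamma>' (csubst \<sigma> M) (csubst \<sigma> N) A \<T>"
proof (induction arbitrary: \<sigma> \<Gamma>' and \<sigma> \<Gamma>' and \<sigma> \<Gamma>' and \<sigma> \<Gamma>' and \<sigma> \<Gamma>'
    rule: vtyp_ctyp_htyp_veq_ceq.inducts)
  case (vt_var n \<Gamma>) then show ?case by (simp add: S_var)
next
  case (vt_tup \<Gamma> Vs As)
  then show ?case by (auto intro!: vtyp_ctyp_htyp_veq_ceq.vt_tup elim: list_all2_map1I)
next
  case (vt_proj \<Gamma> V As i) then show ?case by (simp add: vtyp_ctyp_htyp_veq_ceq.vt_proj)
next
  case (vt_inj i As \<Gamma> V) then show ?case by (simp add: vtyp_ctyp_htyp_veq_ceq.vt_inj)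
next
  case (vt_lam A \<Gamma> M B \<T>) then show ?case by (simp add: vtyp_ctyp_htyp_veq_ceq.vt_lam S_up)
next
  case (ct_ret \<Gamma> V A \<T>) then show ?case by (simp add: vtyp_ctyp_htyp_veq_ceq.ct_ret)
next
  case (ct_let \<Gamma> M A \<T> N B) then show ?case by (simp add: vtyp_ctyp_htyp_veq_ceq.ct_let S_up)
next
  case (ct_app \<Gamma> V A B \<T> W)
  show ?case unfolding csubst.simps
    by (rule vtyp_ctyp_htyp_veq_ceq.ct_app) (use ct_app in auto)
next
  case (ct_case \<Gamma> V As B \<T> Ms)
  show ?case unfolding csubst.simps
    by (rule vtyp_ctyp_htyp_veq_ceq.ct_case[of _ _ As]) (use ct_case S_up in \<open>auto elim!: list_all2_map2I\<close>)
next
  case (ct_op \<T> op A B \<Gamma> V) then show ?case by (simp add: vtyp_ctyp_htyp_veq_ceq.ct_op)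
next
  case (ct_handle \<Gamma> M A \<T> H B \<T>' N)
  show ?case unfolding csubst_handle
    by (rule vtyp_ctyp_htyp_veq_ceq.ct_handle) (use ct_handle S_up in auto)
next
  case (ht H \<T> X \<T>' \<Gamma>)
  \<comment> \<open>\<open>S\<close> is assumed closed under a single lift. Iterating it reaches the
    context of an axiom equation, where the types of \<open>\<Delta>\<close> and of \<open>k\<close>
    precede \<open>\<Gamma>\<close>.\<close>
  have upn: "S (\<Delta> @ \<Gamma>) (upn (length \<Delta>) \<sigma>) (\<Delta> @ \<Gamma>')" for \<Delta>
    by (induction \<Delta>) (use ht.prems S_up in \<open>auto simp: upn_def\<close>)
  show ?case
  proof (rule vtyp_ctyp_htyp_veq_ceq.ht)
    show "fmdom (hsubst \<sigma> H) = fmdom (sig \<T>)" using ht.hyps by simp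
  next
    fix op A B M assume "fmlookup (sig \<T>) op = Some (A, B)" "fmlookup (hsubst \<sigma> H) op = Some M"
    then show "ctyp (TFun (ty_of B) X \<T>' # ty_of A # \<Gamma>') M X \<T>'"
      using ht.IH(1) ht.prems S_up by auto
  next
    fix \<Delta> M N A assume ax: "(\<Delta>, M, N, A) \<in> axs \<T>"
    have "S (map ty_of \<Delta> @ TFun (ty_of A) X \<T>' # \<Gamma>) (upn (Suc (length \<Delta>)) \<sigma>)
        (map ty_of \<Delta> @ TFun (ty_of A) X \<T>' # \<Gamma>')"
      using upn[of "map ty_of \<Delta> @ [TFun (ty_of A) X \<T>']"] by simp
    from ht.IH(2)[OF ax this]
    show "ceq (map ty_of \<Delta> @ TFun (ty_of A) X \<T>' # \<Gamma>')
          (hinst \<T> X \<T>' (hren ((+) (Suc (length \<Delta>))) (hsubst \<sigma> H)) (VVar (length \<Delta>)) M)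
          (hinst \<T> X \<T>' (hren ((+) (Suc (length \<Delta>))) (hsubst \<sigma> H)) (VVar (length \<Delta>)) N) X \<T>'"
      by (simp add: csubst_hinst_upn[OF axs_typed(1)[OF ax] ht.hyps(1)] csubst_hinst_upn[OF axs_typed(2)[OF ax] ht.hyps(1)])
  qed
next
  case (ve_refl \<Gamma> V A) then show ?case by (simp add: vtyp_ctyp_htyp_veq_ceq.ve_refl)
next
  case (ve_sym \<Gamma> V W A) then show ?case by (simp add: vtyp_ctyp_htyp_veq_ceq.ve_sym)
next
  case (ve_trans \<Gamma> U V A W) then show ?case by (meson vtyp_ctyp_htyp_veq_ceq.ve_trans)
next
  case (ve_tup Vs As Ws \<Gamma>) then show ?case by (simp add: vtyp_ctyp_htyp_veq_ceq.ve_tup)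
next
  case (ve_proj \<Gamma> V W As i) then show ?case by (simp add: vtyp_ctyp_htyp_veq_ceq.ve_proj)
next
  case (ve_inj i As \<Gamma> V W) then show ?case by (simp add: vtyp_ctyp_htyp_veq_ceq.ve_inj)
next
  case (ve_lam A \<Gamma> M N B \<T>) then show ?case by (simp add: vtyp_ctyp_htyp_veq_ceq.ve_lam S_up)
next
  case (ve_prod_beta \<Gamma> Vs As i)
  have "list_all2 (vtyp \<Gamma>') (map (vsubst \<sigma>) Vs) As" using ve_prod_beta
    by (auto elim: list_all2_map1I)
  from vtyp_ctyp_htyp_veq_ceq.ve_prod_beta[OF this, of i] show ?case using ve_prod_beta
    by (simp add: list_all2_lengthD)
next
  case (ve_prod_eta \<Gamma> V As)
  then show ?case using vtyp_ctyp_htyp_veq_ceq.ve_prod_eta[of \<Gamma>' "vsubst \<sigma> V" As]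
    by (simp add: comp_def)
next
  case (ve_fun_eta \<Gamma> V A B \<T>)
  then show ?case by (simp add: vsubst_up_vren vtyp_ctyp_htyp_veq_ceq.ve_fun_eta)
next
  case (ce_refl \<Gamma> M A \<T>) then show ?case by (simp add: vtyp_ctyp_htyp_veq_ceq.ce_refl)
next
  case (ce_sym \<Gamma> M N A \<T>) then show ?case by (simp add: vtyp_ctyp_htyp_veq_ceq.ce_sym)
next
  case (ce_trans \<Gamma> M N A \<T> P) then show ?case by (meson vtyp_ctyp_htyp_veq_ceq.ce_trans)
next
  case (ce_ret \<Gamma> V W A \<T>) then show ?case by (simp add: vtyp_ctyp_htyp_veq_ceq.ce_ret)
next
  case (ce_let \<Gamma> M M' A \<T> N N' B) then show ?case by (simp add: vtyp_ctyp_htyp_veq_ceq.ce_let S_up)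
next
  case (ce_app \<Gamma> V V' A B \<T> W W')
  show ?case unfolding csubst.simps by (rule vtyp_ctyp_htyp_veq_ceq.ce_app) (use ce_app in auto)
next
  case (ce_case \<Gamma> V V' As Ms Ms' B \<T>)
  show ?case unfolding csubst.simps
    by (rule vtyp_ctyp_htyp_veq_ceq.ce_case[of _ _ _ As]) (use ce_case S_up in auto)
next
  case (ce_op \<T> op A B \<Gamma> V W) then show ?case by (simp add: vtyp_ctyp_htyp_veq_ceq.ce_op)
next
  case (ce_handle \<Gamma> M M' A \<T> H B \<T>' H' N N')
  show ?case unfolding csubst_handle
    by (rule vtyp_ctyp_htyp_veq_ceq.ce_handle) (use ce_handle S_up in auto)
next
  case (ce_fun_beta A \<Gamma> M B \<T> V)
  then show ?case by (simp add: csubst_csubst1 S_up vtyp_ctyp_htyp_veq_ceq.ce_fun_beta)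
next
  case (ce_sum_beta i As \<Gamma> V B \<T> Ms)
  have "list_all2 (\<lambda>A M. ctyp (A # \<Gamma>') M B \<T>) As (map (csubst (up \<sigma>)) Ms)"
    using ce_sum_beta S_up by (auto elim!: list_all2_map2I)
  from vtyp_ctyp_htyp_veq_ceq.ce_sum_beta[OF ce_sum_beta.hyps(1) _ this] show ?case
    using ce_sum_beta by (simp add: csubst_csubst1 list_all2_lengthD)
next
  case (ce_sum_eta \<Gamma> V As M B \<T>)
  have "csubst (up \<sigma>) (csubst (scons (VInj As i (VVar 0)) (\<lambda>n. VVar (Suc n))) M) =
      csubst (scons (VInj As i (VVar 0)) (\<lambda>n. VVar (Suc n))) (csubst (up \<sigma>) M)" for i
    by (simp add: csubst_csubst vsubst_scons scons_up) (simp add: comp_def vsubst_var)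
  then show ?case
    using ce_sum_eta S_up vtyp_ctyp_htyp_veq_ceq.ce_sum_eta[of \<Gamma>' "vsubst \<sigma> V" As "csubst (up \<sigma>) M" B \<T>]
    by (simp add: csubst_csubst1 comp_def)
next
  case (ce_let_ret \<Gamma> V A M B \<T>)
  then show ?case by (simp add: csubst_csubst1 S_up vtyp_ctyp_htyp_veq_ceq.ce_let_ret)
next
  case (ce_let_eta \<Gamma> M A \<T>) then show ?case by (simp add: vtyp_ctyp_htyp_veq_ceq.ce_let_eta)
next
  case (ce_let_let \<Gamma> M A \<T> N B P C)
  then show ?case by (simp add: csubst_up_up_cren S_up vtyp_ctyp_htyp_veq_ceq.ce_let_let)
next
  case (ce_handle_ret \<Gamma> V A H \<T> B \<T>' N)
  then show ?case by (simp add: csubst_csubst1 S_up vtyp_ctyp_htyp_veq_ceq.ce_handle_ret)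
next
  case (ce_handle_let \<Gamma> M A \<T> N B H C \<T>' P)
  then show ?case
    by (simp add: csubst_up_up_cren hsubst_up_hren S_up vtyp_ctyp_htyp_veq_ceq.ce_handle_let)
next
  case (ce_handle_op \<T> op A B \<Gamma> V H C \<T>' N M)
  have "fmlookup (hsubst \<sigma> H) op = Some (csubst (up (up \<sigma>)) M)" using ce_handle_op by simp
  from vtyp_ctyp_htyp_veq_ceq.ce_handle_op[OF ce_handle_op.hyps(1) _ _ _ this] show ?case
    using ce_handle_op S_up by (simp add: csubst_clause_subst)
next
  case (ce_axiom \<Delta> M N A \<T> \<Gamma> \<tau>)
  \<comment> \<open>The rule already allows instantiation along any typed substitution, so
    substituting into an instance gives the instance along the composite.\<close>
  then show ?case
    using vtyp_ctyp_htyp_veq_ceq.ce_axiom[OF ce_axiom.hyps(1), of \<Gamma>' "vsubst \<sigma> \<circ> \<tau>"]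
    by (simp add: csubst_csubst)
qed

section \<open>Typed renamings and substitutions, inversion, and presuppositions of equality\<close>

definition styp :: "('b, 'op) ty list \<Rightarrow> (nat \<Rightarrow> ('b, 'op) val) \<Rightarrow> ('b, 'op) ty list \<Rightarrow> bool" where
  "styp \<Gamma> \<sigma> \<Gamma>' \<longleftrightarrow> (\<forall>i < length \<Gamma>. vtyp \<Gamma>' (\<sigma> i) (\<Gamma> ! i))"

definition rtyp :: "('b, 'op) ty list \<Rightarrow> (nat \<Rightarrow> nat) \<Rightarrow> ('b, 'op) ty list \<Rightarrow> bool" where
  "rtyp \<Gamma> \<xi> \<Gamma>' \<longleftrightarrow> (\<forall>i < length \<Gamma>. \<xi> i < length \<Gamma>' \<and> \<Gamma>' ! \<xi> i = \<Gamma> ! i)"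

lemma rtyp_Suc [simp]: "rtyp \<Gamma> Suc (A # \<Gamma>)"
  by (simp add: rtyp_def)

lemma rtyp_upr [simp]: "rtyp \<Gamma> \<xi> \<Gamma>' \<Longrightarrow> rtyp (A # \<Gamma>) (upr \<xi>) (A # \<Gamma>')"
  by (auto simp: rtyp_def upr_def split: nat.split)

lemma rename_closed:
  assumes "rtyp \<Gamma> \<xi> \<Gamma>'"
  shows vtyp_ren: "vtyp \<Gamma> V A \<Longrightarrow> vtyp \<Gamma>' (vren \<xi> V) A"
    and ctyp_ren: "ctyp \<Gamma> M A \<T> \<Longrightarrow> ctyp \<Gamma>' (cren \<xi> M) A \<T>"
    and htyp_ren: "htyp \<Gamma> H \<T> A \<T>' \<Longrightarrow> htyp \<Gamma>' (hren \<xi> H) \<T> A \<T>'"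
    and veq_ren: "veq \<Gamma> V W A \<Longrightarrow> veq \<Gamma>' (vren \<xi> V) (vren \<xi> W) A"
    and ceq_ren: "ceq \<Gamma> M N A \<T> \<Longrightarrow> ceq \<Gamma>' (cren \<xi> M) (cren \<xi> N) A \<T>"
proof -
  let ?S = "\<lambda>\<Gamma> \<sigma> \<Gamma>'. \<exists>\<xi>. \<sigma> = (\<lambda>n. VVar (\<xi> n)) \<and> rtyp \<Gamma> \<xi> \<Gamma>'"
  have 1: "vtyp \<Gamma>' (\<sigma> i) (\<Gamma> ! i)" if "?S \<Gamma> \<sigma> \<Gamma>'" "i < length \<Gamma>" for \<Gamma> \<sigma> \<Gamma>' i
    using that vt_var unfolding rtyp_def by metis
  have 2: "?S (A # \<Gamma>) (up \<sigma>) (A # \<Gamma>')" if "?S \<Gamma> \<sigma> \<Gamma>'" for \<Gamma> \<sigma> \<Gamma>' A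
    using that rtyp_upr up_var by metis
  have 3: "?S \<Gamma> (\<lambda>n. VVar (\<xi> n)) \<Gamma>'" using assms by blast
  show "vtyp \<Gamma> V A \<Longrightarrow> vtyp \<Gamma>' (vren \<xi> V) A"
    unfolding vsubst_var[symmetric]
    by (rule subst_closed(1)[where S = ?S and \<Gamma> = \<Gamma> and \<Gamma>' = \<Gamma>'], erule (1) 1, erule 2, assumption, rule 3)
  show "ctyp \<Gamma> M A \<T> \<Longrightarrow> ctyp \<Gamma>' (cren \<xi> M) A \<T>"
    unfolding csubst_var[symmetric]
    by (rule subst_closed(2)[where S = ?S and \<Gamma> = \<Gamma> and \<Gamma>' = \<Gamma>'], erule (1) 1, erule 2, assumption, rule 3)
  show "htyp \<Gamma> H \<T> A \<T>' \<Longrightarrow> htyp \<Gamma>' (hren \<xi> H) \<T> A \<T>'"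
    unfolding hsubst_var[symmetric]
    by (rule subst_closed(3)[where S = ?S and \<Gamma> = \<Gamma> and \<Gamma>' = \<Gamma>'], erule (1) 1, erule 2, assumption, rule 3)
  show "veq \<Gamma> V W A \<Longrightarrow> veq \<Gamma>' (vren \<xi> V) (vren \<xi> W) A"
    unfolding vsubst_var[symmetric]
    by (rule subst_closed(4)[where S = ?S and \<Gamma> = \<Gamma> and \<Gamma>' = \<Gamma>'], erule (1) 1, erule 2, assumption, rule 3)
  show "ceq \<Gamma> M N A \<T> \<Longrightarrow> ceq \<Gamma>' (cren \<xi> M) (cren \<xi> N) A \<T>"
    unfolding csubst_var[symmetric]
    by (rule subst_closed(5)[where S = ?S and \<Gamma> = \<Gamma> and \<Gamma>' = \<Gamma>'], erule (1) 1, erule 2, assumption, rule 3)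
qed

lemma styp_up [simp]: "styp \<Gamma> \<sigma> \<Gamma>' \<Longrightarrow> styp (A # \<Gamma>) (up \<sigma>) (A # \<Gamma>')"
  unfolding styp_def up_def using vt_var[of 0 "A # \<Gamma>'"]
  by (auto split: nat.split intro: vtyp_ren[OF rtyp_Suc] simp: nth_Cons)

lemma subst_typed:
  assumes "styp \<Gamma> \<sigma> \<Gamma>'"
  shows vtyp_subst: "vtyp \<Gamma> V A \<Longrightarrow> vtyp \<Gamma>' (vsubst \<sigma> V) A"
    and ctyp_subst: "ctyp \<Gamma> M A \<T> \<Longrightarrow> ctyp \<Gamma>' (csubst \<sigma> M) A \<T>"
    and htyp_subst: "htyp \<Gamma> H \<T> A \<T>' \<Longrightarrow> htyp \<Gamma>' (hsubst \<sigma> H) \<T> A \<T>'"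
    and veq_subst: "veq \<Gamma> V W A \<Longrightarrow> veq \<Gamma>' (vsubst \<sigma> V) (vsubst \<sigma> W) A"
    and ceq_subst: "ceq \<Gamma> M N A \<T> \<Longrightarrow> ceq \<Gamma>' (csubst \<sigma> M) (csubst \<sigma> N) A \<T>"
proof -
  have 1: "\<And>\<Gamma> \<sigma> \<Gamma>' i. styp \<Gamma> \<sigma> \<Gamma>' \<Longrightarrow> i < length \<Gamma> \<Longrightarrow> vtyp \<Gamma>' (\<sigma> i) (\<Gamma> ! i)"
    by (simp add: styp_def)
  show "vtyp \<Gamma> V A \<Longrightarrow> vtyp \<Gamma>' (vsubst \<sigma> V) A"
    by (rule subst_closed(1)[where S = styp and \<Gamma> = \<Gamma> and \<Gamma>' = \<Gamma>'], erule (1) 1, erule styp_up, assumption, rule assms)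
  show "ctyp \<Gamma> M A \<T> \<Longrightarrow> ctyp \<Gamma>' (csubst \<sigma> M) A \<T>"
    by (rule subst_closed(2)[where S = styp and \<Gamma> = \<Gamma> and \<Gamma>' = \<Gamma>'], erule (1) 1, erule styp_up, assumption, rule assms)
  show "htyp \<Gamma> H \<T> A \<T>' \<Longrightarrow> htyp \<Gamma>' (hsubst \<sigma> H) \<T> A \<T>'"
    by (rule subst_closed(3)[where S = styp and \<Gamma> = \<Gamma> and \<Gamma>' = \<Gamma>'], erule (1) 1, erule styp_up, assumption, rule assms)
  show "veq \<Gamma> V W A \<Longrightarrow> veq \<Gamma>' (vsubst \<sigma> V) (vsubst \<sigma> W) A"
    by (rule subst_closed(4)[where S = styp and \<Gamma> = \<Gamma> and \<Gamma>' = \<Gamma>'], erule (1) 1, erule styp_up, assumption, rule assms)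
  show "ceq \<Gamma> M N A \<T> \<Longrightarrow> ceq \<Gamma>' (csubst \<sigma> M) (csubst \<sigma> N) A \<T>"
    by (rule subst_closed(5)[where S = styp and \<Gamma> = \<Gamma> and \<Gamma>' = \<Gamma>'], erule (1) 1, erule styp_up, assumption, rule assms)
qed

inductive_cases vtyp_VVarE [elim!]: "vtyp \<Gamma> (VVar n) A"
  and vtyp_VTupE [elim!]: "vtyp \<Gamma> (VTup Vs) A"
  and vtyp_VProjE: "vtyp \<Gamma> (VProj i V) A"
  and vtyp_VInjE [elim!]: "vtyp \<Gamma> (VInj As i V) A"
  and vtyp_VLamE [elim!]: "vtyp \<Gamma> (VLam A B \<T> M) C"

inductive_cases ctyp_CRetE [elim!]: "ctyp \<Gamma> (CRet V) A \<T>"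
  and ctyp_CLetE [elim!]: "ctyp \<Gamma> (CLet A M N) B \<T>"
  and ctyp_COpE [elim!]: "ctyp \<Gamma> (COp op V) B \<T>"
  and ctyp_CHandleE [elim!]: "ctyp \<Gamma> (CHandle A \<T> M H N) B \<T>'"

inductive_cases htypE: "htyp \<Gamma> H \<T> X \<T>'"

lemma htyp_fmdom: "htyp \<Gamma> H \<T> X \<T>' \<Longrightarrow> fmdom H = fmdom (sig \<T>)"
  by (auto elim: htypE)

lemma htyp_clause:
  "htyp \<Gamma> H \<T> X \<T>' \<Longrightarrow> fmlookup (sig \<T>) op = Some (A, B) \<Longrightarrow> fmlookup H op = Some M \<Longrightarrow>
    ctyp (TFun (ty_of B) X \<T>' # ty_of A # \<Gamma>) M X \<T>'"
  by (auto elim: htypE)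

lemma htyp_clauseE:
  assumes "htyp \<Gamma> H \<T> X \<T>'" "fmlookup (sig \<T>) op = Some (A, B)"
  obtains M where "fmlookup H op = Some M" "ctyp (TFun (ty_of B) X \<T>' # ty_of A # \<Gamma>) M X \<T>'"
proof -
  have "op |\<in>| fmdom H"
    using fmdomI[OF assms(2)] htyp_fmdom[OF assms(1)] by simp
  then obtain M where "fmlookup H op = Some M"
    by (auto simp only: fmlookup_dom_iff)
  then show ?thesis using that htyp_clause[OF assms] by blast
qed

lemma vtyp_VVarI: "n < length \<Gamma> \<Longrightarrow> \<Gamma> ! n = A \<Longrightarrow> vtyp \<Gamma> (VVar n) A"
  using vt_var by blast

lemma vtyp_VProjI: "vtyp \<Gamma> V (TProd As) \<Longrightarrow> i < length As \<Longrightarrow> As ! i = A \<Longrightarrow> vtyp \<Gamma> (VProj i V) A"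
  using vt_proj by blast

lemma vtyp_VTup2: "vtyp \<Gamma> V A \<Longrightarrow> vtyp \<Gamma> W B \<Longrightarrow> vtyp \<Gamma> (VTup [V, W]) (TProd [A, B])"
  by (intro vt_tup) auto

lemma vtyp_VTup0: "vtyp \<Gamma> (VTup []) (TProd [])"
  by (intro vt_tup) auto

lemma vtyp_val_of: "gvtyp \<Delta> V A \<Longrightarrow> vtyp (map ty_of \<Delta> @ \<Gamma>) (val_of V) (ty_of A)"
proof (induction rule: gvtyp.induct)
  case (gv_tup Vs As)
  then show ?case by (auto intro!: vt_tup simp: list_all2_conv_all_nth)
qed (auto intro: vtyp_VVarI vtyp_VProjI vt_inj simp: nth_append)

lemma gctyp_argty:
  assumes "fmlookup (sig \<T>) op = Some (A, B)"
  shows "argty \<T> op = A" "resty \<T> op = B"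
  using assms by (simp_all add: argty_def resty_def)

lemma ctyp_comp_of:
  "gctyp (sig \<T>) \<Delta> M A \<Longrightarrow> ctyp (map ty_of \<Delta>) (comp_of \<T> M) (ty_of A) \<T>"
proof (induction rule: gctyp.induct)
  case (gc_ret \<Delta> V A)
  then show ?case using vtyp_val_of[of \<Delta> V A "[]"] by (auto intro: ct_ret)
next
  case (gc_let op A B \<Delta> V M C)
  then show ?case using vtyp_val_of[of \<Delta> V A "[]"] by (auto intro!: ct_let ct_op simp: gctyp_argty)
next
  case (gc_case \<Delta> V As C Ms)
  then show ?case using vtyp_val_of[of \<Delta> V "GSum As" "[]"]
    by (auto intro!: ct_case simp: list_all2_conv_all_nth)
qed

lemma styp_id [simp]: "styp \<Gamma> VVar \<Gamma>"
  by (simp add: styp_def vt_var)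

lemma styp_scons: "vtyp \<Gamma>' V A \<Longrightarrow> styp \<Gamma> \<sigma> \<Gamma>' \<Longrightarrow> styp (A # \<Gamma>) (scons V \<sigma>) \<Gamma>'"
  by (auto simp: styp_def scons_def nth_Cons split: nat.split)

lemma styp_shift [simp]: "styp \<Gamma> (\<lambda>n. VVar (Suc n)) (A # \<Gamma>)"
  by (auto simp: styp_def intro: vtyp_VVarI)

lemma ctyp_csubst1: "ctyp (A # \<Gamma>) M B \<T> \<Longrightarrow> vtyp \<Gamma> V A \<Longrightarrow> ctyp \<Gamma> (csubst1 V M) B \<T>"
  unfolding csubst1_def by (rule ctyp_subst[OF styp_scons]) auto

lemma ctyp_clause_subst:
  "ctyp (B # A # \<Gamma>) M C \<T> \<Longrightarrow> vtyp \<Gamma> V A \<Longrightarrow> vtyp \<Gamma> W B \<Longrightarrow> ctyp \<Gamma> (clause_subst V W M) C \<T>"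
  unfolding clause_subst_def by (rule ctyp_subst[OF styp_scons[OF _ styp_scons]]) auto

text \<open>Most equality rules carry their typing premises or inherit them inductively. The
  exceptions worth checking are the reducts: beta and handler laws need closure of typing under
  substitution, and axiom instances need \<open>axs_typed\<close>.\<close>

lemma eq_typed:
  "vtyp \<Gamma> V A \<Longrightarrow> True" "ctyp \<Gamma> M A \<T> \<Longrightarrow> True" "htyp \<Gamma> H \<T> X \<T>' \<Longrightarrow> True"
  "veq \<Gamma> V W A \<Longrightarrow> vtyp \<Gamma> V A \<and> vtyp \<Gamma> W A"
  "ceq \<Gamma> M N A \<T> \<Longrightarrow> ctyp \<Gamma> M A \<T> \<and> ctyp \<Gamma> N A \<T>"
proof (induction rule: vtyp_ctyp_htyp_veq_ceq.inducts)
  case (ve_prod_eta \<Gamma> V As)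
  then show ?case by (auto intro!: vt_tup vt_proj simp: list_all2_conv_all_nth)
next
  case (ve_fun_eta \<Gamma> V A B \<T>)
  have "vtyp (A # \<Gamma>) (vren Suc V) (TFun A B \<T>)" using ve_fun_eta vtyp_ren[OF rtyp_Suc] by blast
  then show ?case using ve_fun_eta by (auto intro!: vt_lam ct_app[of _ _ A] vtyp_VVarI)
next
  case (ve_prod_beta \<Gamma> Vs As i)
  then show ?case by (auto intro!: vt_proj vt_tup simp: list_all2_conv_all_nth)
next
  case (ce_fun_beta A \<Gamma> M B \<T> V)
  then show ?case by (blast intro: ct_app vt_lam ctyp_csubst1)
next
  case (ce_sum_beta i As \<Gamma> V B \<T> Ms)
  then have "list_all2 (\<lambda>A M. ctyp (A # \<Gamma>) M B \<T>) As Ms" "ctyp (As ! i # \<Gamma>) (Ms ! i) B \<T>"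
    by (auto simp: list_all2_conv_all_nth)
  then show ?case
    using ct_case[OF vt_inj[OF ce_sum_beta(1,2)]] ctyp_csubst1[OF _ ce_sum_beta(2)] by blast
next
  case (ce_sum_eta \<Gamma> V As M B \<T>)
  have "ctyp (As ! i # \<Gamma>) (csubst (scons (VInj As i (VVar 0)) (\<lambda>n. VVar (Suc n))) M) B \<T>"
    if "i < length As" for i
    by (rule ctyp_subst[OF styp_scons[OF vt_inj styp_shift]])
      (use ce_sum_eta that in \<open>auto intro: vtyp_VVarI\<close>)
  then have "list_all2 (\<lambda>A M. ctyp (A # \<Gamma>) M B \<T>) As
      (map (\<lambda>i. csubst (scons (VInj As i (VVar 0)) (\<lambda>n. VVar (Suc n))) M) [0..<length As])"
    by (simp add: list_all2_conv_all_nth)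
  with ce_sum_eta show ?case by (blast intro: ct_case ctyp_csubst1)
next
  case (ce_let_ret \<Gamma> V A M B \<T>)
  then show ?case by (blast intro: ct_let ct_ret ctyp_csubst1)
next
  case (ce_let_eta \<Gamma> M A \<T>)
  then show ?case by (auto intro!: ct_let[of _ _ A] ct_ret vtyp_VVarI)
next
  case (ce_let_let \<Gamma> M A \<T> N B P C)
  then have "ctyp (B # A # \<Gamma>) (cren (upr Suc) P) C \<T>" using ctyp_ren[OF rtyp_upr[OF rtyp_Suc]] by blast
  with ce_let_let show ?case by (blast intro: ct_let)
next
  case (ce_handle_ret \<Gamma> V A H \<T> B \<T>' N)
  then show ?case by (blast intro: ct_handle ct_ret ctyp_csubst1)
next
  case (ce_handle_let \<Gamma> M A \<T> N B H C \<T>' P)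
  then have "ctyp (B # A # \<Gamma>) (cren (upr Suc) P) C \<T>'" "htyp (A # \<Gamma>) (hren Suc H) \<T> C \<T>'"
    using ctyp_ren[OF rtyp_upr[OF rtyp_Suc]] htyp_ren[OF rtyp_Suc] by blast+
  with ce_handle_let show ?case by (blast intro: ct_let ct_handle)
next
  case (ce_handle_op \<T> op A B \<Gamma> V H C \<T>' N M)
  have M: "ctyp (TFun (ty_of B) C \<T>' # ty_of A # \<Gamma>) M C \<T>'"
    by (rule htyp_clause[of _ H]) (use ce_handle_op in auto)
  show ?case
    using ce_handle_op ct_handle[OF ct_op[OF ce_handle_op(1)]] ctyp_clause_subst[OF M _ vt_lam] by simp
next
  case (ce_axiom \<Delta> M N A \<T> \<Gamma> \<sigma>)
  then have "styp (map ty_of \<Delta>) \<sigma> \<Gamma>" by (auto simp: styp_def)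
  from ctyp_subst[OF this ctyp_comp_of] show ?case using axs_typed[OF ce_axiom(1)] by simp
next
  case (ce_case \<Gamma> V V' As Ms Ms' B \<T>)
  then show ?case by (auto intro!: ct_case[of _ _ As] simp: list_all2_conv_all_nth)
next
  case (ve_tup Vs As Ws \<Gamma>)
  then show ?case by (auto intro!: vt_tup simp: list_all2_conv_all_nth)
qed (auto intro: vtyp_ctyp_htyp_veq_ceq.intros)

lemma veq_typed: "veq \<Gamma> V W A \<Longrightarrow> vtyp \<Gamma> V A" "veq \<Gamma> V W A \<Longrightarrow> vtyp \<Gamma> W A"
  and ceq_typed: "ceq \<Gamma> M N A \<T> \<Longrightarrow> ctyp \<Gamma> M A \<T>" "ceq \<Gamma> M N A \<T> \<Longrightarrow> ctyp \<Gamma> N A \<T>"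
  using eq_typed(4,5) by blast+

section \<open>Congruence of substitution and of handling\<close>

definition seq :: "('b, 'op) ty list \<Rightarrow> (nat \<Rightarrow> ('b, 'op) val) \<Rightarrow> (nat \<Rightarrow> ('b, 'op) val) \<Rightarrow> ('b, 'op) ty list \<Rightarrow> bool" where
  "seq \<Gamma> \<sigma> \<tau> \<Gamma>' \<longleftrightarrow> (\<forall>i < length \<Gamma>. veq \<Gamma>' (\<sigma> i) (\<tau> i) (\<Gamma> ! i))"

lemma seq_styp: "seq \<Gamma> \<sigma> \<tau> \<Gamma>' \<Longrightarrow> styp \<Gamma> \<sigma> \<Gamma>'" "seq \<Gamma> \<sigma> \<tau> \<Gamma>' \<Longrightarrow> styp \<Gamma> \<tau> \<Gamma>'"
  unfolding seq_def styp_def using veq_typed by blast+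

lemma seq_up: "seq \<Gamma> \<sigma> \<tau> \<Gamma>' \<Longrightarrow> seq (A # \<Gamma>) (up \<sigma>) (up \<tau>) (A # \<Gamma>')"
  unfolding seq_def up_def using ve_refl[OF vtyp_VVarI[of 0 "A # \<Gamma>'" A]]
  by (auto split: nat.split intro: veq_ren[OF rtyp_Suc] simp: nth_Cons)

text \<open>Induction on the typing of the term works because every term former has a congruence
  rule. The handler conclusion is clausewise, since that is a premise of \<open>ce_handle\<close>;
  the rule also wants both substituted handlers well typed, which \<open>htyp_subst\<close>
  supplies.\<close>

lemma subst_cong:
  shows vsubst_cong: "vtyp \<Gamma> V A \<Longrightarrow> seq \<Gamma> \<sigma> \<tau> \<Gamma>' \<Longrightarrow> veq \<Gamma>' (vsubst \<sigma> V) (vsubst \<tau> V) A"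
    and csubst_cong: "ctyp \<Gamma> M A \<T> \<Longrightarrow> seq \<Gamma> \<sigma> \<tau> \<Gamma>' \<Longrightarrow> ceq \<Gamma>' (csubst \<sigma> M) (csubst \<tau> M) A \<T>"
    and hsubst_cong: "htyp \<Gamma> H \<T> X \<T>' \<Longrightarrow> seq \<Gamma> \<sigma> \<tau> \<Gamma>' \<Longrightarrow>
      fmlookup (sig \<T>) op = Some (A', B') \<Longrightarrow> fmlookup H op = Some P \<Longrightarrow>
      ceq (TFun (ty_of B') X \<T>' # ty_of A' # \<Gamma>') (csubst (up (up \<sigma>)) P) (csubst (up (up \<tau>)) P) X \<T>'"
    and "veq \<Gamma> V W A \<Longrightarrow> True"
    and "ceq \<Gamma> M N A \<T> \<Longrightarrow> True"
proof (induction arbitrary: \<sigma> \<tau> \<Gamma>' and \<sigma> \<tau> \<Gamma>' and \<sigma> \<tau> \<Gamma>' op A' B' P and \<sigma> and \<sigma>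
    rule: vtyp_ctyp_htyp_veq_ceq.inducts)
  case (vt_var n \<Gamma>) then show ?case by (simp add: seq_def)
next
  case (vt_tup \<Gamma> Vs As)
  then show ?case by (auto intro!: ve_tup simp: list_all2_conv_all_nth)
next
  case (ct_app \<Gamma> V A B \<T> W) then show ?case by (simp, blast intro: ce_app)
next
  case (ct_case \<Gamma> V As B \<T> Ms)
  note up = seq_up[OF ct_case.prems]
  from ct_case up show ?case by (auto intro!: ce_case[of _ _ _ As] simp: list_all2_conv_all_nth)
next
  case (ct_op \<T> op A B \<Gamma> V) then show ?case by (auto intro!: ce_op)
next
  case (ct_handle \<Gamma> M A \<T> H B \<T>' N)
  have "htyp \<Gamma>' (hsubst \<sigma> H) \<T> B \<T>'" "htyp \<Gamma>' (hsubst \<tau> H) \<T> B \<T>'"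
    using ct_handle.hyps(2) ct_handle.prems by (auto intro: htyp_subst seq_styp)
  then show ?case unfolding csubst_handle using ct_handle seq_up[OF ct_handle.prems]
    by (auto intro!: ce_handle)
next
  case (vt_lam A \<Gamma> M B \<T>)
  show ?case using vt_lam.IH[OF seq_up[OF vt_lam.prems]] by (simp add: ve_lam)
next
  case (ct_let \<Gamma> M A \<T> N B)
  show ?case using ct_let.IH(1)[OF ct_let.prems] ct_let.IH(2)[OF seq_up[OF ct_let.prems]]
    by (simp add: ce_let)
next
  case (ht H \<T> X \<T>' \<Gamma>)
  show ?case by (rule ht.IH(1)[OF ht.prems(2,3) seq_up[OF seq_up[OF ht.prems(1)]]])
qed (auto intro: ve_refl ve_proj ve_inj ce_ret)

text \<open>Passes through \<open>csubst \<tau> M\<close>: first the substitution is changed, then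
  the term.\<close>

lemma csubst_eq_cong:
  assumes "ceq \<Gamma> M N A \<T>" "seq \<Gamma> \<sigma> \<tau> \<Gamma>'"
  shows "ceq \<Gamma>' (csubst \<sigma> M) (csubst \<tau> N) A \<T>"
  using ce_trans[OF csubst_cong[OF ceq_typed(1)[OF assms(1)] assms(2)] ceq_subst[OF seq_styp(2)[OF assms(2)] assms(1)]] .

lemma vsubst_eq_cong:
  assumes "veq \<Gamma> V W A" "seq \<Gamma> \<sigma> \<tau> \<Gamma>'"
  shows "veq \<Gamma>' (vsubst \<sigma> V) (vsubst \<tau> W) A"
  using ve_trans[OF vsubst_cong[OF veq_typed(1)[OF assms(1)] assms(2)] veq_subst[OF seq_styp(2)[OF assms(2)] assms(1)]] .

lemma seq_scons: "veq \<Gamma>' V W A \<Longrightarrow> seq \<Gamma> \<sigma> \<tau> \<Gamma>' \<Longrightarrow> seq (A # \<Gamma>) (scons V \<sigma>) (scons W \<tau>) \<Gamma>'"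
  by (auto simp: seq_def scons_def nth_Cons split: nat.split)

lemma seq_refl: "styp \<Gamma> \<sigma> \<Gamma>' \<Longrightarrow> seq \<Gamma> \<sigma> \<sigma> \<Gamma>'"
  by (auto simp: seq_def styp_def ve_refl)

lemma csubst1_cong:
  "ceq (A # \<Gamma>) M N B \<T> \<Longrightarrow> veq \<Gamma> V W A \<Longrightarrow> ceq \<Gamma> (csubst1 V M) (csubst1 W N) B \<T>"
  unfolding csubst1_def by (rule csubst_eq_cong[OF _ seq_scons]) (auto intro: seq_refl)

lemma clause_subst_cong:
  "ceq (B # A # \<Gamma>) M N C \<T> \<Longrightarrow> veq \<Gamma> V V' A \<Longrightarrow> veq \<Gamma> W W' B \<Longrightarrow>
    ceq \<Gamma> (clause_subst V W M) (clause_subst V' W' N) C \<T>"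
  unfolding clause_subst_def by (rule csubst_eq_cong[OF _ seq_scons[OF _ seq_scons]]) (auto intro: seq_refl)

text \<open>The comparison of handlers demanded by \<open>ce_handle\<close>, without any requirement
  that either handler respects the axioms.\<close>

definition heq :: "('b, 'op) ty list \<Rightarrow> ('b, 'op) handler \<Rightarrow> ('b, 'op) handler \<Rightarrow> ('b, 'op) effthy \<Rightarrow>
    ('b, 'op) ty \<Rightarrow> ('b, 'op) effthy \<Rightarrow> bool" where
  "heq \<Gamma> H H' \<T> X \<T>' \<longleftrightarrow> fmdom H = fmdom (sig \<T>) \<and> fmdom H' = fmdom (sig \<T>) \<and>
    (\<forall>op A B P P'. fmlookup (sig \<T>) op = Some (A, B) \<longrightarrow> fmlookup H op = Some P \<longrightarrow>
      fmlookup H' op = Some P' \<longrightarrow> ceq (TFun (ty_of B) X \<T>' # ty_of A # \<Gamma>) P P' X \<T>')"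

lemma heq_ren:
  assumes "heq \<Gamma> H H' \<T> X \<T>'" "rtyp \<Gamma> \<xi> \<Gamma>'"
  shows "heq \<Gamma>' (hren \<xi> H) (hren \<xi> H') \<T> X \<T>'"
  using assms ceq_ren[OF rtyp_upr[OF rtyp_upr[OF assms(2)]]] unfolding heq_def by auto

text \<open>By induction on the effect theory term. In the operation case the handled continuation
  sits inside a lambda that is substituted into a clause, so both the clause and the inserted values
  vary.\<close>

lemma hinst_cong:
  "gctyp (sig \<T>) \<Delta> M A \<Longrightarrow> heq (map ty_of \<Delta> @ \<Gamma>) H H' \<T> X \<T>' \<Longrightarrow>
    veq (map ty_of \<Delta> @ \<Gamma>) k k' (TFun (ty_of A) X \<T>') \<Longrightarrow>
    ceq (map ty_of \<Delta> @ \<Gamma>) (hinst \<T> X \<T>' H k M) (hinst \<T> X \<T>' H' k' M) X \<T>'"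
proof (induction arbitrary: H H' k k' rule: gctyp.induct)
  case (gc_ret \<Delta> V A)
  then show ?case by (auto intro!: ce_app[of _ _ _ "ty_of A"] ve_refl vtyp_val_of)
next
  case (gc_let op A B \<Delta> V M C)
  obtain P P' where P: "fmlookup H op = Some P" "fmlookup H' op = Some P'"
    using gc_let.prems(1) gc_let.hyps(1) unfolding heq_def by (metis fmdomI fmlookup_dom_iff)
  have "ceq (TFun (ty_of B) X \<T>' # ty_of A # map ty_of \<Delta> @ \<Gamma>) P P' X \<T>'"
    using P gc_let.prems(1) gc_let.hyps(1) unfolding heq_def by blast
  moreover have "ceq (ty_of B # map ty_of \<Delta> @ \<Gamma>)
     (hinst \<T> X \<T>' (hren Suc H) (vren Suc k) M) (hinst \<T> X \<T>' (hren Suc H') (vren Suc k') M) X \<T>'"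
    using gc_let.IH[OF heq_ren[OF gc_let.prems(1)] veq_ren[OF _ gc_let.prems(2)]] by simp
  ultimately show ?case using P gc_let.hyps
    by (auto intro!: clause_subst_cong ve_refl ve_lam vtyp_val_of simp: gctyp_argty)
next
  case (gc_case \<Delta> V As C Ms)
  have "ceq (ty_of (As ! i) # map ty_of \<Delta> @ \<Gamma>)
     (hinst \<T> X \<T>' (hren Suc H) (vren Suc k) (Ms ! i)) (hinst \<T> X \<T>' (hren Suc H') (vren Suc k') (Ms ! i)) X \<T>'"
    if "i < length As" for i
  proof -
    have "\<And>H H' k k'. heq (map ty_of (As ! i # \<Delta>) @ \<Gamma>) H H' \<T> X \<T>' \<Longrightarrow>
      veq (map ty_of (As ! i # \<Delta>) @ \<Gamma>) k k' (TFun (ty_of C) X \<T>') \<Longrightarrow>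
      ceq (map ty_of (As ! i # \<Delta>) @ \<Gamma>) (hinst \<T> X \<T>' H k (Ms ! i)) (hinst \<T> X \<T>' H' k' (Ms ! i)) X \<T>'"
      using gc_case.IH that by (auto simp: list_all2_conv_all_nth)
    from this[OF heq_ren[OF gc_case.prems(1)] veq_ren[OF _ gc_case.prems(2)]]
    show ?thesis by simp
  qed
  moreover have "vtyp (map ty_of \<Delta> @ \<Gamma>) (val_of V) (TSum (map ty_of As))"
    using vtyp_val_of[OF gc_case.hyps] by simp
  ultimately show ?case using gc_case.IH
    by (auto intro!: ce_case[of _ _ _ "map ty_of As"] ve_refl simp: list_all2_lengthD)
qed

lemma rtyp_add: "rtyp \<Gamma> ((+) (length \<Delta>)) (\<Delta> @ \<Gamma>)"
  by (simp add: rtyp_def)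

text \<open>Respecting an axiom is invariant under clausewise equality: the chain is
  \<open>M[H',k] = M[H,k] = N[H,k] = N[H',k]\<close>, with \<open>hinst_cong\<close> at both ends.
  This makes it harmless to exchange representatives of a handler.\<close>

lemma htyp_heq:
  assumes "htyp \<Gamma> H \<T> X \<T>'" "heq \<Gamma> H H' \<T> X \<T>'"
  shows "htyp \<Gamma> H' \<T> X \<T>'"
proof (rule ht)
  show "fmdom H' = fmdom (sig \<T>)" using assms by (simp add: heq_def)
next
  fix op A B M assume op: "fmlookup (sig \<T>) op = Some (A, B)" "fmlookup H' op = Some M"
  obtain P where "fmlookup H op = Some P" using htyp_clauseE[OF assms(1) op(1)] .
  with op show "ctyp (TFun (ty_of B) X \<T>' # ty_of A # \<Gamma>) M X \<T>'"
    using assms(2) ceq_typed(2) unfolding heq_def by metis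
next
  fix \<Delta> M N A assume ax: "(\<Delta>, M, N, A) \<in> axs \<T>"
  let ?\<Gamma> = "map ty_of \<Delta> @ TFun (ty_of A) X \<T>' # \<Gamma>" and ?r = "(+) (Suc (length \<Delta>))"
  have r: "rtyp \<Gamma> ?r ?\<Gamma>" using rtyp_add[of \<Gamma> "map ty_of \<Delta> @ [TFun (ty_of A) X \<T>']"] by simp
  have k: "veq ?\<Gamma> (VVar (length \<Delta>)) (VVar (length \<Delta>)) (TFun (ty_of A) X \<T>')"
    by (auto intro!: ve_refl vtyp_VVarI simp: nth_append)
  have "ceq ?\<Gamma> (hinst \<T> X \<T>' (hren ?r H) (VVar (length \<Delta>)) L)
      (hinst \<T> X \<T>' (hren ?r H') (VVar (length \<Delta>)) L) X \<T>'" if "gctyp (sig \<T>) \<Delta> L A" for L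
    by (rule hinst_cong[OF that heq_ren[OF assms(2) r] k])
  moreover have "ceq ?\<Gamma> (hinst \<T> X \<T>' (hren ?r H) (VVar (length \<Delta>)) M)
      (hinst \<T> X \<T>' (hren ?r H) (VVar (length \<Delta>)) N) X \<T>'"
    using assms(1) ax by (auto elim: htypE)
  ultimately show "ceq ?\<Gamma> (hinst \<T> X \<T>' (hren ?r H') (VVar (length \<Delta>)) M)
      (hinst \<T> X \<T>' (hren ?r H') (VVar (length \<Delta>)) N) X \<T>'"
    using axs_typed[OF ax] by (meson ce_sym ce_trans)
qed

lemma ceq_handle:
  assumes "ceq \<Gamma> M M' A \<T>" "htyp \<Gamma> H \<T> B \<T>'" "heq \<Gamma> H H' \<T> B \<T>'" "ceq (A # \<Gamma>) N N' B \<T>'"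
  shows "ceq \<Gamma> (CHandle A \<T> M H N) (CHandle A \<T> M' H' N') B \<T>'"
  using assms htyp_heq[OF assms(2,3)] unfolding heq_def by (intro ce_handle) blast+

lemma vty_eq_aux: "vtyp \<Gamma> V A \<Longrightarrow> vty \<Gamma> V = A" "ctyp \<Gamma> M A \<T> \<Longrightarrow> True" "htyp \<Gamma> H \<T> X \<T>' \<Longrightarrow> True"
  "veq \<Gamma> V W A \<Longrightarrow> True" "ceq \<Gamma> M N A \<T> \<Longrightarrow> True"
proof (induction rule: vtyp_ctyp_htyp_veq_ceq.inducts)
  case (vt_tup \<Gamma> Vs As)
  then show ?case by (auto simp: list_all2_conv_all_nth intro: nth_equalityI)
qed simp_all

lemma vty_eq: "vtyp \<Gamma> V A \<Longrightarrow> vty \<Gamma> V = A"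
  by (rule vty_eq_aux(1))

section \<open>Thunks and one-variable terms\<close>

abbreviation UT :: "('b, 'op) ty" where "UT \<equiv> TProd []"

text \<open>The monad of the term model is \<open>T\<^sub>\<T> A = 1 \<rightarrow> A!\<T>\<close>.\<close>

definition TT :: "('b, 'op) effthy \<Rightarrow> ('b, 'op) ty \<Rightarrow> ('b, 'op) ty" where
  "TT \<T> A = TFun UT A \<T>"

definition thunk :: "('b, 'op) effthy \<Rightarrow> ('b, 'op) ty \<Rightarrow> ('b, 'op) comp \<Rightarrow> ('b, 'op) val" where
  "thunk \<T> A M = VLam UT A \<T> (cren Suc M)"

definition force :: "('b, 'op) val \<Rightarrow> ('b, 'op) comp" where
  "force V = CApp V (VTup [])"

text \<open>A value \<open>W\<close> in a one-variable context is an arrow, and \<open>inst W V\<close> its application to the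
  generalised element \<open>V\<close>. Sending every variable to \<open>V\<close> makes \<open>inst\<close> commute with
  substitutions without typing assumptions.\<close>

definition inst :: "('b, 'op) val \<Rightarrow> ('b, 'op) val \<Rightarrow> ('b, 'op) val" where
  "inst W V = vsubst (\<lambda>_. V) W"

lemma vsubst_thunk [simp]: "vsubst \<sigma> (thunk \<T> A M) = thunk \<T> A (csubst \<sigma> M)"
  by (simp add: thunk_def csubst_up_cren)

lemma upr_Suc_cren: "cren (upr \<xi>) (cren Suc M) = cren Suc (cren \<xi> M)"
  by (simp add: cren_cren) (simp add: comp_def)

lemma vren_thunk [simp]: "vren \<xi> (thunk \<T> A M) = thunk \<T> A (cren \<xi> M)"
  by (simp add: thunk_def upr_Suc_cren)

lemma csubst_force [simp]: "csubst \<sigma> (force V) = force (vsubst \<sigma> V)"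
  by (simp add: force_def)

lemma cren_force [simp]: "cren \<xi> (force V) = force (vren \<xi> V)"
  by (simp add: force_def)

lemma vsubst_inst [simp]: "vsubst \<sigma> (inst W V) = inst W (vsubst \<sigma> V)"
  by (simp add: inst_def vsubst_vsubst comp_def)

lemma vren_inst [simp]: "vren \<xi> (inst W V) = inst W (vren \<xi> V)"
  by (simp add: inst_def vren_vsubst comp_def)

lemma inst_simps:
  "inst (VVar n) V = V"
  "inst (VTup Ws) V = VTup (map (\<lambda>W. inst W V) Ws)"
  "inst (VProj i W) V = VProj i (inst W V)"
  "inst (VInj As i W) V = VInj As i (inst W V)"
  "inst (thunk \<T> A M) V = thunk \<T> A (csubst (\<lambda>_. V) M)"
  "inst (inst U W) V = inst U (inst W V)"
  by (simp_all add: inst_def vsubst_vsubst comp_def)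

named_theorems tt

lemma tt_Var0 [tt]: "vtyp (A # \<Gamma>) (VVar 0) A"
  by (auto intro: vtyp_VVarI)

lemma tt_VarSuc [tt]: "vtyp \<Gamma> (VVar n) A \<Longrightarrow> vtyp (B # \<Gamma>) (VVar (Suc n)) A"
  by (auto intro: vtyp_VVarI)

lemma tt_weak [tt]: "vtyp \<Gamma> V A \<Longrightarrow> vtyp (B # \<Gamma>) (vren Suc V) A"
  by (rule vtyp_ren[OF rtyp_Suc])

lemma ctyp_weak [tt]: "ctyp \<Gamma> M A \<T> \<Longrightarrow> ctyp (B # \<Gamma>) (cren Suc M) A \<T>"
  by (rule ctyp_ren[OF rtyp_Suc])

lemma tt_proj0 [tt]: "vtyp \<Gamma> V (TProd [A, B]) \<Longrightarrow> vtyp \<Gamma> (VProj 0 V) A"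
  by (auto intro: vtyp_VProjI)

lemma tt_proj1 [tt]: "vtyp \<Gamma> V (TProd [A, B]) \<Longrightarrow> vtyp \<Gamma> (VProj (Suc 0) V) B"
  by (auto intro: vtyp_VProjI)

lemma tt_force [tt]: "vtyp \<Gamma> V (TT \<T> A) \<Longrightarrow> ctyp \<Gamma> (force V) A \<T>"
  unfolding force_def TT_def by (rule ct_app[OF _ vtyp_VTup0])

lemma tt_thunk [tt]: "ctyp \<Gamma> M A \<T> \<Longrightarrow> vtyp \<Gamma> (thunk \<T> A M) (TT \<T> A)"
  unfolding thunk_def TT_def by (intro vt_lam ctyp_weak)

lemma tt_inst [tt]: "vtyp [A] W B \<Longrightarrow> vtyp \<Gamma> V A \<Longrightarrow> vtyp \<Gamma> (inst W V) B"
  unfolding inst_def by (rule vtyp_subst[of "[A]"]) (auto simp: styp_def)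

declare vtyp_VTup2 [tt] vtyp_VTup0 [tt] vt_lam [tt] ct_ret [tt] ct_let [tt] ct_app [tt]

lemma veq_inst: "veq [A] W W' B \<Longrightarrow> veq \<Gamma> V V' A \<Longrightarrow> veq \<Gamma> (inst W V) (inst W' V') B"
  unfolding inst_def by (rule vsubst_eq_cong[of "[A]"]) (auto simp: seq_def)

lemma veq_inst2: "vtyp [A] W B \<Longrightarrow> veq \<Gamma> V V' A \<Longrightarrow> veq \<Gamma> (inst W V) (inst W V') B"
  by (rule veq_inst[OF ve_refl])

text \<open>\<open>inst\<close> sends all indices to \<open>VVar 0\<close>, which agrees with the
  identity on the only index of the context \<open>[A]\<close>. Congruence of substitution turns
  this agreement into provable equality without an analysis of free variables.\<close>

lemma inst_Var0: "vtyp [A] W B \<Longrightarrow> veq [A] (inst W (VVar 0)) W B"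
  unfolding inst_def
  using vsubst_cong[of "[A]" W B "\<lambda>_. VVar 0" VVar "[A]"] by (auto simp: seq_def intro: ve_refl tt)

lemma ceq_force: "veq \<Gamma> V W (TT \<T> A) \<Longrightarrow> ceq \<Gamma> (force V) (force W) A \<T>"
  unfolding force_def TT_def by (rule ce_app[OF _ ve_refl[OF vtyp_VTup0]])

lemma veq_thunk: "ceq \<Gamma> M N A \<T> \<Longrightarrow> veq \<Gamma> (thunk \<T> A M) (thunk \<T> A N) (TT \<T> A)"
  unfolding thunk_def TT_def by (intro ve_lam ceq_ren[OF rtyp_Suc])

lemma force_thunk: "ctyp \<Gamma> M A \<T> \<Longrightarrow> ceq \<Gamma> (force (thunk \<T> A M)) M A \<T>"
  using ce_fun_beta[of UT \<Gamma> "cren Suc M" A \<T> "VTup []"]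
  by (simp add: force_def thunk_def ctyp_weak vtyp_VTup0)

lemma veq_UT: "vtyp \<Gamma> V UT \<Longrightarrow> veq \<Gamma> V (VTup []) UT"
  using ve_prod_eta[of \<Gamma> V "[]"] by simp

text \<open>Function eta, after replacing the bound variable of unit type by the empty
  tuple.\<close>

lemma thunk_force: "vtyp \<Gamma> V (TT \<T> A) \<Longrightarrow> veq \<Gamma> (thunk \<T> A (force V)) V (TT \<T> A)"
  unfolding thunk_def cren_force force_def TT_def
  by (rule ve_sym, rule ve_trans[OF ve_fun_eta])
    (auto intro!: ve_lam ce_app[of _ _ _ UT] ve_refl veq_UT tt)

lemma veq_thunk_force: "vtyp \<Gamma> V (TT \<T> A) \<Longrightarrow> ceq \<Gamma> M (force V) A \<T> \<Longrightarrow> veq \<Gamma> (thunk \<T> A M) V (TT \<T> A)"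
  by (rule ve_trans[OF veq_thunk thunk_force])

lemma proj0_tup: "vtyp \<Gamma> V A \<Longrightarrow> vtyp \<Gamma> W B \<Longrightarrow> veq \<Gamma> (VProj 0 (VTup [V, W])) V A"
  using ve_prod_beta[of \<Gamma> "[V, W]" "[A, B]" 0] by simp

lemma proj1_tup: "vtyp \<Gamma> V A \<Longrightarrow> vtyp \<Gamma> W B \<Longrightarrow> veq \<Gamma> (VProj (Suc 0) (VTup [V, W])) W B"
  using ve_prod_beta[of \<Gamma> "[V, W]" "[A, B]" 1] by simp

lemma pair_eta: "vtyp \<Gamma> V (TProd [A, B]) \<Longrightarrow> veq \<Gamma> (VTup [VProj 0 V, VProj (Suc 0) V]) V (TProd [A, B])"
  using ve_sym[OF ve_prod_eta[of \<Gamma> V "[A, B]"]] by (simp add: upt_rec)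

lemma ve_tup2: "veq \<Gamma> V V' A \<Longrightarrow> veq \<Gamma> W W' B \<Longrightarrow> veq \<Gamma> (VTup [V, W]) (VTup [V', W']) (TProd [A, B])"
  by (rule ve_tup) (auto simp: nth_Cons less_Suc_eq split: nat.split)

lemma ve_proj0: "veq \<Gamma> V W (TProd [A, B]) \<Longrightarrow> veq \<Gamma> (VProj 0 V) (VProj 0 W) A"
  using ve_proj[of \<Gamma> V W "[A, B]" 0] by simp

lemma ve_proj1: "veq \<Gamma> V W (TProd [A, B]) \<Longrightarrow> veq \<Gamma> (VProj (Suc 0) V) (VProj (Suc 0) W) B"
  using ve_proj[of \<Gamma> V W "[A, B]" 1] by simp

lemma proj0_tup': "veq \<Gamma> V V' A \<Longrightarrow> vtyp \<Gamma> W B \<Longrightarrow> veq \<Gamma> (VProj 0 (VTup [V, W])) V' A"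
  by (meson proj0_tup ve_trans veq_typed)

lemma proj1_tup': "vtyp \<Gamma> V A \<Longrightarrow> veq \<Gamma> W W' B \<Longrightarrow> veq \<Gamma> (VProj (Suc 0) (VTup [V, W])) W' B"
  by (meson proj1_tup ve_trans veq_typed)

lemma force_thunk': "ceq \<Gamma> M N A \<T> \<Longrightarrow> ceq \<Gamma> (force (thunk \<T> A M)) N A \<T>"
  by (meson force_thunk ce_trans ceq_typed)

lemma ve_var0: "veq (A # \<Gamma>) (VVar 0) (VVar 0) A"
  by (intro ve_refl tt)

lemma ve_varSuc: "vtyp \<Gamma> (VVar n) A \<Longrightarrow> veq (B # \<Gamma>) (VVar (Suc n)) (VVar (Suc n)) A"
  by (intro ve_refl tt)

text \<open>The rules \<open>qq\<close> decide an equation between a term and one of its reducts by resolution,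
  in the given order.\<close>

lemmas qq = ve_var0 ve_varSuc proj0_tup' proj1_tup' force_thunk' ve_tup2 ve_proj0 ve_proj1 veq_inst2
  veq_thunk ceq_force ce_ret ce_let ce_app

text \<open>\<open>W\<close> is a reduct of \<open>V\<close> and \<open>K\<close> the intended end
  of the computation. With the right-hand side left open, the rule can be chained by resolution as
  one reduction step at the head.\<close>

lemma let_ret:
  "ctyp (A # \<Gamma>) N B \<T> \<Longrightarrow> veq \<Gamma> V W A \<Longrightarrow> ceq \<Gamma> (csubst1 W N) K B \<T> \<Longrightarrow>
    ceq \<Gamma> (CLet A (CRet V) N) K B \<T>"
  by (meson ce_let_ret ce_trans csubst1_cong ce_refl veq_typed)

lemma let_let:
  assumes "ctyp (B # \<Gamma>) P C \<T>" "ctyp \<Gamma> M A \<T>" "ctyp (A # \<Gamma>) N B \<T>"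
    "ceq \<Gamma> (CLet A M (CLet B N (cren (upr Suc) P))) K C \<T>"
  shows "ceq \<Gamma> (CLet B (CLet A M N) P) K C \<T>"
  using ce_trans[OF ce_let_let[OF assms(2,3,1)] assms(4)] .

text \<open>Here \<open>W\<close> is the substituted value in reduced form.\<close>

lemma let_let_ret:
  assumes P: "ctyp (B # \<Gamma>) P C \<T>" and M: "ctyp \<Gamma> M A \<T>" and VW: "veq (A # \<Gamma>) V W B"
    and K: "ceq \<Gamma> (CLet A M (csubst (scons W (\<lambda>n. VVar (Suc n))) P)) K C \<T>"
  shows "ceq \<Gamma> (CLet B (CLet A M (CRet V)) P) K C \<T>"
proof (rule let_let[OF P M ct_ret[OF veq_typed(1)[OF VW]]])
  have "scons W VVar \<circ> upr Suc = scons W (\<lambda>n. VVar (Suc n))"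
    by (rule ext) (simp add: scons_def upr_def split: nat.split)
  then have *: "csubst1 W (cren (upr Suc) P) = csubst (scons W (\<lambda>n. VVar (Suc n))) P"
    by (simp add: csubst1_def csubst_cren)
  have P': "ctyp (B # A # \<Gamma>) (cren (upr Suc) P) C \<T>"
    by (rule ctyp_ren[OF rtyp_upr[OF rtyp_Suc] P])
  have "ceq (A # \<Gamma>) (CLet B (CRet V) (cren (upr Suc) P)) (csubst (scons W (\<lambda>n. VVar (Suc n))) P) C \<T>"
    using let_ret[OF P' VW ce_refl[OF ctyp_csubst1[OF P' veq_typed(2)[OF VW]]]] by (simp add: *)
  from ce_trans[OF ce_let[OF ce_refl[OF M] this] K]
  show "ceq \<Gamma> (CLet A M (CLet B (CRet V) (cren (upr Suc) P))) K C \<T>" .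
qed

lemma let_eta: "ceq \<Gamma> M N A \<T> \<Longrightarrow> ceq \<Gamma> (CLet A M (CRet (VVar 0))) N A \<T>"
  by (meson ce_let_eta ce_trans ceq_typed)

lemma let_thunk:
  "ceq \<Gamma> (CLet A M N) K B \<T> \<Longrightarrow> ceq \<Gamma> (CLet A (force (thunk \<T> A M)) N) K B \<T>"
  by (meson ce_trans ceq_typed ctyp_CLetE ce_let ce_refl force_thunk)

section \<open>The arrows of the term model\<close>

definition tmV :: "('b, 'op) effthy \<Rightarrow> ('b, 'op) ty \<Rightarrow> ('b, 'op) ty \<Rightarrow> ('b, 'op) val \<Rightarrow> ('b, 'op) val" where
  "tmV \<T> A B f = thunk \<T> B (CLet A (force (VVar 0)) (CRet (inst f (VVar 0))))"

definition etaV :: "('b, 'op) effthy \<Rightarrow> ('b, 'op) ty \<Rightarrow> ('b, 'op) val" where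
  "etaV \<T> A = thunk \<T> A (CRet (VVar 0))"

definition muV :: "('b, 'op) effthy \<Rightarrow> ('b, 'op) ty \<Rightarrow> ('b, 'op) val" where
  "muV \<T> A = thunk \<T> A (CLet (TT \<T> A) (force (VVar 0)) (force (VVar 0)))"

definition stV :: "('b, 'op) effthy \<Rightarrow> ('b, 'op) ty \<Rightarrow> ('b, 'op) ty \<Rightarrow> ('b, 'op) val" where
  "stV \<T> A B = thunk \<T> (TProd [A, B]) (CLet B (force (VProj (Suc 0) (VVar 0)))
    (CRet (VTup [VProj 0 (VVar (Suc 0)), VVar 0])))"

definition kevV :: "('b, 'op) effthy \<Rightarrow> ('b, 'op) ty \<Rightarrow> ('b, 'op) val" where
  "kevV \<T> B = thunk \<T> B (CApp (VProj 0 (VVar 0)) (VProj (Suc 0) (VVar 0)))"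

definition kcurV :: "('b, 'op) effthy \<Rightarrow> ('b, 'op) ty \<Rightarrow> ('b, 'op) ty \<Rightarrow> ('b, 'op) val \<Rightarrow> ('b, 'op) val" where
  "kcurV \<T> A B f = VLam A B \<T> (force (inst f (VTup [VVar (Suc 0), VVar 0])))"

definition cotV :: "('b, 'op) effthy \<Rightarrow> ('b, 'op) ty \<Rightarrow> ('b, 'op) val list \<Rightarrow> ('b, 'op) val" where
  "cotV \<T> B fs = thunk \<T> B (CCase (VProj (Suc 0) (VVar 0))
    (map (\<lambda>f. force (inst f (VTup [VProj 0 (VVar (Suc 0)), VVar 0]))) fs))"

definition opnV :: "('b, 'op) effthy \<Rightarrow> 'op \<Rightarrow> ('b, 'op) val" where
  "opnV \<T> op = thunk \<T> (ty_of (resty \<T> op)) (COp op (VVar 0))"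

text \<open>The handler given by an element \<open>h\<close> of the handler object.\<close>

definition hof :: "('b, 'op) effthy \<Rightarrow> ('b, 'op) val \<Rightarrow> ('b, 'op) handler" where
  "hof \<T> h = fmmap_keys
    (\<lambda>op _. CApp (VProj (op_index \<T> op) (vren (\<lambda>n. Suc (Suc n)) h)) (VTup [VVar (Suc 0), VVar 0])) (sig \<T>)"

text \<open>The computation in \<open>f\<close> returns values of type \<open>TT \<T>' X\<close>,
  which are themselves thunks; the return clause runs them, as \<open>handle\<close> maps
  \<open>T T' X\<close> to \<open>T' X\<close>.\<close>

definition hdlV :: "('b, 'op) effthy \<Rightarrow> ('b, 'op) effthy \<Rightarrow> ('b, 'op) ty \<Rightarrow> ('b, 'op) val \<Rightarrow> ('b, 'op) val \<Rightarrow> ('b, 'op) val" where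
  "hdlV \<T> \<T>' X h f = thunk \<T>' X (CHandle (TT \<T>' X) \<T> (force f) (hof \<T> h) (force (VVar 0)))"

definition crossV :: "('b, 'op) val \<Rightarrow> ('b, 'op) val \<Rightarrow> ('b, 'op) val" where
  "crossV f g = VTup [inst f (VProj 0 (VVar 0)), inst g (VProj (Suc 0) (VVar 0))]"

text \<open>Every clause depends on its environment only through \<open>h\<close>. Naturality of the
  handling operation in the model ultimately rests on this.\<close>

lemma hsubst_hof [simp]: "hsubst \<sigma> (hof \<T> h) = hof \<T> (vsubst \<sigma> h)"
proof (rule fmap_ext)
  fix op
  show "fmlookup (hsubst \<sigma> (hof \<T> h)) op = fmlookup (hof \<T> (vsubst \<sigma> h)) op"
    by (cases "fmlookup (sig \<T>) op") (simp_all add: hof_def vsubst_vren vren_vsubst, simp add: comp_def vren_vren)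
qed

lemma hren_hof [simp]: "hren \<xi> (hof \<T> h) = hof \<T> (vren \<xi> h)"
  using hsubst_hof[of "\<lambda>n. VVar (\<xi> n)" \<T> h] by (simp add: hsubst_var vsubst_var)

lemma inst_arrows [simp]:
  "inst (tmV \<T> A B f) V = thunk \<T> B (CLet A (force V) (CRet (inst f (VVar 0))))"
  "inst (etaV \<T> A) V = thunk \<T> A (CRet V)"
  "inst (muV \<T> A) V = thunk \<T> A (CLet (TT \<T> A) (force V) (force (VVar 0)))"
  "inst (stV \<T> A B) V = thunk \<T> (TProd [A, B]) (CLet B (force (VProj (Suc 0) V))
    (CRet (VTup [VProj 0 (vren Suc V), VVar 0])))"
  "inst (kevV \<T> B) V = thunk \<T> B (CApp (VProj 0 V) (VProj (Suc 0) V))"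
  "inst (kcurV \<T> A B f) V = VLam A B \<T> (force (inst f (VTup [vren Suc V, VVar 0])))"
  "inst (cotV \<T> B fs) V = thunk \<T> B (CCase (VProj (Suc 0) V)
    (map (\<lambda>f. force (inst f (VTup [VProj 0 (vren Suc V), VVar 0]))) fs))"
  "inst (opnV \<T> op) V = thunk \<T> (ty_of (resty \<T> op)) (COp op V)"
  "inst (hdlV \<T> \<T>' X h f) V =
     thunk \<T>' X (CHandle (TT \<T>' X) \<T> (force (inst f V)) (hof \<T> (inst h V)) (force (VVar 0)))"
  "inst (crossV f g) V = VTup [inst f (VProj 0 V), inst g (VProj (Suc 0) V)]"
  by (simp_all add: tmV_def etaV_def muV_def stV_def kevV_def kcurV_def cotV_def opnV_def hdlV_def
      crossV_def inst_simps)
    (simp_all add: inst_def vsubst_vsubst comp_def)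

lemmas arrow_defs = tmV_def etaV_def muV_def stV_def kevV_def crossV_def

declare inst_simps [simp]

lemma let_proj0:
  "vtyp \<Gamma> W B \<Longrightarrow> vtyp \<Gamma> V (TT \<T> A) \<Longrightarrow> ceq \<Gamma> (CLet A (force V) N) K C \<T> \<Longrightarrow>
    ceq \<Gamma> (CLet A (force (VProj 0 (VTup [V, W]))) N) K C \<T>"
  by (meson ce_trans ceq_typed ctyp_CLetE ce_let ce_refl ceq_force proj0_tup)

lemma let_proj1:
  "vtyp \<Gamma> V B \<Longrightarrow> vtyp \<Gamma> W (TT \<T> A) \<Longrightarrow> ceq \<Gamma> (CLet A (force W) N) K C \<T> \<Longrightarrow>
    ceq \<Gamma> (CLet A (force (VProj (Suc 0) (VTup [V, W]))) N) K C \<T>"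
  by (meson ce_trans ceq_typed ctyp_CLetE ce_let ce_refl ceq_force proj1_tup)

text \<open>The product type of \<open>W\<close> does not occur in the statement, so resolution
  could not guess it; it is recovered by inverting the typing of \<open>VProj i W\<close>.\<close>

lemma ve_proj_proj1:
  assumes "vtyp \<Gamma> V B" "veq \<Gamma> (VProj i W) K A"
  shows "veq \<Gamma> (VProj i (VProj (Suc 0) (VTup [V, W]))) K A"
proof -
  obtain As where W: "vtyp \<Gamma> W (TProd As)" "i < length As" "A = As ! i"
    using veq_typed(1)[OF assms(2)] by (auto elim: vtyp_VProjE)
  then show ?thesis
    using ve_trans[OF ve_proj[OF proj1_tup[OF assms(1) W(1)] W(2)]] assms(2) by simp
qed

lemma let_proj_proj1:
  assumes "vtyp \<Gamma> V B" "vtyp \<Gamma> (VProj i W) (TT \<T> A)" "ceq \<Gamma> (CLet A (force (VProj i W)) N) K C \<T>"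
  shows "ceq \<Gamma> (CLet A (force (VProj i (VProj (Suc 0) (VTup [V, W])))) N) K C \<T>"
  using ve_proj_proj1[OF assms(1) ve_refl[OF assms(2)]] assms(3)
  by (meson ce_trans ceq_typed ctyp_CLetE ce_let ce_refl ceq_force)

text \<open>The order is a reduction strategy: redexes at the head of a let and nested projections
  come before the congruence rules in \<open>qq\<close>.\<close>

lemmas qqs = let_proj_proj1 ve_proj_proj1 let_thunk let_proj0 let_proj1 let_let_ret let_let let_ret qq

section \<open>Typing of the arrows; monad and strength laws\<close>

lemma etaV_typed: "vtyp [A] (etaV \<T> A) (TT \<T> A)"
  unfolding etaV_def by (assumption | rule tt)+

lemma muV_typed: "vtyp [TT \<T> (TT \<T> A)] (muV \<T> A) (TT \<T> A)"
  unfolding muV_def by (assumption | rule tt)+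

lemma stV_typed: "vtyp [TProd [A', TT \<T> A]] (stV \<T> A' A) (TT \<T> (TProd [A', A]))"
  unfolding stV_def by (assumption | rule tt)+

lemma kevV_typed: "vtyp [TProd [TFun A B \<T>, A]] (kevV \<T> B) (TT \<T> B)"
  unfolding kevV_def by (assumption | rule tt)+

lemma opnV_typed:
  "fmlookup (sig \<T>) op = Some (A, B) \<Longrightarrow> vtyp [ty_of A] (opnV \<T> op) (TT \<T> (ty_of B))"
  unfolding opnV_def by (auto simp: gctyp_argty intro!: tt_thunk ct_op tt_Var0)

lemma tmV_id: "veq [TT \<T> A] (tmV \<T> A A (VVar 0)) (VVar 0) (TT \<T> A)"
  unfolding tmV_def inst_simps
  by (rule veq_thunk_force tt let_eta qq)+

lemma muV_etaT: "veq [TT \<T> A] (inst (muV \<T> A) (etaV \<T> (TT \<T> A))) (VVar 0) (TT \<T> A)"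
  by ((simp add: arrow_defs), (rule veq_thunk_force))
    (assumption | rule tt qqs | simp add: csubst1_def)+

text \<open>The composite reduces to a let that returns its own variable, so the comparison goes
  through that form of \<open>force (VVar 0)\<close> and ends with the right unit law of
  let.\<close>

lemma muV_Teta: "veq [TT \<T> A] (inst (muV \<T> A) (tmV \<T> A (TT \<T> A) (etaV \<T> A))) (VVar 0) (TT \<T> A)"
  by (simp add: tmV_def, rule veq_thunk_force, rule tt, rule ce_trans[OF _ let_eta])
    (assumption | rule tt qqs | simp)+

text \<open>The rules reduce a term towards a known target, so an equation with redexes on both
  sides needs a named meeting point. Here \<open>?k\<close> runs the three layers of thunks one
  after the other; the same pattern serves the naturality and strength laws below.\<close>

lemma muV_muV:
  "veq [TT \<T> (TT \<T> (TT \<T> A))] (inst (muV \<T> A) (muV \<T> (TT \<T> A)))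
     (inst (muV \<T> A) (tmV \<T> (TT \<T> (TT \<T> A)) (TT \<T> A) (muV \<T> A))) (TT \<T> A)"
  (is "veq _ ?l ?r _")
proof (rule ve_trans[OF _ ve_sym])
  let ?k = "thunk \<T> A (CLet (TT \<T> (TT \<T> A)) (force (VVar 0)) (CLet (TT \<T> A) (force (VVar 0)) (force (VVar 0))))"
  show "veq [TT \<T> (TT \<T> (TT \<T> A))] ?l ?k (TT \<T> A)"
    by (simp add: muV_def) (assumption | rule tt qqs | simp)+
  show "veq [TT \<T> (TT \<T> (TT \<T> A))] ?r ?k (TT \<T> A)"
    by (simp add: tmV_def) (assumption | rule tt qqs | simp)+
qed

lemma stV_unit:
  "veq [TProd [UT, TT \<T> A]] (inst (tmV \<T> (TProd [UT, A]) A (VProj (Suc 0) (VVar 0))) (stV \<T> UT A))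
     (VProj (Suc 0) (VVar 0)) (TT \<T> A)"
  by (simp add: stV_def, rule veq_thunk_force, (rule tt)+, rule ce_trans[OF _ let_eta])
    (assumption | rule tt qqs | simp)+

definition assocV :: "('b, 'op) val" where
  "assocV = VTup [VProj 0 (VProj 0 (VVar 0)), VTup [VProj (Suc 0) (VProj 0 (VVar 0)), VProj (Suc 0) (VVar 0)]]"

lemma stV_assoc:
  "veq [TProd [TProd [A, B], TT \<T> C]]
     (inst (tmV \<T> (TProd [TProd [A, B], C]) (TProd [A, TProd [B, C]]) assocV) (stV \<T> (TProd [A, B]) C))
     (inst (stV \<T> A (TProd [B, C])) (inst (crossV (VVar 0) (stV \<T> B C)) assocV))
     (TT \<T> (TProd [A, TProd [B, C]]))"
  (is "veq ?\<Gamma> ?l ?r ?T")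
proof (rule ve_trans[OF _ ve_sym])
  let ?k = "thunk \<T> (TProd [A, TProd [B, C]]) (CLet C (force (VProj (Suc 0) (VVar 0)))
    (CRet (VTup [VProj 0 (VProj 0 (VVar (Suc 0))), VTup [VProj (Suc 0) (VProj 0 (VVar (Suc 0))), VVar 0]])))"
  show "veq ?\<Gamma> ?l ?k ?T"
    by (simp add: stV_def assocV_def) (assumption | rule tt qqs | simp)+
  show "veq ?\<Gamma> ?r ?k ?T"
    by (simp add: crossV_def assocV_def) (assumption | rule tt qqs | simp)+
qed

text \<open>Reduction leaves the pair of the two projections of the variable; surjective pairing
  identifies it with the variable.\<close>

lemma stV_eta:
  "veq [TProd [A, B]] (inst (stV \<T> A B) (crossV (VVar 0) (etaV \<T> B))) (etaV \<T> (TProd [A, B]))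
     (TT \<T> (TProd [A, B]))"
  unfolding etaV_def[of _ "TProd [A, B]"]
  by ((simp add: crossV_def), (rule ve_trans[OF _ veq_thunk[OF ce_ret[OF pair_eta]]]))
    (assumption | rule tt qqs | simp add: csubst1_def)+

lemma stV_mu:
  "veq [TProd [A, TT \<T> (TT \<T> B)]]
     (inst (stV \<T> A B) (crossV (VVar 0) (muV \<T> B)))
     (inst (muV \<T> (TProd [A, B])) (inst (tmV \<T> (TProd [A, TT \<T> B]) (TT \<T> (TProd [A, B])) (stV \<T> A B))
       (stV \<T> A (TT \<T> B)))) (TT \<T> (TProd [A, B]))"
  (is "veq ?\<Gamma> ?l ?r ?T")
proof (rule ve_trans[OF _ ve_sym])
  let ?k = "thunk \<T> (TProd [A, B]) (CLet (TT \<T> B) (force (VProj (Suc 0) (VVar 0)))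
    (CLet B (force (VVar 0)) (CRet (VTup [VProj 0 (VVar (Suc (Suc 0))), VVar 0]))))"
  show "veq ?\<Gamma> ?l ?k ?T"
    by (simp add: crossV_def) (assumption | rule tt qqs | simp)+
  show "veq ?\<Gamma> ?r ?k ?T"
    by (simp add: stV_def) (assumption | rule tt qqs | simp)+
qed

context
  fixes \<T> :: "('b, 'op) effthy" and A A' B B' C :: "('b, 'op) ty" and f :: "('b, 'op) val"
  assumes f: "vtyp [A] f B"
begin

lemma tmV_typed: "vtyp [TT \<T> A] (tmV \<T> A B f) (TT \<T> B)"
  unfolding tmV_def by (assumption | rule tt f)+

lemma tmV_comp:
  assumes g: "vtyp [B] g C"
  shows "veq [TT \<T> A] (inst (tmV \<T> B C g) (tmV \<T> A B f)) (tmV \<T> A C (inst g f)) (TT \<T> C)"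
  by (simp add: tmV_def) (assumption | rule tt f g qqs | simp)+

lemma etaV_nat: "veq [A] (inst (tmV \<T> A B f) (etaV \<T> A)) (inst (etaV \<T> B) f) (TT \<T> B)"
  by (simp add: etaV_def) (assumption | rule tt f qqs inst_Var0 | simp add: csubst1_def)+

lemma muV_nat:
  "veq [TT \<T> (TT \<T> A)] (inst (muV \<T> B) (tmV \<T> (TT \<T> A) (TT \<T> B) (tmV \<T> A B f)))
     (inst (tmV \<T> A B f) (muV \<T> A)) (TT \<T> B)"
  (is "veq ?\<Gamma> ?l ?r ?T")
proof (rule ve_trans[OF _ ve_sym])
  let ?k = "thunk \<T> B (CLet (TT \<T> A) (force (VVar 0)) (CLet A (force (VVar 0)) (CRet (inst f (VVar 0)))))"
  show "veq ?\<Gamma> ?l ?k ?T"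
    by (simp add: tmV_def[of _ "TT \<T> A"]) (assumption | rule tt f qqs | simp)+
  show "veq ?\<Gamma> ?r ?k ?T"
    by (simp add: muV_def) (assumption | rule tt f qqs | simp)+
qed

lemma stV_nat:
  assumes g: "vtyp [A'] g B'"
  shows "veq [TProd [A, TT \<T> A']] (inst (stV \<T> B B') (crossV f (tmV \<T> A' B' g)))
    (inst (tmV \<T> (TProd [A, A']) (TProd [B, B']) (crossV f g)) (stV \<T> A A')) (TT \<T> (TProd [B, B']))"
  (is "veq ?\<Gamma> ?l ?r ?T")
proof (rule ve_trans[OF _ ve_sym])
  let ?k = "thunk \<T> (TProd [B, B']) (CLet A' (force (VProj (Suc 0) (VVar 0)))
    (CRet (VTup [inst f (VProj 0 (VVar (Suc 0))), inst g (VVar 0)])))"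
  show "veq ?\<Gamma> ?l ?k ?T"
    by (simp add: crossV_def) (assumption | rule tt f g qqs | simp)+
  show "veq ?\<Gamma> ?r ?k ?T"
    by (simp add: stV_def) (assumption | rule tt f g qqs | simp)+
qed

end

lemma tmV_cong:
  assumes "veq [A] f g B"
  shows "veq [TT \<T> A] (tmV \<T> A B f) (tmV \<T> A B g) (TT \<T> B)"
  unfolding tmV_def by (rule tt veq_inst[OF assms] qq)+

subsection \<open>Kleisli exponentials and coproducts\<close>

lemma kcurV_typed: "vtyp [TProd [X, A]] f (TT \<T> B) \<Longrightarrow> vtyp [X] (kcurV \<T> A B f) (TFun A B \<T>)"
  unfolding kcurV_def by (assumption | rule tt)+

lemma kcurV_cong:
  assumes "veq [TProd [X, A]] f g (TT \<T> B)"
  shows "veq [X] (kcurV \<T> A B f) (kcurV \<T> A B g) (TFun A B \<T>)"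
  unfolding kcurV_def by (rule tt ve_lam veq_inst[OF assms] qq)+

lemma fun_beta:
  "ctyp (A # \<Gamma>) M B \<T> \<Longrightarrow> veq \<Gamma> V V' A \<Longrightarrow> ceq \<Gamma> (csubst1 V' M) K B \<T> \<Longrightarrow>
    ceq \<Gamma> (CApp (VLam A B \<T> M) V) K B \<T>"
  by (meson ce_trans ce_fun_beta csubst1_cong ce_refl veq_typed)

text \<open>Function beta, framed by projections of an explicit pair before it and surjective
  pairing after it, because the argument of \<open>f\<close> is rebuilt from its components.\<close>

lemma kevV_beta:
  assumes f: "vtyp [TProd [X, A]] f (TT \<T> B)"
  shows "veq [TProd [X, A]] (inst (kevV \<T> B) (crossV (kcurV \<T> A B f) (VVar 0))) f (TT \<T> B)"
proof -
  have 1: "ceq [TProd [X, A]] (CApp (VProj 0 (VTup [VLam A B \<T> (force (inst f (VTup [VProj 0 (VVar (Suc 0)), VVar 0]))),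
        VProj (Suc 0) (VVar 0)]))
      (VProj (Suc 0) (VTup [VLam A B \<T> (force (inst f (VTup [VProj 0 (VVar (Suc 0)), VVar 0]))), VProj (Suc 0) (VVar 0)])))
      (CApp (VLam A B \<T> (force (inst f (VTup [VProj 0 (VVar (Suc 0)), VVar 0])))) (VProj (Suc 0) (VVar 0))) B \<T>"
    by (rule f tt qq ve_lam)+
  have 2: "ceq [TProd [X, A]] (CApp (VLam A B \<T> (force (inst f (VTup [VProj 0 (VVar (Suc 0)), VVar 0])))) (VProj (Suc 0) (VVar 0)))
      (force (inst f (VTup [VProj 0 (VVar 0), VProj (Suc 0) (VVar 0)]))) B \<T>"
    by (rule fun_beta) (rule f tt qq | simp add: csubst1_def)+
  have 3: "ceq [TProd [X, A]] (force (inst f (VTup [VProj 0 (VVar 0), VProj (Suc 0) (VVar 0)]))) (force f) B \<T>"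
    by (rule ceq_force ve_trans[OF veq_inst2[OF f pair_eta] inst_Var0] f tt)+
  show ?thesis
    using veq_thunk_force[OF f ce_trans[OF ce_trans[OF 1 2] 3]] by (simp add: crossV_def)
qed

text \<open>Uniqueness of transposes is function eta. It is stated as a computation: the transpose
  of the evaluation of \<open>g\<close> is \<open>g\<close>.\<close>

lemma kcurV_unique:
  assumes g: "vtyp [X] g (TFun A B \<T>)"
  shows "veq [X] (kcurV \<T> A B (inst (kevV \<T> B) (crossV g (VVar 0)))) g (TFun A B \<T>)"
proof -
  have 1: "veq [X] (kcurV \<T> A B (inst (kevV \<T> B) (crossV g (VVar 0))))
     (VLam A B \<T> (CApp (inst g (VVar (Suc 0))) (VVar 0))) (TFun A B \<T>)"
    by (simp add: crossV_def kcurV_def) (rule g tt qq ve_lam | simp)+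
  have 2: "veq [X] (inst g (VVar 0)) (VLam A B \<T> (CApp (inst g (VVar (Suc 0))) (VVar 0))) (TFun A B \<T>)"
    using ve_fun_eta[OF tt_inst[OF g tt_Var0]] by simp
  show ?thesis by (rule ve_trans[OF 1 ve_trans[OF ve_sym[OF 2] inst_Var0[OF g]]])
qed

lemma cotV_typed:
  assumes "list_all2 (\<lambda>f A. vtyp [TProd [Z, A]] f (TT \<T> Y)) fs As"
  shows "vtyp [TProd [Z, TSum As]] (cotV \<T> Y fs) (TT \<T> Y)"
  unfolding cotV_def
  by (rule tt ct_case)+ (use assms in \<open>auto simp: list_all2_conv_all_nth intro!: tt\<close>)

lemma cotV_cong:
  assumes "list_all2 (\<lambda>f A. vtyp [TProd [Z, A]] f (TT \<T> Y)) fs As" "length gs = length fs"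
    "\<And>i. i < length As \<Longrightarrow> veq [TProd [Z, As ! i]] (fs ! i) (gs ! i) (TT \<T> Y)"
  shows "veq [TProd [Z, TSum As]] (cotV \<T> Y fs) (cotV \<T> Y gs) (TT \<T> Y)"
proof -
  have "length fs = length As" using assms(1) by (rule list_all2_lengthD)
  with assms(2,3) show ?thesis unfolding cotV_def
    by (intro veq_thunk ce_case[of _ _ _ As] ve_refl) (auto intro!: ceq_force veq_inst ve_refl tt)
qed

text \<open>Sum beta. Distributivity costs nothing: the parameter of type \<open>Z\<close> is a
  variable of the context and stays available inside every branch.\<close>

lemma cotV_beta:
  fixes As :: "('b, 'op) ty list"
  assumes fs: "list_all2 (\<lambda>f A. vtyp [TProd [Z, A]] f (TT \<T> Y)) fs As" and i: "i < length As"
  shows "veq [TProd [Z, As ! i]] (inst (cotV \<T> Y fs) (crossV (VVar 0) (VInj As i (VVar 0)))) (fs ! i) (TT \<T> Y)"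
proof -
  let ?\<Gamma> = "[TProd [Z, As ! i]]" and ?V = "VProj (Suc 0) (VVar 0) :: ('b, 'op) val"
  let ?z = "VTup [VProj 0 (VVar 0), VInj As i ?V]"
  let ?Ms = "map (\<lambda>f. force (inst f (VTup [VProj 0 (vren Suc ?z), VVar 0]))) fs"
  have f: "vtyp [TProd [Z, As ! i]] (fs ! i) (TT \<T> Y)" and len: "length fs = length As"
    using fs i by (auto simp: list_all2_conv_all_nth)
  have V: "vtyp ?\<Gamma> ?V (As ! i)" by (rule tt)+
  have Ms: "list_all2 (\<lambda>A M. ctyp (A # ?\<Gamma>) M Y \<T>) As ?Ms"
    using fs i by (auto simp: list_all2_conv_all_nth intro!: tt vt_inj)
  have 1: "ceq ?\<Gamma> (CCase (VProj (Suc 0) ?z) ?Ms) (CCase (VInj As i ?V) ?Ms) Y \<T>"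
  proof (rule ce_case[of _ _ _ As])
    show "veq ?\<Gamma> (VProj (Suc 0) ?z) (VInj As i ?V) (TSum As)"
      by (rule proj1_tup tt vt_inj i)+
    show "ceq (As ! j # ?\<Gamma>) (?Ms ! j) (?Ms ! j) Y \<T>" if "j < length As" for j
      using Ms that list_all2_nthD[OF Ms] by (intro ce_refl) simp
  qed (use len in simp_all)
  have "csubst1 ?V (?Ms ! i) = force (inst (fs ! i) (VTup [VProj 0 ?z, ?V]))"
    using i len by (simp add: csubst1_def)
  with ce_sum_beta[OF i V Ms]
  have 2: "ceq ?\<Gamma> (CCase (VInj As i ?V) ?Ms) (force (inst (fs ! i) (VTup [VProj 0 ?z, ?V]))) Y \<T>" by simp
  have 3: "ceq ?\<Gamma> (force (inst (fs ! i) (VTup [VProj 0 ?z, ?V]))) (force (inst (fs ! i) (VTup [VProj 0 (VVar 0), ?V]))) Y \<T>"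
    by (rule f qq tt vt_inj i)+
  have 4: "ceq ?\<Gamma> (force (inst (fs ! i) (VTup [VProj 0 (VVar 0), ?V]))) (force (fs ! i)) Y \<T>"
    by (rule ceq_force ve_trans[OF veq_inst2[OF f pair_eta] inst_Var0] f tt)+
  show ?thesis
    using veq_thunk_force[OF f ce_trans[OF 1 ce_trans[OF 2 ce_trans[OF 3 4]]]] by (simp add: crossV_def comp_def)
qed

text \<open>Sum eta, applied to the computation \<open>?M\<close> in which the scrutinee is
  abstracted from \<open>force g\<close> while the parameter is kept. As the rule holds for
  arbitrary computations, it yields uniqueness among Kleisli arrows for every monad.\<close>

lemma cotV_unique:
  fixes As :: "('b, 'op) ty list"
  assumes g: "vtyp [TProd [Z, TSum As]] g (TT \<T> Y)"
  shows "veq [TProd [Z, TSum As]]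
    (cotV \<T> Y (map (\<lambda>i. inst g (crossV (VVar 0) (VInj As i (VVar 0)))) [0..<length As])) g (TT \<T> Y)"
proof -
  let ?\<Gamma> = "[TProd [Z, TSum As]]" and ?V = "VProj (Suc 0) (VVar 0) :: ('b, 'op) val"
  let ?M = "force (inst g (VTup [VProj 0 (VVar (Suc 0)), VVar 0]))"
  let ?Ms = "map (\<lambda>i. force (inst g (VTup [VProj 0 (VTup [VProj 0 (VVar (Suc 0)), VVar 0]),
    VInj As i (VProj (Suc 0) (VTup [VProj 0 (VVar (Suc 0)), VVar 0]))]))) [0..<length As]"
  have V: "vtyp ?\<Gamma> ?V (TSum As)" by (rule tt)+
  have M: "ctyp (TSum As # ?\<Gamma>) ?M Y \<T>" by (rule tt g)+
  have 1: "ceq ?\<Gamma> (CCase ?V ?Ms) (CCase ?V (map (\<lambda>i. force (inst g (VTup [VProj 0 (VVar (Suc 0)), VInj As i (VVar 0)]))) [0..<length As])) Y \<T>"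
    by (rule ce_case[of _ _ _ As], (rule ve_refl V)+, simp, simp, simp)
      (rule g tt qq ve_inj | assumption)+
  have 2: "ceq ?\<Gamma> (csubst1 ?V ?M) (CCase ?V (map (\<lambda>i. force (inst g (VTup [VProj 0 (VVar (Suc 0)), VInj As i (VVar 0)]))) [0..<length As])) Y \<T>"
    using ce_sum_eta[OF V M] by simp
  have 3: "ceq ?\<Gamma> (csubst1 ?V ?M) (force g) Y \<T>"
    unfolding csubst1_def
    by simp (rule ceq_force ve_trans[OF veq_inst2[OF g pair_eta] inst_Var0] g tt)+
  show ?thesis
    using veq_thunk_force[OF g ce_trans[OF 1 ce_trans[OF ce_sym[OF 2] 3]]] by (simp add: crossV_def cotV_def comp_def)
qed

subsection \<open>Sequencing\<close>

text \<open>The composite of functor action and strength is just a let whose body sees both the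
  environment and the result.\<close>

lemma strmapV:
  assumes f: "vtyp [G] f (TT \<T> A)" and g: "vtyp [TProd [G, A]] g B"
  shows "veq [G] (inst (tmV \<T> (TProd [G, A]) B g) (inst (stV \<T> G A) (VTup [VVar 0, f])))
    (thunk \<T> B (CLet A (force f) (CRet (inst g (VTup [VVar (Suc 0), VVar 0]))))) (TT \<T> B)"
  by simp
    (rule f g tt qqs | simp | rule ceq_force ve_refl)+

lemma muV_thunk:
  assumes f: "vtyp [G] f (TT \<T> A)" and g: "vtyp [TProd [G, A]] g (TT \<T> B)"
  shows "veq [G] (inst (muV \<T> B) (thunk \<T> (TT \<T> B) (CLet A (force f) (CRet (inst g (VTup [VVar (Suc 0), VVar 0]))))))
    (thunk \<T> B (CLet A (force f) (force (inst g (VTup [VVar (Suc 0), VVar 0]))))) (TT \<T> B)"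
  by simp
    (rule f g tt qqs | simp | rule ceq_force ve_refl)+

subsection \<open>Handlers\<close>

text \<open>Signatures are finite maps, so the enumeration chosen in \<open>ops\<close>
  exists.\<close>

lemma ops_spec: "distinct (ops \<T>)" "set (ops \<T>) = fset (fmdom (sig \<T>))"
proof -
  have "\<exists>xs. distinct xs \<and> set xs = fset (fmdom (sig \<T>))"
    using finite_distinct_list[OF finite_fset] by metis
  from someI_ex[OF this] show "distinct (ops \<T>)" "set (ops \<T>) = fset (fmdom (sig \<T>))"
    unfolding ops_def by auto
qed

lemma length_takeWhile_neq: "x \<in> set xs \<Longrightarrow> length (takeWhile (\<lambda>y. y \<noteq> x) xs) < length xs"
  by (induction xs) auto

lemma op_index:
  assumes "fmlookup (sig \<T>) op = Some AB"
  shows "op_index \<T> op < length (ops \<T>)" "ops \<T> ! op_index \<T> op = op"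
proof -
  have "op \<in> set (ops \<T>)" using fmdomI[OF assms] by (simp add: ops_spec)
  then show "op_index \<T> op < length (ops \<T>)" unfolding op_index_def
    by (rule length_takeWhile_neq)
  then show "ops \<T> ! op_index \<T> op = op" unfolding op_index_def
    using nth_length_takeWhile by blast
qed

definition clauseT :: "('b, 'op) effthy \<Rightarrow> ('b, 'op) effthy \<Rightarrow> ('b, 'op) ty \<Rightarrow> 'op \<Rightarrow> ('b, 'op) ty" where
  "clauseT \<T> \<T>' X op =
    TFun (TProd [ty_of (argty \<T> op), TFun (ty_of (resty \<T> op)) X \<T>']) X \<T>'"

definition handlerT :: "('b, 'op) effthy \<Rightarrow> ('b, 'op) effthy \<Rightarrow> ('b, 'op) ty \<Rightarrow> ('b, 'op) ty" where
  "handlerT \<T> \<T>' X = TProd (map (clauseT \<T> \<T>' X) (ops \<T>))"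

context
  fixes \<T> \<T>' :: "('b, 'op) effthy" and op A B
  assumes op: "fmlookup (sig \<T>) op = Some (A, B)"
begin

lemma hof_lookup:
  "fmlookup (hof \<T> h) op =
     Some (CApp (VProj (op_index \<T> op) (vren (\<lambda>n. Suc (Suc n)) h)) (VTup [VVar (Suc 0), VVar 0]))"
  using op by (simp add: hof_def)

lemma handlerT_nth:
  "map (clauseT \<T> \<T>' X) (ops \<T>) ! op_index \<T> op =
     TFun (TProd [ty_of A, TFun (ty_of B) X \<T>']) X \<T>'"
  using op_index[OF op] gctyp_argty[OF op] by (simp add: clauseT_def)

lemma handlerT_proj:
  "vtyp \<Gamma> h (handlerT \<T> \<T>' X) \<Longrightarrow>
    vtyp \<Gamma> (VProj (op_index \<T> op) h) (TFun (TProd [ty_of A, TFun (ty_of B) X \<T>']) X \<T>')"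
  using vt_proj[of \<Gamma> h "map (clauseT \<T> \<T>' X) (ops \<T>)" "op_index \<T> op"] op_index[OF op]
  by (simp add: handlerT_def handlerT_nth del: nth_map)

lemma handlerT_proj_eq:
  "veq \<Gamma> h h' (handlerT \<T> \<T>' X) \<Longrightarrow>
    veq \<Gamma> (VProj (op_index \<T> op) h) (VProj (op_index \<T> op) h') (TFun (TProd [ty_of A, TFun (ty_of B) X \<T>']) X \<T>')"
  using ve_proj[of \<Gamma> h h' "map (clauseT \<T> \<T>' X) (ops \<T>)" "op_index \<T> op"] op_index[OF op]
  by (simp add: handlerT_def handlerT_nth del: nth_map)

lemma handlerT_proj_tup:
  assumes "list_all2 (vtyp \<Gamma>) Vs (map (clauseT \<T> \<T>' X) (ops \<T>))"
  shows "veq \<Gamma> (VProj (op_index \<T> op) (VTup Vs)) (Vs ! op_index \<T> op)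
    (TFun (TProd [ty_of A, TFun (ty_of B) X \<T>']) X \<T>')"
  using ve_prod_beta[OF assms, of "op_index \<T> op"] op_index[OF op]
  by (simp add: handlerT_def handlerT_nth del: nth_map)

end

lemma rtyp_SucSuc: "rtyp \<Gamma> (\<lambda>n. Suc (Suc n)) (A # B # \<Gamma>)"
  by (simp add: rtyp_def)

text \<open>Equal elements of the handler object give clausewise equal handlers, so
  \<open>hof\<close> is well defined on equality classes.\<close>

lemma hof_heq: "veq \<Gamma> h h' (handlerT \<T> \<T>' X) \<Longrightarrow> heq \<Gamma> (hof \<T> h) (hof \<T> h') \<T> X \<T>'"
  unfolding heq_def
  by (auto simp: hof_lookup) (auto simp: hof_def intro!: ce_app[OF handlerT_proj_eq] veq_ren[OF rtyp_SucSuc] ve_refl tt)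

lemma hof_htyp_inst:
  assumes "htyp [Z] (hof \<T> h) \<T> X \<T>'" "vtyp \<Gamma> V Z"
  shows "htyp \<Gamma> (hof \<T> (inst h V)) \<T> X \<T>'"
  using htyp_subst[of "[Z]" "\<lambda>_. V" \<Gamma>, OF _ assms(1)] assms(2) by (simp add: styp_def inst_def)

lemma hof_htyp_weak:
  assumes "htyp \<Gamma> (hof \<T> h) \<T> X \<T>'"
  shows "htyp (A # \<Gamma>) (hof \<T> (vren Suc h)) \<T> X \<T>'"
  using htyp_ren[OF rtyp_Suc assms] by simp

context
  fixes \<T> \<T>' :: "('b, 'op) effthy" and Z X :: "('b, 'op) ty" and h :: "('b, 'op) val"
  assumes h: "vtyp [Z] h (handlerT \<T> \<T>' X)" and H: "htyp [Z] (hof \<T> h) \<T> X \<T>'"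
begin

lemma hdlV_typed: "vtyp [Z] f (TT \<T> (TT \<T>' X)) \<Longrightarrow> vtyp [Z] (hdlV \<T> \<T>' X h f) (TT \<T>' X)"
  unfolding hdlV_def by (rule tt ct_handle H | assumption)+

lemma hdlV_cong:
  "veq [Z] h h' (handlerT \<T> \<T>' X) \<Longrightarrow> veq [Z] f f' (TT \<T> (TT \<T>' X)) \<Longrightarrow>
    veq [Z] (hdlV \<T> \<T>' X h f) (hdlV \<T> \<T>' X h' f') (TT \<T>' X)"
  unfolding hdlV_def by (rule veq_thunk ceq_handle H hof_heq qq | assumption)+

lemma inst_hdlV: "inst (hdlV \<T> \<T>' X h f) V = hdlV \<T> \<T>' X (inst h V) (inst f V)"
  by simp (simp add: hdlV_def)

lemma hdlV_unit:
  assumes f: "vtyp [Z] f (TT \<T>' X)"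
  shows "veq [Z] (hdlV \<T> \<T>' X h (inst (etaV \<T> (TT \<T>' X)) f)) f (TT \<T>' X)"
proof (simp add: hdlV_def, rule veq_thunk_force[OF f])
  have "ceq [Z] (CHandle (TT \<T>' X) \<T> (force (thunk \<T> (TT \<T>' X) (CRet f))) (hof \<T> h) (force (VVar 0)))
      (CHandle (TT \<T>' X) \<T> (CRet f) (hof \<T> h) (force (VVar 0))) X \<T>'"
    by (rule ceq_handle H hof_heq ve_refl h f tt qq)+
  moreover have "ceq [Z] (CHandle (TT \<T>' X) \<T> (CRet f) (hof \<T> h) (force (VVar 0))) (force f) X \<T>'"
    using ce_handle_ret[OF f H, of "force (VVar 0)"] by (simp add: csubst1_def tt)
  ultimately show "ceq [Z] (CHandle (TT \<T>' X) \<T> (force (thunk \<T> (TT \<T>' X) (CRet f))) (hof \<T> h) (force (VVar 0)))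
      (force f) X \<T>'" by (rule ce_trans)
qed

text \<open>The calculus weakens the handler to \<open>vren Suc h\<close>, whereas the model
  produces \<open>inst h (VVar (Suc 0))\<close>. The two agree because \<open>h\<close> depends on a
  single variable.\<close>

lemma handle_let:
  assumes "ctyp [Z] M A \<T>" "ctyp [A, Z] N (TT \<T>' X) \<T>"
    "ceq [A, Z] (CHandle (TT \<T>' X) \<T> N (hof \<T> (inst h (VVar (Suc 0)))) (force (VVar 0))) K X \<T>'"
  shows "ceq [Z] (CHandle (TT \<T>' X) \<T> (CLet A M N) (hof \<T> h) (force (VVar 0))) (CHandle A \<T> M (hof \<T> h) K) X \<T>'"
proof -
  have r: "veq [A, Z] (vren Suc h) (inst h (VVar (Suc 0))) (handlerT \<T> \<T>' X)"
    using ve_sym[OF veq_ren[OF rtyp_Suc inst_Var0[OF h]]] by simp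
  have "ceq [Z] (CHandle (TT \<T>' X) \<T> (CLet A M N) (hof \<T> h) (force (VVar 0)))
     (CHandle A \<T> M (hof \<T> h) (CHandle (TT \<T>' X) \<T> N (hof \<T> (vren Suc h)) (force (VVar 0)))) X \<T>'"
    using ce_handle_let[OF assms(1,2) H, of "force (VVar 0)"] by (simp add: tt)
  moreover have "ceq [Z] (CHandle A \<T> M (hof \<T> h) (CHandle (TT \<T>' X) \<T> N (hof \<T> (vren Suc h)) (force (VVar 0))))
     (CHandle A \<T> M (hof \<T> h) K) X \<T>'"
    by (rule ceq_handle ce_refl assms(1) H hof_heq ve_refl h
      ce_trans[OF ceq_handle[OF ce_refl[OF assms(2)] hof_htyp_weak[OF H] hof_heq[OF r]] assms(3)] tt)+
  ultimately show ?thesis by (rule ce_trans)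
qed

lemma handle_ret:
  assumes "htyp \<Gamma> K \<T> X \<T>'" "vtyp \<Gamma> V (TT \<T>' X)" "ceq \<Gamma> (force V) P X \<T>'"
  shows "ceq \<Gamma> (CHandle (TT \<T>' X) \<T> (CRet V) K (force (VVar 0))) P X \<T>'"
  using ce_trans[OF ce_handle_ret[OF assms(2,1), of "force (VVar 0)"]] assms(3) by (simp add: csubst1_def tt)

text \<open>Both sides equal handling \<open>force f\<close> with a continuation \<open>?k1\<close>
  that handles the inner computation by the weakened \<open>h\<close>. The left side gets there by
  the handler law for let, the right side by that law followed by the one for return.\<close>

lemma hdlV_mu:
  assumes f: "vtyp [Z] f (TT \<T> (TT \<T> (TT \<T>' X)))"
  defines "Y \<equiv> TT \<T> (TT \<T>' X)"
  shows "veq [Z] (hdlV \<T> \<T>' X h (inst (muV \<T> (TT \<T>' X)) f))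
    (hdlV \<T> \<T>' X h (thunk \<T> (TT \<T>' X) (CLet Y (force f)
      (CRet (inst (hdlV \<T> \<T>' X (inst h (VProj 0 (VVar 0))) (VProj (Suc 0) (VVar 0))) (VTup [VVar (Suc 0), VVar 0]))))))
    (TT \<T>' X)"
  (is "veq _ ?l ?r _")
proof (rule ve_trans[OF _ ve_sym])
  let ?h1 = "inst h (VVar (Suc 0))"
  let ?k1 = "CHandle (TT \<T>' X) \<T> (force (VVar 0)) (hof \<T> ?h1) (force (VVar 0))"
  let ?k = "thunk \<T>' X (CHandle Y \<T> (force f) (hof \<T> h) ?k1)"
  have H1: "htyp [Y, Z] (hof \<T> ?h1) \<T> X \<T>'"
    by (rule hof_htyp_inst[OF H] tt)+
  have k1: "ctyp [Y, Z] ?k1 X \<T>'" unfolding Y_def by (rule ct_handle H1[unfolded Y_def] tt)+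
  have f': "vtyp [Z] f (TT \<T> Y)" using f by (simp add: Y_def)
  have "ceq [Z] (CHandle (TT \<T>' X) \<T> (force (thunk \<T> (TT \<T>' X) (CLet Y (force f) (force (VVar 0))))) (hof \<T> h) (force (VVar 0)))
    (CHandle (TT \<T>' X) \<T> (CLet Y (force f) (force (VVar 0))) (hof \<T> h) (force (VVar 0))) X \<T>'"
    unfolding Y_def by (rule ceq_handle H hof_heq ve_refl h force_thunk f ce_refl tt)+
  moreover have "ceq [Z] (CHandle (TT \<T>' X) \<T> (CLet Y (force f) (force (VVar 0))) (hof \<T> h) (force (VVar 0)))
     (CHandle Y \<T> (force f) (hof \<T> h) ?k1) X \<T>'"
    by (rule handle_let) (use f k1 in \<open>auto intro!: tt ce_refl simp: Y_def\<close>)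
  ultimately show "veq [Z] ?l ?k (TT \<T>' X)"
    by (simp add: hdlV_def Y_def[symmetric]) (blast intro: veq_thunk ce_trans)
  let ?p = "VTup [VVar (Suc 0), VVar 0]"
  let ?M = "CHandle (TT \<T>' X) \<T> (force (VProj (Suc 0) ?p)) (hof \<T> (inst h (VProj 0 ?p))) (force (VVar 0))"
  have p: "vtyp [Y, Z] ?p (TProd [Z, Y])" by (rule tt)+
  have HM: "htyp [Y, Z] (hof \<T> (inst h (VProj 0 ?p))) \<T> X \<T>'"
    by (rule hof_htyp_inst[OF H] tt)+
  have M: "ceq [Y, Z] ?M ?k1 X \<T>'"
    unfolding Y_def
    by (rule ceq_handle HM[unfolded Y_def] hof_heq veq_inst2[OF h] qq tt ceq_force ce_refl)+
  have V: "vtyp [Y, Z] (thunk \<T>' X ?M) (TT \<T>' X)" by (rule tt_thunk ceq_typed(1)[OF M])+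
  have "ceq [Z] (CHandle (TT \<T>' X) \<T> (force (thunk \<T> (TT \<T>' X) (CLet Y (force f) (CRet (thunk \<T>' X ?M))))) (hof \<T> h) (force (VVar 0)))
    (CHandle (TT \<T>' X) \<T> (CLet Y (force f) (CRet (thunk \<T>' X ?M))) (hof \<T> h) (force (VVar 0))) X \<T>'"
    by (rule ceq_handle H hof_heq ve_refl h V f' force_thunk ce_refl tt)+
  moreover have "ceq [Z] (CHandle (TT \<T>' X) \<T> (CLet Y (force f) (CRet (thunk \<T>' X ?M))) (hof \<T> h) (force (VVar 0)))
     (CHandle Y \<T> (force f) (hof \<T> h) ?k1) X \<T>'"
    by (rule handle_let handle_ret f' V tt H1 force_thunk' M)+
  ultimately show "veq [Z] ?r ?k (TT \<T>' X)"
    by (simp add: hdlV_def) (blast intro: veq_thunk ce_trans)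
qed

text \<open>The composite arrow is first normalised to a let that performs the operation and returns
  the suspended call of the continuation. The handler laws for let, return and operations then apply
  in turn.\<close>

lemma hdlV_op:
  assumes op: "fmlookup (sig \<T>) op = Some (A, B)"
    and f: "vtyp [Z] f (TProd [ty_of A, TFun (ty_of B) X \<T>'])"
  defines "K \<equiv> TFun (ty_of B) X \<T>'"
  shows "veq [Z] (hdlV \<T> \<T>' X h
      (inst (tmV \<T> (TProd [K, ty_of B]) (TT \<T>' X) (kevV \<T>' X)) (inst (stV \<T> K (ty_of B))
        (inst (VTup [VProj (Suc 0) (VVar 0), VProj 0 (VVar 0)]) (inst (crossV (opnV \<T> op) (VVar 0)) f)))))
    (inst (kevV \<T>' X) (VTup [VProj (op_index \<T> op) h, f])) (TT \<T>' X)"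
  (is "veq _ (hdlV _ _ _ _ ?F) _ _")
proof -
  let ?o = "COp op (VProj 0 f)" and ?b = "ty_of B"
  let ?a1 = "CApp (VProj (Suc 0) (vren Suc f)) (VVar 0)"
  let ?G = "thunk \<T> (TT \<T>' X) (CLet ?b ?o (CRet (thunk \<T>' X ?a1)))"
  have fK: "vtyp [Z] f (TProd [ty_of A, K])" using f by (simp add: K_def)
  have o: "ctyp [Z] ?o ?b \<T>" by (rule ct_op op tt f)+
  have op': "ty_of (resty \<T> op) = ?b" using gctyp_argty[OF op] by simp
  have oo: "ceq [Z] ?o ?o ?b \<T>" by (rule ce_refl o)+
  have o1: "ctyp [?b, Z] (COp op (VProj 0 (vren Suc f))) ?b \<T>" by (rule ct_op op tt f)+
  have f1: "veq [?b, Z] (vren Suc f) (vren Suc f) (TProd [ty_of A, TFun (ty_of B) X \<T>'])"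
    by (rule ve_refl tt f)+
  have a1: "ctyp [?b, Z] ?a1 X \<T>'" by (rule tt f)+
  have "veq [Z] ?F ?G (TT \<T> (TT \<T>' X))"
    unfolding K_def
    by (simp add: op')
      (rule o o1 tt qqs f oo f1 | simp)+
  then have "veq [Z] (hdlV \<T> \<T>' X h ?F) (hdlV \<T> \<T>' X h ?G) (TT \<T>' X)"
    by (intro hdlV_cong ve_refl h)
  moreover have "veq [Z] (hdlV \<T> \<T>' X h ?G) (inst (kevV \<T>' X) (VTup [VProj (op_index \<T> op) h, f])) (TT \<T>' X)"
  proof (simp add: hdlV_def, rule veq_thunk)
    have V: "vtyp [?b, Z] (thunk \<T>' X ?a1) (TT \<T>' X)" by (rule tt_thunk a1)+
    have H1: "htyp [?b, Z] (hof \<T> (inst h (VVar (Suc 0)))) \<T> X \<T>'"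
      by (rule hof_htyp_inst[OF H] tt)+
    have 1: "ceq [Z] (CHandle (TT \<T>' X) \<T> (force ?G) (hof \<T> h) (force (VVar 0)))
      (CHandle (TT \<T>' X) \<T> (CLet ?b ?o (CRet (thunk \<T>' X ?a1))) (hof \<T> h) (force (VVar 0))) X \<T>'"
      by (rule ceq_handle H hof_heq ve_refl h V o force_thunk ce_refl tt)+
    have 2: "ceq [Z] (CHandle (TT \<T>' X) \<T> (CLet ?b ?o (CRet (thunk \<T>' X ?a1))) (hof \<T> h) (force (VVar 0)))
      (CHandle ?b \<T> ?o (hof \<T> h) ?a1) X \<T>'"
      by (rule handle_let handle_ret V tt H1 o force_thunk a1)+
    have 3: "ceq [Z] (CHandle ?b \<T> ?o (hof \<T> h) ?a1)
      (CApp (VProj (op_index \<T> op) h) (VTup [VProj 0 f, VLam ?b X \<T>' ?a1])) X \<T>'"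
      using ce_handle_op[OF op tt_proj0[OF f] H a1 hof_lookup[OF op]]
      by (simp add: clause_subst_def vsubst_vren comp_def)
    \<comment> \<open>The operation law leaves an eta-expanded continuation. Function eta turns it
      into the second projection of \<open>f\<close>, and surjective pairing reassembles
      \<open>f\<close>.\<close>
    have 4: "ceq [Z] (CApp (VProj (op_index \<T> op) h) (VTup [VProj 0 f, VLam ?b X \<T>' ?a1]))
      (CApp (VProj (op_index \<T> op) h) f) X \<T>'"
    proof (rule ce_app[OF ve_refl[OF handlerT_proj[OF op h]]])
      have "veq [Z] (VLam ?b X \<T>' ?a1) (VProj (Suc 0) f) (TFun ?b X \<T>')"
        using ve_sym[OF ve_fun_eta[OF tt_proj1[OF f]]] by simp
      then show "veq [Z] (VTup [VProj 0 f, VLam ?b X \<T>' ?a1]) f (TProd [ty_of A, TFun ?b X \<T>'])"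
        by (rule ve_trans[OF ve_tup2[OF ve_refl[OF tt_proj0[OF f]]] pair_eta[OF f]])
    qed
    have 5: "ceq [Z] (CApp (VProj 0 (VTup [VProj (op_index \<T> op) h, f]))
        (VProj (Suc 0) (VTup [VProj (op_index \<T> op) h, f])))
      (CApp (VProj (op_index \<T> op) h) f) X \<T>'"
      by (rule ce_app proj0_tup proj1_tup handlerT_proj[OF op h] f)+
    show "ceq [Z] (CHandle (TT \<T>' X) \<T> (force ?G) (hof \<T> h) (force (VVar 0)))
      (CApp (VProj 0 (VTup [VProj (op_index \<T> op) h, f])) (VProj (Suc 0) (VTup [VProj (op_index \<T> op) h, f]))) X \<T>'"
      by (rule ce_trans[OF 1 ce_trans[OF 2 ce_trans[OF 3 ce_trans[OF 4 ce_sym[OF 5]]]]])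
  qed
  ultimately show ?thesis by (rule ve_trans)
qed

end

section \<open>The term model\<close>

text \<open>The carriers \<open>'o\<close> and \<open>'m\<close> are arbitrary types that can hold
  the syntax; the model is transported along the two injections instead of being built on the syntax
  directly.\<close>

locale term_model =
  fixes eo :: "('b, 'op) ty \<Rightarrow> 'o" and em :: "('b, 'op) val \<Rightarrow> 'm"
  assumes inj_eo: "inj eo" and inj_em: "inj em"
begin

definition ot :: "'o \<Rightarrow> ('b, 'op) ty" where "ot = inv eo"

text \<open>An arrow from \<open>A\<close> to \<open>B\<close> is the equality class of some \<open>x : A \<turnstile> V : B\<close>. Wrapping a
  representative in an injection term that lists \<open>A\<close> and \<open>B\<close> records domain and codomain
  within a single value, so that \<open>em\<close> embeds all arrows.\<close>

definition ar :: "('b, 'op) ty \<Rightarrow> ('b, 'op) ty \<Rightarrow> ('b, 'op) val \<Rightarrow> 'm" where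
  "ar A B V = em (VInj [A, B] 0 (SOME W. veq [A] V W B))"

definition dm :: "'m \<Rightarrow> ('b, 'op) ty" where
  "dm m = (case inv em m of VInj As i V \<Rightarrow> As ! 0 | _ \<Rightarrow> undefined)"

definition cd :: "'m \<Rightarrow> ('b, 'op) ty" where
  "cd m = (case inv em m of VInj As i V \<Rightarrow> As ! Suc 0 | _ \<Rightarrow> undefined)"

definition bd :: "'m \<Rightarrow> ('b, 'op) val" where
  "bd m = (case inv em m of VInj As i V \<Rightarrow> V | _ \<Rightarrow> undefined)"

lemma ot_eo [simp]: "ot (eo A) = A" "ot \<circ> eo = id"
  using inj_eo by (auto simp: ot_def)

lemma eo_eq [simp]: "eo A = eo B \<longleftrightarrow> A = B"
  using inj_eo by (simp add: inj_eq)

lemma dm_ar [simp]: "dm (ar A B V) = A" and cd_ar [simp]: "cd (ar A B V) = B"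
  using inj_em by (simp_all add: dm_def cd_def ar_def)

lemma bd_ar: "vtyp [A] V B \<Longrightarrow> veq [A] V (bd (ar A B V)) B"
  using inj_em someI[of "\<lambda>W. veq [A] V W B", OF ve_refl] by (simp add: bd_def ar_def)

text \<open>Provably equal values satisfy the same predicate under \<open>SOME\<close>, hence share
  their representative.\<close>

lemma ar_eqI:
  assumes "veq [A] V W B"
  shows "ar A B V = ar A B W"
proof -
  have "veq [A] V U B = veq [A] W U B" for U
    using assms by (meson ve_sym ve_trans)
  then show ?thesis by (simp add: ar_def)
qed

text \<open>Every operation works on the representatives \<open>bd\<close> and on the endpoints
  stored in an arrow or given by the objects. Independence of the representatives is proved
  separately for each operation, by the \<open>den\<close> rules.\<close>

definition \<MM> :: "('o, 'm, 'b, 'op) eff_structure" where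
  "\<MM> = \<lparr>
    Ob = range eo,
    Arr = {ar A B V | A B V. vtyp [A] V B},
    Dom = \<lambda>m. eo (dm m),
    Cod = \<lambda>m. eo (cd m),
    Ide = \<lambda>X. ar (ot X) (ot X) (VVar 0),
    Cmp = \<lambda>g f. ar (dm f) (cd g) (inst (bd g) (bd f)),
    Prd = \<lambda>Xs. eo (TProd (map ot Xs)),
    Prj = \<lambda>Xs i. ar (TProd (map ot Xs)) (map ot Xs ! i) (VProj i (VVar 0)),
    Tup = \<lambda>Z fs. ar (ot Z) (TProd (map cd fs)) (VTup (map bd fs)),
    Cop = \<lambda>Xs. eo (TSum (map ot Xs)),
    Inc = \<lambda>Xs i. ar (map ot Xs ! i) (TSum (map ot Xs)) (VInj (map ot Xs) i (VVar 0)),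
    Cot = \<lambda>\<T> Z Xs Y fs. ar (TProd [ot Z, TSum (map ot Xs)]) (TT \<T> (ot Y)) (cotV \<T> (ot Y) (map bd fs)),
    TO = \<lambda>\<T> X. eo (TT \<T> (ot X)),
    TM = \<lambda>\<T> f. ar (TT \<T> (dm f)) (TT \<T> (cd f)) (tmV \<T> (dm f) (cd f) (bd f)),
    Eta = \<lambda>\<T> X. ar (ot X) (TT \<T> (ot X)) (etaV \<T> (ot X)),
    Mu = \<lambda>\<T> X. ar (TT \<T> (TT \<T> (ot X))) (TT \<T> (ot X)) (muV \<T> (ot X)),
    St = \<lambda>\<T> X Y. ar (TProd [ot X, TT \<T> (ot Y)]) (TT \<T> (TProd [ot X, ot Y])) (stV \<T> (ot X) (ot Y)),
    KExp = \<lambda>\<T> Y Z. eo (TFun (ot Y) (ot Z) \<T>),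
    KEv = \<lambda>\<T> Y Z. ar (TProd [TFun (ot Y) (ot Z) \<T>, ot Y]) (TT \<T> (ot Z)) (kevV \<T> (ot Z)),
    KCur = \<lambda>\<T> X Y Z f. ar (ot X) (TFun (ot Y) (ot Z) \<T>) (kcurV \<T> (ot Y) (ot Z) (bd f)),
    Bas = \<lambda>b. eo (TBase b),
    Opn = \<lambda>\<T> op. ar (ty_of (argty \<T> op)) (TT \<T> (ty_of (resty \<T> op))) (opnV \<T> op),
    Hdl = \<lambda>\<T> \<T>' X h f. ar (dm f) (TT \<T>' (ot X)) (hdlV \<T> \<T>' (ot X) (bd h) (bd f))\<rparr>"

text \<open>\<open>den m A B V\<close>: the arrow \<open>m : A \<rightarrow> B\<close> is denoted by \<open>V\<close>. The rules below compute a
  denotation by resolution, which also yields its typing.\<close>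

definition den :: "'m \<Rightarrow> ('b, 'op) ty \<Rightarrow> ('b, 'op) ty \<Rightarrow> ('b, 'op) val \<Rightarrow> bool" where
  "den m A B V \<longleftrightarrow> m = ar A B V \<and> vtyp [A] V B"

lemma den_typed: "den m A B V \<Longrightarrow> vtyp [A] V B"
  by (simp add: den_def)

lemma den_bd: "den m A B V \<Longrightarrow> veq [A] (bd m) V B"
  by (auto simp: den_def intro: ve_sym bd_ar)

lemma den_dm: "den m A B V \<Longrightarrow> dm m = A" and den_cd: "den m A B V \<Longrightarrow> cd m = B"
  by (auto simp: den_def)

lemma den_eq: "den m A B V \<Longrightarrow> den n A B W \<Longrightarrow> veq [A] V W B \<Longrightarrow> m = n"
  by (auto simp: den_def intro: ar_eqI)

text \<open>Both denotations are provably equal to the stored representative \<open>bd m\<close>.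
  This is how an equality of arrows becomes an equality of the calculus.\<close>

lemma den_eqD: "den m A B V \<Longrightarrow> den m A B W \<Longrightarrow> veq [A] V W B"
  using den_bd by (meson ve_sym ve_trans)

lemma den_ar: "veq [A] W V B \<Longrightarrow> den (ar A B W) A B V"
  by (auto simp: den_def intro: ar_eqI veq_typed)

lemma den_arI: "vtyp [A] V B \<Longrightarrow> den (ar A B V) A B V"
  by (simp add: den_def)

lemma den_cong: "den m A B V \<Longrightarrow> veq [A] V W B \<Longrightarrow> den m A B W"
  by (auto simp: den_def intro: ar_eqI veq_typed)

lemma hom_iff: "m \<in> hom \<MM> X Y \<longleftrightarrow> (\<exists>A B V. X = eo A \<and> Y = eo B \<and> den m A B V)"
  by (auto simp: hom_def \<MM>_def den_def)

lemma den_hom: "den m A B V \<Longrightarrow> m \<in> hom \<MM> (eo A) (eo B)"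
  by (auto simp: hom_iff)

lemma homE:
  assumes "m \<in> hom \<MM> (eo A) (eo B)"
  obtains V where "den m A B V"
  using assms by (auto simp: hom_iff)

lemma Ob_iff: "X \<in> Ob \<MM> \<longleftrightarrow> (\<exists>A. X = eo A)"
  by (auto simp: \<MM>_def)

lemma obs [simp]:
  "eo A \<in> Ob \<MM>"
  "Prd \<MM> (map eo As) = eo (TProd As)"
  "Prd \<MM> [] = eo UT" "Prd \<MM> [eo A, eo B] = eo (TProd [A, B])"
  "Cop \<MM> (map eo As) = eo (TSum As)"
  "TO \<MM> \<T> (eo A) = eo (TT \<T> A)"
  "KExp \<MM> \<T> (eo A) (eo B) = eo (TFun A B \<T>)"
  "Bas \<MM> b = eo (TBase b)"
  by (simp_all add: \<MM>_def)

lemma den_obs: "den m A B V \<Longrightarrow> Dom \<MM> m = eo A" "den m A B V \<Longrightarrow> Cod \<MM> m = eo B"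
  by (auto simp: \<MM>_def den_dm den_cd)

section \<open>Denotations of the operations of the model\<close>

named_theorems dd

lemma den_Ide [dd]: "den (Ide \<MM> (eo A)) A A (VVar 0)"
  by (auto simp: \<MM>_def intro!: den_arI tt)

lemma den_Cmp [dd]: "den g B C W \<Longrightarrow> den f A B V \<Longrightarrow> den (Cmp \<MM> g f) A C (inst W V)"
  by (auto simp: \<MM>_def den_dm den_cd intro!: den_ar veq_inst den_bd)

lemma den_Prj: "i < length As \<Longrightarrow> den (Prj \<MM> (map eo As) i) (TProd As) (As ! i) (VProj i (VVar 0))"
  by (auto simp: \<MM>_def intro!: den_arI vt_proj tt)

lemma den_Prj0 [dd]: "den (Prj \<MM> [eo A, eo B] 0) (TProd [A, B]) A (VProj 0 (VVar 0))"
  using den_Prj[of 0 "[A, B]"] by simp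

lemma den_Prj1 [dd]: "den (Prj \<MM> [eo A, eo B] 1) (TProd [A, B]) B (VProj (Suc 0) (VVar 0))"
  "den (Prj \<MM> [eo A, eo B] (Suc 0)) (TProd [A, B]) B (VProj (Suc 0) (VVar 0))"
  using den_Prj[of 1 "[A, B]"] by simp_all

lemma den_Tup:
  assumes "length fs = length As" "length Vs = length As"
    "\<And>i. i < length As \<Longrightarrow> den (fs ! i) Z (As ! i) (Vs ! i)"
  shows "den (Tup \<MM> (eo Z) fs) Z (TProd As) (VTup Vs)"
proof -
  have "map cd fs = As" using assms by (auto intro!: nth_equalityI den_cd)
  moreover have "veq [Z] (VTup (map bd fs)) (VTup Vs) (TProd As)"
    using assms den_bd by (auto intro!: ve_tup)
  ultimately show ?thesis by (auto simp: \<MM>_def intro!: den_ar)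
qed

lemma den_pair [dd]: "den f A B V \<Longrightarrow> den g A C W \<Longrightarrow> den (pair \<MM> f g) A (TProd [B, C]) (VTup [V, W])"
  unfolding pair_def den_obs by (rule den_Tup) (auto simp: nth_Cons less_Suc_eq split: nat.split)

lemma den_cross [dd]:
  assumes "den f A A' V" "den g B B' W"
  shows "den (cross \<MM> f g) (TProd [A, B]) (TProd [A', B']) (crossV V W)"
  unfolding cross_def crossV_def den_obs(1)[OF assms(1)] den_obs(1)[OF assms(2)]
  by (rule dd assms)+

lemma den_swap [dd]: "den (swap \<MM> (eo A) (eo B)) (TProd [A, B]) (TProd [B, A]) (VTup [VProj (Suc 0) (VVar 0), VProj 0 (VVar 0)])"
  unfolding swap_def by (rule dd)+

lemma den_assoc_r [dd]:
  "den (assoc_r \<MM> (eo A) (eo B) (eo C)) (TProd [TProd [A, B], C]) (TProd [A, TProd [B, C]]) assocV"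
proof -
  have "den (assoc_r \<MM> (eo A) (eo B) (eo C)) (TProd [TProd [A, B], C]) (TProd [A, TProd [B, C]])
      (VTup [inst (VProj 0 (VVar 0)) (VProj 0 (VVar 0)),
        VTup [inst (VProj (Suc 0) (VVar 0)) (VProj 0 (VVar 0)), VProj (Suc 0) (VVar 0)]])"
    unfolding assoc_r_def obs by (rule dd)+
  then show ?thesis by (simp add: assocV_def)
qed

lemma den_TM [dd]: "den f A B V \<Longrightarrow> den (TM \<MM> \<T> f) (TT \<T> A) (TT \<T> B) (tmV \<T> A B V)"
  by (auto simp: \<MM>_def den_dm den_cd intro!: den_ar tmV_cong den_bd)

lemma den_Eta [dd]: "den (Eta \<MM> \<T> (eo A)) A (TT \<T> A) (etaV \<T> A)"
  by (auto simp: \<MM>_def intro!: den_arI etaV_typed)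

lemma den_Mu [dd]: "den (Mu \<MM> \<T> (eo A)) (TT \<T> (TT \<T> A)) (TT \<T> A) (muV \<T> A)"
  by (auto simp: \<MM>_def intro!: den_arI muV_typed)

lemma den_St [dd]: "den (St \<MM> \<T> (eo A) (eo B)) (TProd [A, TT \<T> B]) (TT \<T> (TProd [A, B])) (stV \<T> A B)"
  by (auto simp: \<MM>_def intro!: den_arI stV_typed)

lemma den_KEv [dd]: "den (KEv \<MM> \<T> (eo A) (eo B)) (TProd [TFun A B \<T>, A]) (TT \<T> B) (kevV \<T> B)"
  by (auto simp: \<MM>_def intro!: den_arI kevV_typed)

lemma den_KCur [dd]:
  "den f (TProd [X, A]) (TT \<T> B) V \<Longrightarrow> den (KCur \<MM> \<T> (eo X) (eo A) (eo B) f) X (TFun A B \<T>) (kcurV \<T> A B V)"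
  by (auto simp: \<MM>_def intro!: den_ar kcurV_cong den_bd)

lemma den_Opn:
  "fmlookup (sig \<T>) op = Some (A, B) \<Longrightarrow> den (Opn \<MM> \<T> op) (ty_of A) (TT \<T> (ty_of B)) (opnV \<T> op)"
  by (auto simp: \<MM>_def gctyp_argty intro!: den_arI opnV_typed)

lemma den_Inc: "i < length As \<Longrightarrow> den (Inc \<MM> (map eo As) i) (As ! i) (TSum As) (VInj As i (VVar 0))"
  by (auto simp: \<MM>_def intro!: den_arI vt_inj tt)

lemma den_Cot:
  assumes "list_all2 (\<lambda>f A. vtyp [TProd [Z, A]] f (TT \<T> Y)) Vs As" "length fs = length As"
    "\<And>i. i < length As \<Longrightarrow> den (fs ! i) (TProd [Z, As ! i]) (TT \<T> Y) (Vs ! i)"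
  shows "den (Cot \<MM> \<T> (eo Z) (map eo As) (eo Y) fs) (TProd [Z, TSum As]) (TT \<T> Y) (cotV \<T> Y Vs)"
proof -
  have "length Vs = length As" using assms(1) by (rule list_all2_lengthD)
  with assms have "veq [TProd [Z, TSum As]] (cotV \<T> Y Vs) (cotV \<T> Y (map bd fs)) (TT \<T> Y)"
    by (intro cotV_cong) (auto intro!: ve_sym[OF den_bd])
  then show ?thesis by (auto simp: \<MM>_def intro!: den_ar ve_sym)
qed

text \<open>The typing of \<open>hof V\<close> is what allows the congruence rule for handling, and
  hence the passage to the representatives of \<open>h\<close> and \<open>f\<close>. For semantic
  handlers it is established in \<open>handlers_htyp\<close>.\<close>

lemma den_Hdl:
  assumes "den h Z (handlerT \<T> \<T>' X) V" "htyp [Z] (hof \<T> V) \<T> X \<T>'" "den f Z (TT \<T> (TT \<T>' X)) W"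
  shows "den (Hdl \<MM> \<T> \<T>' (eo X) h f) Z (TT \<T>' X) (hdlV \<T> \<T>' X V W)"
proof -
  have "veq [Z] (hdlV \<T> \<T>' X V W) (hdlV \<T> \<T>' X (bd h) (bd f)) (TT \<T>' X)"
    using assms by (intro hdlV_cong den_typed ve_sym[OF den_bd])
  then show ?thesis using assms by (auto simp: \<MM>_def den_dm intro!: den_ar ve_sym)
qed

section \<open>Verification of the categorical axioms\<close>

lemma map_eo: "set Xs \<subseteq> Ob \<MM> \<Longrightarrow> Xs = map eo (map ot Xs)"
  by (induction Xs) (auto simp: Ob_iff)

lemma is_category: "is_category \<MM>"
  unfolding is_category_def
proof (intro conjI ballI allI)
  fix f assume "f \<in> Arr \<MM>"
  then show "Dom \<MM> f \<in> Ob \<MM>" "Cod \<MM> f \<in> Ob \<MM>" by (auto simp: \<MM>_def)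
next
  fix X assume "X \<in> Ob \<MM>"
  then show "Ide \<MM> X \<in> hom \<MM> X X" by (auto simp: Ob_iff intro: den_hom den_Ide)
next
  fix X Y Z f g assume "f \<in> hom \<MM> X Y" "g \<in> hom \<MM> Y Z"
  then show "Cmp \<MM> g f \<in> hom \<MM> X Z" by (auto simp: hom_iff) (blast intro: den_Cmp)
next
  fix X Y f assume "f \<in> hom \<MM> X Y"
  then obtain A B V where *: "X = eo A" "Y = eo B" and f: "den f A B V" by (auto simp: hom_iff)
  note V = den_typed[OF f]
  show "Cmp \<MM> f (Ide \<MM> X) = f" unfolding *
    by (rule den_eq, (rule dd f)+) (rule inst_Var0 V)+
  show "Cmp \<MM> (Ide \<MM> Y) f = f" unfolding *
    by (rule den_eq, (rule dd f)+) (simp add: ve_refl V)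
next
  fix W X Y Z f g h assume "f \<in> hom \<MM> W X" "g \<in> hom \<MM> X Y" "h \<in> hom \<MM> Y Z"
  then obtain A B C D F G H where d: "den f A B F" "den g B C G" "den h C D H"
    by (auto simp: hom_iff)
  show "Cmp \<MM> (Cmp \<MM> h g) f = Cmp \<MM> h (Cmp \<MM> g f)"
    by (rule den_eq, (rule dd d)+) (simp add: ve_refl den_typed[OF den_Cmp[OF d(3) den_Cmp[OF d(2,1)]]])
qed

lemma has_products: "has_products \<MM>"
  unfolding has_products_def
proof (intro allI impI conjI ballI)
  fix Xs assume "set Xs \<subseteq> Ob \<MM>"
  define As where "As = map ot Xs"
  have Xs: "Xs = map eo As" using map_eo[OF \<open>set Xs \<subseteq> Ob \<MM>\<close>] by (simp add: As_def)
  show "Prd \<MM> Xs \<in> Ob \<MM>" by (simp add: Xs)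
  show "Prj \<MM> Xs i \<in> hom \<MM> (Prd \<MM> Xs) (Xs ! i)" if "i < length Xs" for i
    using den_hom[OF den_Prj[of i As]] that by (simp add: Xs)
  fix X fs assume X: "X \<in> Ob \<MM>" and fs: "list_all2 (\<lambda>f Y. f \<in> hom \<MM> X Y) fs Xs"
  obtain Z where Z: "X = eo Z" using X by (auto simp: Ob_iff)
  have len: "length fs = length As" using fs by (simp add: Xs list_all2_lengthD)
  have "\<exists>V. den (fs ! i) Z (As ! i) V" if "i < length As" for i
    using fs that by (auto simp: Xs Z list_all2_conv_all_nth hom_iff)
  then obtain V where V: "\<And>i. i < length As \<Longrightarrow> den (fs ! i) Z (As ! i) (V i)" by metis
  define Vs where "Vs = map V [0..<length As]"
  have T: "den (Tup \<MM> X fs) Z (TProd As) (VTup Vs)"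
    unfolding Z by (rule den_Tup) (auto simp: len Vs_def V)
  have Vs: "list_all2 (vtyp [Z]) Vs As"
    using den_typed[OF V] by (auto simp: Vs_def list_all2_conv_all_nth)
  show "Tup \<MM> X fs \<in> hom \<MM> X (Prd \<MM> Xs)" using den_hom[OF T] by (simp add: Xs Z)
  show "Cmp \<MM> (Prj \<MM> Xs i) (Tup \<MM> X fs) = fs ! i" if "i < length Xs" for i
  proof -
    have i: "i < length As" using that by (simp add: Xs)
    show ?thesis unfolding Xs
      by (rule den_eq, rule den_Cmp, rule den_Prj[OF i], rule T, rule V[OF i])
        (use ve_prod_beta[OF Vs i] i in \<open>simp add: Vs_def comp_def\<close>)
  qed
  fix g assume "g \<in> hom \<MM> X (Prd \<MM> Xs)" and g: "\<forall>i<length Xs. Cmp \<MM> (Prj \<MM> Xs i) g = fs ! i"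
  then obtain W where W: "den g Z (TProd As) W" by (auto simp: Xs Z hom_iff)
  note W' = den_typed[OF W]
  have "veq [Z] (VProj i W) (V i) (As ! i)" if i: "i < length As" for i
    using den_eqD[OF den_Cmp[OF den_Prj[OF i] W]] V[OF i] g i by (simp add: Xs)
  \<comment> \<open>By product eta \<open>W\<close> is the tuple of its projections, and these are
    provably equal to the components of \<open>Vs\<close>.\<close>
  then have "veq [Z] (VTup (map (\<lambda>i. VProj i W) [0..<length As])) (VTup Vs) (TProd As)"
    by (intro ve_tup) (auto simp: Vs_def)
  from den_eq[OF W T ve_trans[OF ve_prod_eta[OF W'] this]] show "g = Tup \<MM> X fs" .
qed

lemma has_kleisli_exponentials: "has_kleisli_exponentials \<MM> \<T>"
  unfolding has_kleisli_exponentials_def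
proof (intro ballI conjI)
  fix Y Z assume "Y \<in> Ob \<MM>" "Z \<in> Ob \<MM>"
  then obtain A B where YZ: "Y = eo A" "Z = eo B" by (auto simp: Ob_iff)
  show "KExp \<MM> \<T> Y Z \<in> Ob \<MM>" by (simp add: YZ)
  show "KEv \<MM> \<T> Y Z \<in> hom \<MM> (Prd \<MM> [KExp \<MM> \<T> Y Z, Y]) (TO \<MM> \<T> Z)"
    using den_hom[OF den_KEv] by (simp add: YZ)
  fix X f assume "X \<in> Ob \<MM>" "f \<in> hom \<MM> (Prd \<MM> [X, Y]) (TO \<MM> \<T> Z)"
  then obtain C V where X: "X = eo C" and f: "den f (TProd [C, A]) (TT \<T> B) V"
    by (auto simp: Ob_iff YZ hom_iff)
  note V = den_typed[OF f]
  show "KCur \<MM> \<T> X Y Z f \<in> hom \<MM> X (KExp \<MM> \<T> Y Z)"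
    using den_hom[OF den_KCur[OF f]] by (simp add: YZ X)
  show "Cmp \<MM> (KEv \<MM> \<T> Y Z) (cross \<MM> (KCur \<MM> \<T> X Y Z f) (Ide \<MM> Y)) = f"
    unfolding YZ X by (rule den_eq, (rule dd f)+, rule kevV_beta[OF V])
  fix g assume "g \<in> hom \<MM> X (KExp \<MM> \<T> Y Z)"
  then obtain W where g: "den g C (TFun A B \<T>) W" by (auto simp: X YZ hom_iff)
  show "Cmp \<MM> (KEv \<MM> \<T> Y Z) (cross \<MM> g (Ide \<MM> Y)) = f \<longrightarrow> g = KCur \<MM> \<T> X Y Z f"
  proof
    assume eq: "Cmp \<MM> (KEv \<MM> \<T> Y Z) (cross \<MM> g (Ide \<MM> Y)) = f"
    \<comment> \<open>The hypothesis on \<open>g\<close> gives \<open>f\<close> a second denotation;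
      its transpose is \<open>W\<close> by \<open>kcurV_unique\<close>.\<close>
    have "den f (TProd [C, A]) (TT \<T> B) (inst (kevV \<T> B) (crossV W (VVar 0)))"
      unfolding eq[symmetric] YZ by (rule dd g)+
    from den_KCur[OF this]
    show "g = KCur \<MM> \<T> X Y Z f"
      unfolding YZ X by (rule den_eq[OF g]) (rule ve_sym[OF kcurV_unique] den_typed g)+
  qed
qed

lemma has_kleisli_coproducts: "has_kleisli_coproducts \<MM>"
  unfolding has_kleisli_coproducts_def
proof (intro allI impI conjI ballI)
  fix Xs assume "set Xs \<subseteq> Ob \<MM>"
  define As where "As = map ot Xs"
  have Xs: "Xs = map eo As" using map_eo[OF \<open>set Xs \<subseteq> Ob \<MM>\<close>] by (simp add: As_def)
  show "Cop \<MM> Xs \<in> Ob \<MM>" by (simp add: Xs)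
  show "Inc \<MM> Xs i \<in> hom \<MM> (Xs ! i) (Cop \<MM> Xs)" if "i < length Xs" for i
    using den_hom[OF den_Inc[of i As]] that by (simp add: Xs)
  fix \<T> Z0 Y0 fs assume ob: "Z0 \<in> Ob \<MM>" "Y0 \<in> Ob \<MM>"
    and fs: "list_all2 (\<lambda>f X. f \<in> hom \<MM> (Prd \<MM> [Z0, X]) (TO \<MM> \<T> Y0)) fs Xs"
  obtain Z Y where Z: "Z0 = eo Z" and Y: "Y0 = eo Y" using ob by (auto simp: Ob_iff)
  have len: "length fs = length As" using fs by (simp add: Xs list_all2_lengthD)
  have "\<exists>V. den (fs ! i) (TProd [Z, As ! i]) (TT \<T> Y) V" if "i < length As" for i
    using fs that by (auto simp: Xs Z Y list_all2_conv_all_nth hom_iff)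
  then obtain V where V: "\<And>i. i < length As \<Longrightarrow> den (fs ! i) (TProd [Z, As ! i]) (TT \<T> Y) (V i)" by metis
  define Vs where "Vs = map V [0..<length As]"
  have Vs: "list_all2 (\<lambda>f A. vtyp [TProd [Z, A]] f (TT \<T> Y)) Vs As"
    using den_typed[OF V] by (auto simp: Vs_def list_all2_conv_all_nth)
  have C: "den (Cot \<MM> \<T> Z0 Xs Y0 fs) (TProd [Z, TSum As]) (TT \<T> Y) (cotV \<T> Y Vs)"
    unfolding Z Xs Y by (rule den_Cot[OF Vs]) (auto simp: len Vs_def V)
  show "Cot \<MM> \<T> Z0 Xs Y0 fs \<in> hom \<MM> (Prd \<MM> [Z0, Cop \<MM> Xs]) (TO \<MM> \<T> Y0)"
    using den_hom[OF C] by (simp add: Xs Z Y)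
  show "Cmp \<MM> (Cot \<MM> \<T> Z0 Xs Y0 fs) (cross \<MM> (Ide \<MM> Z0) (Inc \<MM> Xs i)) = fs ! i" if "i < length Xs" for i
  proof -
    have i: "i < length As" using that by (simp add: Xs)
    have "den (cross \<MM> (Ide \<MM> Z0) (Inc \<MM> Xs i)) (TProd [Z, As ! i]) (TProd [Z, TSum As]) (crossV (VVar 0) (VInj As i (VVar 0)))"
      unfolding Xs Z by (rule dd den_Inc[OF i])+
    from den_Cmp[OF C this] show ?thesis
      by (rule den_eq[OF _ V[OF i]]) (use cotV_beta[OF Vs i] i in \<open>simp add: Vs_def\<close>)
  qed
  fix g assume "g \<in> hom \<MM> (Prd \<MM> [Z0, Cop \<MM> Xs]) (TO \<MM> \<T> Y0)"
    and g: "\<forall>i<length Xs. Cmp \<MM> g (cross \<MM> (Ide \<MM> Z0) (Inc \<MM> Xs i)) = fs ! i"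
  then obtain W where W: "den g (TProd [Z, TSum As]) (TT \<T> Y) W" by (auto simp: Xs Z Y hom_iff)
  note W' = den_typed[OF W]
  \<comment> \<open>Each \<open>fs ! i\<close> acquires a second denotation, through
    \<open>g\<close>. Comparing it with \<open>V i\<close> branchwise makes
    \<open>cotV_unique\<close> applicable.\<close>
  have gi: "den (fs ! i) (TProd [Z, As ! i]) (TT \<T> Y) (inst W (crossV (VVar 0) (VInj As i (VVar 0))))"
    if i: "i < length As" for i
  proof -
    have "fs ! i = Cmp \<MM> g (cross \<MM> (Ide \<MM> Z0) (Inc \<MM> Xs i))" using g i by (simp add: Xs)
    then show ?thesis unfolding Xs Z by simp (rule W dd den_Inc[OF i])+
  qed
  have "veq [TProd [Z, TSum As]] (cotV \<T> Y Vs) W (TT \<T> Y)"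
    by (rule ve_trans[OF cotV_cong[OF Vs] cotV_unique[OF W']])
      (auto simp: Vs_def den_eqD[OF V gi])
  from den_eq[OF W C ve_sym[OF this]] show "g = Cot \<MM> \<T> Z0 Xs Y0 fs" .
qed

lemma is_strong_monad: "is_strong_monad \<MM> \<T>"
  unfolding is_strong_monad_def
proof (intro conjI ballI allI)
  fix X assume "X \<in> Ob \<MM>"
  then obtain A where X: "X = eo A" by (auto simp: Ob_iff)
  show "TO \<MM> \<T> X \<in> Ob \<MM>" by (simp add: X)
  show "TM \<MM> \<T> (Ide \<MM> X) = Ide \<MM> (TO \<MM> \<T> X)" unfolding X obs
    by (rule den_eq, (rule dd)+, rule tmV_id)
  show "Eta \<MM> \<T> X \<in> hom \<MM> X (TO \<MM> \<T> X)" unfolding X obs by (rule den_hom dd)+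
  show "Mu \<MM> \<T> X \<in> hom \<MM> (TO \<MM> \<T> (TO \<MM> \<T> X)) (TO \<MM> \<T> X)" unfolding X obs by (rule den_hom dd)+
  show "Cmp \<MM> (Mu \<MM> \<T> X) (Eta \<MM> \<T> (TO \<MM> \<T> X)) = Ide \<MM> (TO \<MM> \<T> X)" unfolding X obs
    by (rule den_eq, (rule dd)+, rule muV_etaT)
  show "Cmp \<MM> (Mu \<MM> \<T> X) (TM \<MM> \<T> (Eta \<MM> \<T> X)) = Ide \<MM> (TO \<MM> \<T> X)" unfolding X obs
    by (rule den_eq, (rule dd)+, rule muV_Teta)
  show "Cmp \<MM> (Mu \<MM> \<T> X) (Mu \<MM> \<T> (TO \<MM> \<T> X)) = Cmp \<MM> (Mu \<MM> \<T> X) (TM \<MM> \<T> (Mu \<MM> \<T> X))" unfolding X obs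
    by (rule den_eq, (rule dd)+, rule muV_muV)
  show "Cmp \<MM> (TM \<MM> \<T> (Prj \<MM> [Prd \<MM> [], X] 1)) (St \<MM> \<T> (Prd \<MM> []) X) = Prj \<MM> [Prd \<MM> [], TO \<MM> \<T> X] 1"
    unfolding X obs by (rule den_eq, (rule dd)+, rule stV_unit)
next
  fix X Y f assume "f \<in> hom \<MM> X Y"
  then obtain A B F where X: "X = eo A" "Y = eo B" and f: "den f A B F" by (auto simp: hom_iff)
  show "TM \<MM> \<T> f \<in> hom \<MM> (TO \<MM> \<T> X) (TO \<MM> \<T> Y)" unfolding X obs by (rule den_hom dd f)+
  show "Cmp \<MM> (Eta \<MM> \<T> Y) f = Cmp \<MM> (TM \<MM> \<T> f) (Eta \<MM> \<T> X)" unfolding X obs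
    by (rule den_eq, (rule dd f)+, rule ve_sym[OF etaV_nat[OF den_typed[OF f]]])
  show "Cmp \<MM> (Mu \<MM> \<T> Y) (TM \<MM> \<T> (TM \<MM> \<T> f)) = Cmp \<MM> (TM \<MM> \<T> f) (Mu \<MM> \<T> X)" unfolding X obs
    by (rule den_eq, (rule dd f)+, rule muV_nat[OF den_typed[OF f]])
  fix Z g assume "g \<in> hom \<MM> Y Z"
  then obtain C G where Z: "Z = eo C" and g: "den g B C G" by (auto simp: hom_iff X)
  show "TM \<MM> \<T> (Cmp \<MM> g f) = Cmp \<MM> (TM \<MM> \<T> g) (TM \<MM> \<T> f)"
    by (rule den_eq, (rule dd f g)+, rule ve_sym[OF tmV_comp[OF den_typed[OF f] den_typed[OF g]]])
next
  fix X Y assume "X \<in> Ob \<MM>" "Y \<in> Ob \<MM>"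
  then obtain A B where X: "X = eo A" "Y = eo B" by (auto simp: Ob_iff)
  show "St \<MM> \<T> X Y \<in> hom \<MM> (Prd \<MM> [X, TO \<MM> \<T> Y]) (TO \<MM> \<T> (Prd \<MM> [X, Y]))"
    unfolding X obs by (rule den_hom dd)+
  show "Cmp \<MM> (St \<MM> \<T> X Y) (cross \<MM> (Ide \<MM> X) (Eta \<MM> \<T> Y)) = Eta \<MM> \<T> (Prd \<MM> [X, Y])"
    unfolding X obs by (rule den_eq, (rule dd)+, rule stV_eta)
  show "Cmp \<MM> (St \<MM> \<T> X Y) (cross \<MM> (Ide \<MM> X) (Mu \<MM> \<T> Y)) =
     Cmp \<MM> (Mu \<MM> \<T> (Prd \<MM> [X, Y])) (Cmp \<MM> (TM \<MM> \<T> (St \<MM> \<T> X Y)) (St \<MM> \<T> X (TO \<MM> \<T> Y)))"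
    unfolding X obs by (rule den_eq, (rule dd)+, rule stV_mu)
  fix Z assume "Z \<in> Ob \<MM>"
  then obtain C where Z: "Z = eo C" by (auto simp: Ob_iff)
  show "Cmp \<MM> (TM \<MM> \<T> (assoc_r \<MM> X Y Z)) (St \<MM> \<T> (Prd \<MM> [X, Y]) Z) =
     Cmp \<MM> (St \<MM> \<T> X (Prd \<MM> [Y, Z]))
       (Cmp \<MM> (cross \<MM> (Ide \<MM> X) (St \<MM> \<T> Y Z)) (assoc_r \<MM> X Y (TO \<MM> \<T> Z)))"
    unfolding X Z obs by (rule den_eq, (rule dd)+, rule stV_assoc)
next
  fix X X' Y Y' f g assume "f \<in> hom \<MM> X X'" "g \<in> hom \<MM> Y Y'"
  then obtain A A' B B' F G where X: "X = eo A" "X' = eo A'" "Y = eo B" "Y' = eo B'"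
    and f: "den f A A' F" and g: "den g B B' G" by (auto simp: hom_iff)
  show "Cmp \<MM> (St \<MM> \<T> X' Y') (cross \<MM> f (TM \<MM> \<T> g)) = Cmp \<MM> (TM \<MM> \<T> (cross \<MM> f g)) (St \<MM> \<T> X Y)"
    unfolding X obs
    by (rule den_eq, (rule dd f g)+, rule stV_nat[OF den_typed[OF f] den_typed[OF g]])
qed

end

section \<open>Environments as tuples\<close>

text \<open>The type behind \<open>ctxI\<close> in this model. The base is \<open>UT\<close> for
  contexts of the calculus; when axioms act on handlers it is the product of the domain of the
  handler and the continuation type.\<close>

primrec ctxT :: "('b, 'op) ty \<Rightarrow> ('b, 'op) ty list \<Rightarrow> ('b, 'op) ty" where
  "ctxT Z [] = Z"
| "ctxT Z (A # \<Gamma>) = TProd [ctxT Z \<Gamma>, A]"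

text \<open>\<open>ebs m V\<close> reads off \<open>m\<close> variables from the nested tuple \<open>V : ctxT Z \<Gamma>\<close>, and the base
  component, of type \<open>Z\<close>, at index \<open>m\<close>.\<close>

primrec ebs :: "nat \<Rightarrow> ('b, 'op) val \<Rightarrow> nat \<Rightarrow> ('b, 'op) val" where
  "ebs 0 V = (\<lambda>_. V)"
| "ebs (Suc m) V = (\<lambda>n. case n of 0 \<Rightarrow> VProj (Suc 0) V | Suc n \<Rightarrow> ebs m (VProj 0 V) n)"

lemma vsubst_ebs [simp]: "vsubst \<sigma> (ebs m V n) = ebs m (vsubst \<sigma> V) n"
  by (induction m arbitrary: V n) (auto split: nat.split)

lemma vren_ebs [simp]: "vren \<xi> (ebs m V n) = ebs m (vren \<xi> V) n"
  by (induction m arbitrary: V n) (auto split: nat.split)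

lemma inst_ebs [simp]: "inst (ebs m W n) V = ebs m (inst W V) n"
  by (simp add: inst_def)

lemma inst_vsubst_ebs [simp]: "inst (vsubst (ebs m W) U) V = vsubst (ebs m (inst W V)) U"
  by (simp add: inst_def vsubst_vsubst comp_def)

lemma csubst_csubst_ebs [simp]: "csubst \<sigma> (csubst (ebs m V) M) = csubst (ebs m (vsubst \<sigma> V)) M"
  by (simp add: csubst_csubst comp_def)

lemma seq_ebs: "veq \<Gamma>' V W (ctxT Z \<Gamma>) \<Longrightarrow> seq (\<Gamma> @ [Z]) (ebs (length \<Gamma>) V) (ebs (length \<Gamma>) W) \<Gamma>'"
proof (induction \<Gamma> arbitrary: V W)
  case (Cons A \<Gamma>)
  have "veq \<Gamma>' (VProj 0 V) (VProj 0 W) (ctxT Z \<Gamma>)" "veq \<Gamma>' (VProj (Suc 0) V) (VProj (Suc 0) W) A"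
    using Cons.prems by (auto intro: ve_proj0 ve_proj1)
  with Cons.IH show ?case
    by (auto simp: seq_def nth_Cons split: nat.split)
qed (simp add: seq_def)

lemma styp_ebs: "vtyp \<Gamma>' V (ctxT Z \<Gamma>) \<Longrightarrow> styp (\<Gamma> @ [Z]) (ebs (length \<Gamma>) V) \<Gamma>'"
  by (rule seq_styp(1)[OF seq_ebs]) (rule ve_refl)

lemma seq_trans: "seq \<Gamma> \<sigma> \<tau> \<Gamma>' \<Longrightarrow> seq \<Gamma> \<tau> \<rho> \<Gamma>' \<Longrightarrow> seq \<Gamma> \<sigma> \<rho> \<Gamma>'"
  unfolding seq_def by (meson ve_trans)

text \<open>Reading variables off a pair amounts to extending the substitution read off its first
  component by the second, which is how pairing of environments matches
  \<open>scons\<close>.\<close>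

lemma ebs_tup:
  assumes "veq \<Gamma>' U (VTup [V, W]) (ctxT Z (A # \<Gamma>))" "vtyp \<Gamma>' V (ctxT Z \<Gamma>)" "vtyp \<Gamma>' W A"
  shows "seq (A # \<Gamma> @ [Z]) (ebs (Suc (length \<Gamma>)) U) (scons W (ebs (length \<Gamma>) V)) \<Gamma>'"
proof -
  have "veq \<Gamma>' (VProj 0 U) V (ctxT Z \<Gamma>)" "veq \<Gamma>' (VProj (Suc 0) U) W A"
    using ve_trans[OF ve_proj0 proj0_tup[OF assms(2,3)]] ve_trans[OF ve_proj1 proj1_tup[OF assms(2,3)]]
      assms(1) by auto
  then show ?thesis using seq_ebs[of \<Gamma>' "VProj 0 U" V Z \<Gamma>]
    by (auto simp: seq_def nth_Cons scons_def split: nat.split)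
qed

lemma rtyp_append: "rtyp \<Gamma> (\<lambda>n. n) (\<Gamma> @ \<Delta>)"
  by (simp add: rtyp_def nth_append)

lemma ctyp_append: "ctyp \<Gamma> M A \<T> \<Longrightarrow> ctyp (\<Gamma> @ \<Delta>) M A \<T>"
  using ctyp_ren[OF rtyp_append] by fastforce

lemma hren_id: "hren (\<lambda>n. n) H = H"
  using hsubst_var[of "\<lambda>n. n" H] by simp

lemma htyp_append: "htyp \<Gamma> H \<T> X \<T>' \<Longrightarrow> htyp (\<Gamma> @ \<Delta>) H \<T> X \<T>'"
  using htyp_ren[OF rtyp_append, of \<Gamma> H \<T> X \<T>' \<Delta>] by (simp add: hren_id)

lemma up_ebs: "up (ebs m V) = scons (VVar 0) (ebs m (vren Suc V))"
  by (rule ext) (simp add: up_def scons_def split: nat.split)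

text \<open>The bridge for binders: semantically a bound variable is paired with the environment,
  syntactically the environment substitution is lifted. Used for let, lambda and case.\<close>

lemma body_eq:
  assumes M: "ctyp (A # \<Gamma> @ [Z]) M B \<T>" and V: "vtyp \<Gamma>' V (ctxT Z \<Gamma>)"
    and U: "veq (A # \<Gamma>') U (VTup [vren Suc V, VVar 0]) (ctxT Z (A # \<Gamma>))"
  shows "ceq (A # \<Gamma>') (force (inst (thunk \<T> B (csubst (ebs (Suc (length \<Gamma>)) (VVar 0)) M)) U))
    (csubst (up (ebs (length \<Gamma>) V)) M) B \<T>"
proof -
  have s: "seq (A # \<Gamma> @ [Z]) (ebs (Suc (length \<Gamma>)) U) (up (ebs (length \<Gamma>) V)) (A # \<Gamma>')"
    unfolding up_ebs by (rule ebs_tup[OF U]) (rule tt V)+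
  show ?thesis
    using force_thunk'[OF csubst_cong[OF M s]] by (simp del: ebs.simps)
qed

text \<open>The tuple of the variables \<open>j\<close>, ..., \<open>j + m - 1\<close> over a base
  value \<open>U\<close>, nested as in \<open>ctxT\<close>; up to provable equality a section of
  \<open>ebs\<close>.\<close>

primrec vtup :: "nat \<Rightarrow> nat \<Rightarrow> ('b, 'op) val \<Rightarrow> ('b, 'op) val" where
  "vtup 0 j U = U"
| "vtup (Suc m) j U = VTup [vtup m (Suc j) U, VVar j]"

text \<open>The induction peels off the innermost variable and shifts the remaining ones, whence the
  offset \<open>j\<close>.\<close>

lemma vtup:
  assumes "vtyp \<Gamma>' U Z" "\<And>i. i < length \<Gamma> \<Longrightarrow> j + i < length \<Gamma>' \<and> \<Gamma>' ! (j + i) = \<Gamma> ! i"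
  shows "vtyp \<Gamma>' (vtup (length \<Gamma>) j U) (ctxT Z \<Gamma>) \<and>
    seq (\<Gamma> @ [Z]) (ebs (length \<Gamma>) (vtup (length \<Gamma>) j U)) (\<lambda>n. if n < length \<Gamma> then VVar (j + n) else U) \<Gamma>'"
  using assms
proof (induction \<Gamma> arbitrary: j)
  case Nil
  then show ?case by (simp add: seq_def ve_refl)
next
  case (Cons A \<Gamma>)
  have "Suc j + i < length \<Gamma>' \<and> \<Gamma>' ! (Suc j + i) = \<Gamma> ! i" if "i < length \<Gamma>" for i
    using Cons.prems(2)[of "Suc i"] that by simp
  note IH = Cons.IH[OF Cons.prems(1) this]
  have j: "vtyp \<Gamma>' (VVar j) A" using Cons.prems(2)[of 0] by (auto intro: vtyp_VVarI)
  have t: "vtyp \<Gamma>' (VTup [vtup (length \<Gamma>) (Suc j) U, VVar j]) (ctxT Z (A # \<Gamma>))"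
    using vtyp_VTup2[OF conjunct1[OF IH] j] by simp
  have "seq (A # \<Gamma> @ [Z]) (scons (VVar j) (ebs (length \<Gamma>) (vtup (length \<Gamma>) (Suc j) U)))
      (scons (VVar j) (\<lambda>n. if n < length \<Gamma> then VVar (Suc j + n) else U)) \<Gamma>'"
    using IH by (intro seq_scons ve_refl j) simp
  moreover have "scons (VVar j) (\<lambda>n. if n < length \<Gamma> then VVar (Suc j + n) else U) =
      (\<lambda>n. if n < length (A # \<Gamma>) then VVar (j + n) else U)"
    by (rule ext) (simp add: scons_def split: nat.split)
  ultimately have "seq (A # \<Gamma> @ [Z]) (ebs (Suc (length \<Gamma>)) (VTup [vtup (length \<Gamma>) (Suc j) U, VVar j]))
      (\<lambda>n. if n < length (A # \<Gamma>) then VVar (j + n) else U) \<Gamma>'"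
    using seq_trans[OF ebs_tup[OF ve_refl[OF t] conjunct1[OF IH] j]] by simp
  with t show ?case by (simp del: ebs.simps)
qed

section \<open>Interpretation in the term model\<close>

lemma gvty_eq: "gvtyp \<Delta> V A \<Longrightarrow> gvty \<Delta> V = A"
  by (induction rule: gvtyp.induct) (auto simp: list_all2_conv_all_nth intro: nth_equalityI)

context term_model
begin

text \<open>Each type constructor is interpreted by the operation of the model that applies the same
  constructor, so types denote themselves.\<close>

lemma tyI_eo [simp]: "tyI \<MM> A = eo A"
proof (induction A)
  case (TProd As)
  then have "map (tyI \<MM>) As = map eo As" by simp
  then show ?case by (simp only: tyI.simps obs)
next
  case (TSum As)
  then have "map (tyI \<MM>) As = map eo As" by simp
  then show ?case by (simp only: tyI.simps obs)
qed simp_all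

lemma map_tyI: "map (tyI \<MM>) As = map eo As"
  "map (\<lambda>A. tyI \<MM> (ty_of A)) \<Delta> = map eo (map ty_of \<Delta>)"
  by simp_all

lemma ctxI_eo: "ctxI \<MM> (eo Z) (map eo \<Gamma>) = eo (ctxT Z \<Gamma>)"
  by (induction \<Gamma>) simp_all

lemma den_varI:
  "n < length \<Gamma> \<Longrightarrow> den (varI \<MM> (eo Z) (map eo \<Gamma>) n) (ctxT Z \<Gamma>) (\<Gamma> ! n) (ebs (length \<Gamma>) (VVar 0) n)"
proof (induction \<Gamma> arbitrary: n)
  case (Cons A \<Gamma>)
  show ?case
  proof (cases n)
    case 0
    then show ?thesis using den_Prj1 by (simp add: ctxI_eo)
  next
    case (Suc n')
    then show ?thesis using den_Cmp[OF Cons.IH[of n'] den_Prj0[of "ctxT Z \<Gamma>" A]] Cons.prems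
      by (simp add: ctxI_eo)
  qed
qed simp

lemma den_baseI:
  "den (baseI \<MM> (eo Z) (map eo \<Gamma>)) (ctxT Z \<Gamma>) Z (ebs (length \<Gamma>) (VVar 0) (length \<Gamma>))"
proof (induction \<Gamma>)
  case Nil
  then show ?case by (simp add: den_Ide)
next
  case (Cons A \<Gamma>)
  then show ?case using den_Cmp[OF Cons.IH den_Prj0[of "ctxT Z \<Gamma>" A]] by (simp add: ctxI_eo)
qed

text \<open>The base \<open>Z\<close> is arbitrary because the same values occur both in the
  interpretation over the unit object and in the action on handlers.\<close>

lemma den_gvI:
  "gvtyp \<Delta> V A \<Longrightarrow> den (gvI \<MM> (eo Z) \<Delta> V) (ctxT Z (map ty_of \<Delta>)) (ty_of A)
     (vsubst (ebs (length \<Delta>) (VVar 0)) (val_of V))"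
proof (induction rule: gvtyp.induct)
  case (gv_var n)
  then show ?case using den_varI[of n "map ty_of \<Delta>"] by (simp add: comp_def)
next
  case (gv_tup Vs As)
  then show ?case unfolding gvI.simps map_tyI ctxI_eo ty_of.simps vsubst.simps val_of.simps
    by (intro den_Tup) (auto simp: list_all2_conv_all_nth)
next
  case (gv_proj V As i)
  have "den (Prj \<MM> (map eo (map ty_of As)) i) (TProd (map ty_of As)) (map ty_of As ! i) (VProj i (VVar 0))"
    using gv_proj by (intro den_Prj) simp
  from den_Cmp[OF this] gv_proj.IH show ?case
    using gv_proj.hyps gvty_eq[OF gv_proj.hyps(1)] unfolding gvI.simps map_tyI by simp
next
  case (gv_inj i As V)
  have "den (Inc \<MM> (map eo (map ty_of As)) i) (map ty_of As ! i) (TSum (map ty_of As)) (VInj (map ty_of As) i (VVar 0))"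
    using gv_inj by (intro den_Inc) simp
  then have "den (Inc \<MM> (map eo (map ty_of As)) i) (ty_of (As ! i)) (TSum (map ty_of As)) (VInj (map ty_of As) i (VVar 0))"
    using gv_inj by simp
  from den_Cmp[OF this gv_inj.IH] show ?case
    unfolding gvI.simps map_tyI by simp
qed

lemma den_strmap:
  assumes "den f G (TT \<T> A) F" "den g (TProd [G, A]) B K"
  shows "den (strmap \<MM> \<T> (eo G) (eo A) f g) G (TT \<T> B)
    (thunk \<T> B (CLet A (force F) (CRet (inst K (VTup [VVar (Suc 0), VVar 0])))))"
proof -
  have "den (strmap \<MM> \<T> (eo G) (eo A) f g) G (TT \<T> B)
      (inst (tmV \<T> (TProd [G, A]) B K) (inst (stV \<T> G A) (VTup [VVar 0, F])))"
    unfolding strmap_def by (rule dd assms)+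
  then show ?thesis by (rule den_cong) (rule strmapV[OF den_typed[OF assms(1)] den_typed[OF assms(2)]])
qed

lemma den_bind:
  assumes "den f G (TT \<T> A) F" "den g (TProd [G, A]) (TT \<T> B) K"
  shows "den (Cmp \<MM> (Mu \<MM> \<T> (eo B)) (strmap \<MM> \<T> (eo G) (eo A) f g)) G (TT \<T> B)
    (thunk \<T> B (CLet A (force F) (force (inst K (VTup [VVar (Suc 0), VVar 0])))))"
  using den_cong[OF den_Cmp[OF den_Mu den_strmap[OF assms]] muV_thunk[OF den_typed[OF assms(1)] den_typed[OF assms(2)]]] .

text \<open>Stated for an arbitrary base, since it serves case distinctions both in
  \<open>cI\<close> and in \<open>hcI\<close>.\<close>

lemma den_Cot_pair:
  assumes V: "den v (ctxT Z \<Gamma>) (TSum As) V" and len: "length fs = length As" "length Ms = length As"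
    and M: "\<And>i. i < length As \<Longrightarrow> ctyp (As ! i # \<Gamma> @ [Z]) (Ms ! i) Y \<T>"
    and fs: "\<And>i. i < length As \<Longrightarrow> den (fs ! i) (ctxT Z (As ! i # \<Gamma>)) (TT \<T> Y)
      (thunk \<T> Y (csubst (ebs (Suc (length \<Gamma>)) (VVar 0)) (Ms ! i)))"
  shows "den (Cmp \<MM> (Cot \<MM> \<T> (eo (ctxT Z \<Gamma>)) (map eo As) (eo Y) fs) (pair \<MM> (Ide \<MM> (eo (ctxT Z \<Gamma>))) v))
    (ctxT Z \<Gamma>) (TT \<T> Y)
    (thunk \<T> Y (CCase V (map (csubst (up (ebs (length \<Gamma>) (VVar 0)))) Ms)))"
proof -
  let ?E = "ctxT Z \<Gamma>"
  let ?Vs = "map (\<lambda>M. thunk \<T> Y (csubst (ebs (Suc (length \<Gamma>)) (VVar 0)) M)) Ms"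
  have Vs: "list_all2 (\<lambda>f A. vtyp [TProd [?E, A]] f (TT \<T> Y)) ?Vs As"
    using den_typed[OF fs] len by (auto simp: list_all2_conv_all_nth)
  have C: "den (Cot \<MM> \<T> (eo ?E) (map eo As) (eo Y) fs) (TProd [?E, TSum As]) (TT \<T> Y) (cotV \<T> Y ?Vs)"
    by (rule den_Cot[OF Vs len(1)]) (use fs len in simp)
  have "den (Cmp \<MM> (Cot \<MM> \<T> (eo ?E) (map eo As) (eo Y) fs) (pair \<MM> (Ide \<MM> (eo ?E)) v))
      ?E (TT \<T> Y) (inst (cotV \<T> Y ?Vs) (VTup [VVar 0, V]))"
    by (rule dd C V)+
  then show ?thesis
  proof (rule den_cong)
    note V' = den_typed[OF V]
    have "ceq [?E] (CCase (VProj (Suc 0) (VTup [VVar 0, V]))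
          (map (\<lambda>f. force (inst f (VTup [VProj 0 (vren Suc (VTup [VVar 0, V])), VVar 0]))) ?Vs))
        (CCase V (map (csubst (up (ebs (length \<Gamma>) (VVar 0)))) Ms)) Y \<T>"
    proof (rule ce_case[of _ _ _ As])
      show "veq [?E] (VProj (Suc 0) (VTup [VVar 0, V])) V (TSum As)"
        by (rule proj1_tup tt V')+
      fix i assume i: "i < length As"
      have "veq [As ! i, ?E] (VTup [VProj 0 (vren Suc (VTup [VVar 0, V])), VVar 0])
          (VTup [vren Suc (VVar 0), VVar 0]) (ctxT Z (As ! i # \<Gamma>))"
        by simp (rule qq tt V')+
      from body_eq[OF M[OF i] tt_Var0 this]
      show "ceq [As ! i, ?E] (map (\<lambda>f. force (inst f (VTup [VProj 0 (vren Suc (VTup [VVar 0, V])), VVar 0]))) ?Vs ! i)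
          (map (csubst (up (ebs (length \<Gamma>) (VVar 0)))) Ms ! i) Y \<T>"
        using i len by (simp del: ebs.simps vren.simps inst_simps)
    qed (simp_all add: len)
    from veq_thunk[OF this]
    show "veq [?E] (inst (cotV \<T> Y ?Vs) (VTup [VVar 0, V])) (thunk \<T> Y (CCase V (map (csubst (up (ebs (length \<Gamma>) (VVar 0)))) Ms))) (TT \<T> Y)"
      by (simp only: inst_arrows)
  qed
qed

lemma den_app:
  assumes "den f G (TFun A B \<T>) F" "den g G A K"
  shows "den (Cmp \<MM> (KEv \<MM> \<T> (eo A) (eo B)) (pair \<MM> f g)) G (TT \<T> B) (thunk \<T> B (CApp F K))"
proof -
  have "den (Cmp \<MM> (KEv \<MM> \<T> (eo A) (eo B)) (pair \<MM> f g)) G (TT \<T> B) (inst (kevV \<T> B) (VTup [F, K]))"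
    by (rule dd assms)+
  then show ?thesis
    by (rule den_cong) (simp, (rule veq_thunk ce_app proj0_tup proj1_tup den_typed assms)+)
qed

lemma den_lam:
  assumes "ctyp (A # \<Gamma> @ [Z]) M B \<T>"
    "den f (ctxT Z (A # \<Gamma>)) (TT \<T> B) (thunk \<T> B (csubst (ebs (Suc (length \<Gamma>)) (VVar 0)) M))"
  shows "den (KCur \<MM> \<T> (eo (ctxT Z \<Gamma>)) (eo A) (eo B) f) (ctxT Z \<Gamma>) (TFun A B \<T>)
    (VLam A B \<T> (csubst (up (ebs (length \<Gamma>) (VVar 0))) M))"
proof -
  have "den (KCur \<MM> \<T> (eo (ctxT Z \<Gamma>)) (eo A) (eo B) f) (ctxT Z \<Gamma>) (TFun A B \<T>)
      (kcurV \<T> A B (thunk \<T> B (csubst (ebs (Suc (length \<Gamma>)) (VVar 0)) M)))"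
    using den_KCur assms(2) by simp
  then show ?thesis unfolding kcurV_def
    by (rule den_cong) (intro ve_lam body_eq[OF assms(1) tt_Var0], simp, (rule ve_refl tt)+)
qed

end

lemma handle_let_ret:
  assumes h: "vtyp [Z] h (handlerT \<T> \<T>' X)" and H: "htyp [Z] (hof \<T> h) \<T> X \<T>'"
    and "ctyp [Z] M A \<T>" "vtyp [A, Z] V (TT \<T>' X)" "ceq [A, Z] (force V) P X \<T>'"
  shows "ceq [Z] (CHandle (TT \<T>' X) \<T> (CLet A M (CRet V)) (hof \<T> h) (force (VVar 0)))
    (CHandle A \<T> M (hof \<T> h) P) X \<T>'"
  by (rule handle_let[OF h H] handle_ret[OF h H] hof_htyp_inst[OF H] tt assms)+

context term_model
begin

lemma den_assoc_l [dd]: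
  "den (assoc_l \<MM> (eo A) (eo B) (eo C)) (TProd [A, TProd [B, C]]) (TProd [TProd [A, B], C])
    (VTup [VTup [VProj 0 (VVar 0), VProj 0 (VProj (Suc 0) (VVar 0))], VProj (Suc 0) (VProj (Suc 0) (VVar 0))])"
proof -
  have "den (assoc_l \<MM> (eo A) (eo B) (eo C)) (TProd [A, TProd [B, C]]) (TProd [TProd [A, B], C])
      (VTup [VTup [VProj 0 (VVar 0), inst (VProj 0 (VVar 0)) (VProj (Suc 0) (VVar 0))],
        inst (VProj (Suc 0) (VVar 0)) (VProj (Suc 0) (VVar 0))])"
    unfolding assoc_l_def obs by (rule dd)+
  then show ?thesis by simp
qed

lemma clause_dom_eo:
  "clause_dom \<MM> \<T> \<T>' (eo X) op = eo (TProd [ty_of (argty \<T> op), TFun (ty_of (resty \<T> op)) X \<T>'])"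
  by (simp add: clause_dom_def)

lemma handler_factors_eo: "handler_factors \<MM> \<T> \<T>' (eo X) = map eo (map (clauseT \<T> \<T>' X) (ops \<T>))"
  by (simp add: handler_factors_def clause_dom_eo clauseT_def)

lemma handler_ob_eo: "handler_ob \<MM> \<T> \<T>' (eo X) = eo (handlerT \<T> \<T>' X)"
  by (simp only: handler_ob_def handler_factors_eo obs handlerT_def)

lemma den_handler_proj:
  assumes "fmlookup (sig \<T>) op = Some (A, B)"
  shows "den (handler_proj \<MM> \<T> \<T>' (eo X) op) (handlerT \<T> \<T>' X)
    (TFun (TProd [ty_of A, TFun (ty_of B) X \<T>']) X \<T>') (VProj (op_index \<T> op) (VVar 0))"
  using den_Prj[of "op_index \<T> op" "map (clauseT \<T> \<T>' X) (ops \<T>)"] op_index[OF assms]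
  unfolding handler_proj_def handler_factors_eo handlerT_def[symmetric]
  by (simp add: handlerT_nth[OF assms] del: nth_map map_map)

text \<open>The value denoting the handler clause \<open>P\<close> in the tuple that interprets a handler.\<close>

definition clauseV :: "('b, 'op) effthy \<Rightarrow> ('b, 'op) effthy \<Rightarrow> ('b, 'op) ty \<Rightarrow> nat \<Rightarrow> 'op \<Rightarrow> ('b, 'op) comp \<Rightarrow> ('b, 'op) val" where
  "clauseV \<T> \<T>' X m op P = kcurV \<T>' (TProd [ty_of (argty \<T> op), TFun (ty_of (resty \<T> op)) X \<T>']) X
    (inst (thunk \<T>' X (csubst (ebs (Suc (Suc m)) (VVar 0)) P))
      (VTup [VTup [VProj 0 (VVar 0), VProj 0 (VProj (Suc 0) (VVar 0))], VProj (Suc 0) (VProj (Suc 0) (VVar 0))]))"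

text \<open>A round trip: the tuple that interprets a handler, turned back into a handler by
  \<open>hof\<close>, has the original clauses. Applying a component to parameter and continuation
  is a beta redex whose argument is rebracketed by the associator before the environment is read
  off.\<close>

lemma hof_clauseV:
  fixes \<Gamma> :: "('b, 'op) ty list"
  assumes H: "htyp \<Gamma> H \<T> X \<T>'"
    and Vs: "list_all2 (vtyp [ctxT UT \<Gamma>]) Vs (map (clauseT \<T> \<T>' X) (ops \<T>))"
    and Vs_nth: "\<And>i. i < length (ops \<T>) \<Longrightarrow>
      Vs ! i = clauseV \<T> \<T>' X (length \<Gamma>) (ops \<T> ! i) (the (fmlookup H (ops \<T> ! i)))"
  shows "heq [ctxT UT \<Gamma>] (hof \<T> (VTup Vs)) (hsubst (ebs (length \<Gamma>) (VVar 0)) H) \<T> X \<T>'"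
    (is "heq [?E] _ ?H' _ _ _")
  unfolding heq_def
proof (intro conjI allI impI)
  show "fmdom (hof \<T> (VTup Vs)) = fmdom (sig \<T>)" by (simp add: hof_def)
  show "fmdom ?H' = fmdom (sig \<T>)" using htyp_fmdom[OF H] by simp
  fix op A B P P'
  assume op: "fmlookup (sig \<T>) op = Some (A, B)" and P: "fmlookup (hof \<T> (VTup Vs)) op = Some P"
    and P': "fmlookup ?H' op = Some P'"
  obtain Q where Q: "fmlookup H op = Some Q" "ctyp (TFun (ty_of B) X \<T>' # ty_of A # \<Gamma>) Q X \<T>'"
    by (rule htyp_clauseE[OF H op])
  let ?K = "TFun (ty_of B) X \<T>'" and ?r = "\<lambda>n. Suc (Suc n)" and ?i = "op_index \<T> op"
  let ?\<Gamma> = "[?K, ty_of A, ?E]" and ?m = "length \<Gamma>"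
  let ?x = "VTup [VVar (Suc 0), VVar 0] :: ('b, 'op) val"
  define q where "q = csubst (ebs (Suc (Suc ?m)) (VVar 0)) Q"
  let ?a = "VTup [VTup [VProj 0 (VVar 0), VProj 0 (VProj (Suc 0) (VVar 0))], VProj (Suc 0) (VProj (Suc 0) (VVar 0))] :: ('b, 'op) val"
  let ?c = "clauseV \<T> \<T>' X ?m op Q"
  have c: "Vs ! ?i = ?c" using Vs_nth op_index[OF op] Q(1) by simp
  have rty: "argty \<T> op = A" "resty \<T> op = B" using gctyp_argty[OF op] by auto
  have i: "?i < length (ops \<T>)" by (rule op_index[OF op])
  have ce: "vtyp [?E] ?c (TFun (TProd [ty_of A, ?K]) X \<T>')"
    using list_all2_nthD2[OF Vs, of ?i] i handlerT_nth[OF op, of \<T>' X] by (simp add: c del: nth_map)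
  have V: "vtyp ?\<Gamma> (vren ?r (VTup Vs)) (handlerT \<T> \<T>' X)"
    unfolding handlerT_def by (rule vtyp_ren[OF rtyp_SucSuc] vt_tup Vs)+
  have Vs': "list_all2 (vtyp ?\<Gamma>) (map (vren ?r) Vs) (map (clauseT \<T> \<T>' X) (ops \<T>))"
    by (rule list_all2_map1I[OF Vs]) (rule vtyp_ren[OF rtyp_SucSuc])
  have Peq: "P = CApp (VProj ?i (vren ?r (VTup Vs))) ?x" using P hof_lookup[OF op] by simp
  have len: "length Vs = length (ops \<T>)" using Vs by (auto dest: list_all2_lengthD)
  have 1: "ceq ?\<Gamma> P (CApp (vren ?r ?c) ?x) X \<T>'"
    unfolding Peq
    by (rule ce_app[of _ _ _ "TProd [ty_of A, ?K]"])
      (use handlerT_proj_tup[OF op Vs'] c len i in \<open>auto intro!: ve_refl tt\<close>)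
  have cl: "?c = VLam (TProd [ty_of A, ?K]) X \<T>' (force (inst (inst (thunk \<T>' X q) ?a) (VTup [VVar (Suc 0), VVar 0])))"
    by (simp only: clauseV_def kcurV_def rty q_def)
  have 2: "ceq ?\<Gamma> (CApp (vren ?r ?c) ?x) (force (inst (thunk \<T>' X q) (inst ?a (VTup [VVar (Suc (Suc 0)), ?x])))) X \<T>'"
  proof -
    have "vtyp ?\<Gamma> (vren ?r ?c) (TFun (TProd [ty_of A, ?K]) X \<T>')" by (rule vtyp_ren[OF rtyp_SucSuc ce])
    then have "vtyp ?\<Gamma> (VLam (TProd [ty_of A, ?K]) X \<T>' (force (inst (thunk \<T>' X q) (inst ?a (VTup [VVar (Suc (Suc (Suc 0))), VVar 0]))))) (TFun (TProd [ty_of A, ?K]) X \<T>')"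
      unfolding cl by (simp del: inst_simps(5))
    then have "ctyp (TProd [ty_of A, ?K] # ?\<Gamma>) (force (inst (thunk \<T>' X q) (inst ?a (VTup [VVar (Suc (Suc (Suc 0))), VVar 0])))) X \<T>'"
      by (elim vtyp_VLamE) simp
    from ce_fun_beta[OF this vtyp_VTup2[OF tt_VarSuc[OF tt_Var0] tt_Var0]] show ?thesis
      unfolding cl by (simp add: csubst1_def del: inst_simps(5))
  qed
  \<comment> \<open>In \<open>?\<Gamma>\<close> index 0 is the continuation, index 1 the parameter
    and index 2 the environment tuple. Reading off the rebracketed tuple keeps the first two and so
    gives the doubly lifted substitution.\<close>
  have s: "seq (?K # ty_of A # \<Gamma> @ [UT]) (ebs (Suc (Suc ?m)) (inst ?a (VTup [VVar (Suc (Suc 0)), ?x])))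
      (up (up (ebs ?m (VVar 0)))) ?\<Gamma>"
  proof (rule seq_trans)
    have "veq ?\<Gamma> (inst ?a (VTup [VVar (Suc (Suc 0)), ?x])) (VTup [VTup [VVar (Suc (Suc 0)), VVar (Suc 0)], VVar 0])
       (ctxT UT (?K # ty_of A # \<Gamma>))"
      by simp (rule ve_proj_proj1 qq tt)+
    then show "seq (?K # ty_of A # \<Gamma> @ [UT]) (ebs (Suc (Suc ?m)) (inst ?a (VTup [VVar (Suc (Suc 0)), ?x])))
       (scons (VVar 0) (ebs (Suc ?m) (VTup [VVar (Suc (Suc 0)), VVar (Suc 0)]))) ?\<Gamma>"
      using ebs_tup[of ?\<Gamma> _ "VTup [VVar (Suc (Suc 0)), VVar (Suc 0)]" "VVar 0" UT ?K "ty_of A # \<Gamma>"]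
      by (simp add: tt del: ebs.simps inst_simps)
    have "seq (ty_of A # \<Gamma> @ [UT]) (ebs (Suc ?m) (VTup [VVar (Suc (Suc 0)), VVar (Suc 0)]))
       (scons (VVar (Suc 0)) (ebs ?m (VVar (Suc (Suc 0))))) ?\<Gamma>"
      by (rule ebs_tup) (rule ve_refl tt | simp)+
    note s' = seq_scons[OF ve_refl[OF tt_Var0] this]
    show "seq (?K # ty_of A # \<Gamma> @ [UT]) (scons (VVar 0) (ebs (Suc ?m) (VTup [VVar (Suc (Suc 0)), VVar (Suc 0)])))
       (up (up (ebs ?m (VVar 0)))) ?\<Gamma>"
    proof -
      have "(up (up (ebs ?m (VVar 0))) :: nat \<Rightarrow> ('b, 'op) val) = scons (VVar 0) (scons (VVar (Suc 0)) (ebs ?m (VVar (Suc (Suc 0)))))"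
        by (rule ext) (simp add: up_def scons_def split: nat.split)
      then show ?thesis using s' by simp
    qed
  qed
  have 3: "ceq ?\<Gamma> (force (inst (thunk \<T>' X q) (inst ?a (VTup [VVar (Suc (Suc 0)), ?x])))) P' X \<T>'"
    using force_thunk'[OF csubst_cong[OF ctyp_append[OF Q(2), of "[UT]", simplified] s]] P' Q(1)
    by (simp add: q_def del: ebs.simps inst_simps(1-4,6))
  show "ceq ?\<Gamma> P P' X \<T>'" by (rule ce_trans[OF 1 ce_trans[OF 2 3]])
qed

text \<open>The mutual induction follows typing, because the interpretation depends on context and
  type. The handler conclusion only records denotations of the clauses; assembling them into the
  tuple is left to the \<open>CHandle\<close> case, where the environment object is at hand.\<close>

lemma den_interp:
  shows den_vI: "vtyp \<Gamma> V A \<Longrightarrow>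
      den (vI \<MM> V \<Gamma>) (ctxT UT \<Gamma>) A (vsubst (ebs (length \<Gamma>) (VVar 0)) V)"
    and den_cI: "ctyp \<Gamma> M A \<T> \<Longrightarrow>
      den (cI \<MM> M \<Gamma> A \<T>) (ctxT UT \<Gamma>) (TT \<T> A) (thunk \<T> A (csubst (ebs (length \<Gamma>) (VVar 0)) M))"
    and "htyp \<Gamma> H \<T> X \<T>' \<Longrightarrow> fmlookup (sig \<T>) op = Some (A', B') \<Longrightarrow> fmlookup H op = Some P \<Longrightarrow>
      den (cI \<MM> P (TFun (ty_of B') X \<T>' # ty_of A' # \<Gamma>) X \<T>') (ctxT UT (TFun (ty_of B') X \<T>' # ty_of A' # \<Gamma>))
       (TT \<T>' X) (thunk \<T>' X (csubst (ebs (Suc (Suc (length \<Gamma>))) (VVar 0)) P))"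
    and "veq \<Gamma> V W A \<Longrightarrow> True"
    and "ceq \<Gamma> M N A \<T> \<Longrightarrow> True"
proof (induction arbitrary: and and op A' B' P and and rule: vtyp_ctyp_htyp_veq_ceq.inducts)
  case (vt_var n \<Gamma>)
  then show ?case using den_varI by (simp add: map_tyI)
next
  case (vt_tup \<Gamma> Vs As)
  then show ?case unfolding vI.simps map_tyI ctxI_eo vsubst.simps obs
    by (intro den_Tup) (auto simp: list_all2_conv_all_nth)
next
  case (vt_proj \<Gamma> V As i)
  then show ?case using den_Cmp[OF den_Prj vt_proj.IH] vty_eq[OF vt_proj.hyps(1)]
    by (simp add: map_tyI)
next
  case (vt_inj i As \<Gamma> V)
  then show ?case using den_Cmp[OF den_Inc vt_inj.IH] by (simp add: map_tyI)
next
  case (vt_lam A \<Gamma> M B \<T>)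
  then show ?case using den_lam[OF ctyp_append[OF vt_lam.hyps, of "[UT]", simplified], of "cI \<MM> M (A # \<Gamma>) B \<T>"]
    by (simp add: map_tyI ctxI_eo del: ebs.simps)
next
  case (ct_ret \<Gamma> V A \<T>)
  then show ?case using den_Cmp[OF den_Eta ct_ret.IH] by simp
next
  case (ct_let \<Gamma> M A \<T> N B)
  have "den (cI \<MM> (CLet A M N) \<Gamma> B \<T>) (ctxT UT \<Gamma>) (TT \<T> B)
      (thunk \<T> B (CLet A (force (thunk \<T> A (csubst (ebs (length \<Gamma>) (VVar 0)) M)))
        (force (inst (thunk \<T> B (csubst (ebs (Suc (length \<Gamma>)) (VVar 0)) N)) (VTup [VVar (Suc 0), VVar 0])))))"
    using den_bind[OF ct_let.IH(1)] ct_let.IH(2)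
    by (simp add: map_tyI ctxI_eo del: ebs.simps inst_simps)
  then show ?case
  proof (rule den_cong)
    note M = den_typed[OF ct_let.IH(1)]
    have "ceq [ctxT UT \<Gamma>] (CLet A (force (thunk \<T> A (csubst (ebs (length \<Gamma>) (VVar 0)) M)))
        (force (inst (thunk \<T> B (csubst (ebs (Suc (length \<Gamma>)) (VVar 0)) N)) (VTup [VVar (Suc 0), VVar 0]))))
        (CLet A (csubst (ebs (length \<Gamma>) (VVar 0)) M) (csubst (up (ebs (length \<Gamma>) (VVar 0))) N)) B \<T>"
    proof (rule ce_let)
      show "ceq [ctxT UT \<Gamma>] (force (thunk \<T> A (csubst (ebs (length \<Gamma>) (VVar 0)) M))) (csubst (ebs (length \<Gamma>) (VVar 0)) M) A \<T>"
        by (rule force_thunk ctyp_subst[OF styp_ebs] ctyp_append ct_let.hyps tt)+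
      show "ceq [A, ctxT UT \<Gamma>] (force (inst (thunk \<T> B (csubst (ebs (Suc (length \<Gamma>)) (VVar 0)) N)) (VTup [VVar (Suc 0), VVar 0])))
          (csubst (up (ebs (length \<Gamma>) (VVar 0))) N) B \<T>"
        by (rule body_eq[OF ctyp_append[OF ct_let.hyps(2), of "[UT]", simplified]]) (simp, (rule ve_refl tt)+ | rule tt)+
    qed
    from veq_thunk[OF this]
    show "veq [ctxT UT \<Gamma>] (thunk \<T> B (CLet A (force (thunk \<T> A (csubst (ebs (length \<Gamma>) (VVar 0)) M)))
        (force (inst (thunk \<T> B (csubst (ebs (Suc (length \<Gamma>)) (VVar 0)) N)) (VTup [VVar (Suc 0), VVar 0])))))
       (thunk \<T> B (csubst (ebs (length \<Gamma>) (VVar 0)) (CLet A M N))) (TT \<T> B)" by simp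
  qed
next
  case (ct_app \<Gamma> V A B \<T> W)
  then show ?case using den_app[OF ct_app.IH] vty_eq[OF ct_app.hyps(2)] by simp
next
  case (ct_case \<Gamma> V As B \<T> Ms)
  have len: "length Ms = length As" using ct_case by (auto dest: list_all2_lengthD)
  have M: "ctyp (As ! i # \<Gamma> @ [UT]) (Ms ! i) B \<T>"
    and D: "den (map2 (\<lambda>A m. m (A # \<Gamma>) B \<T>) As (map (cI \<MM>) Ms) ! i) (ctxT UT (As ! i # \<Gamma>)) (TT \<T> B)
      (thunk \<T> B (csubst (ebs (Suc (length \<Gamma>)) (VVar 0)) (Ms ! i)))" if "i < length As" for i
    using ct_case.IH(2) that ctyp_append[of "As ! i # \<Gamma>" "Ms ! i" B \<T> "[UT]"] len
    by (auto simp: list_all2_conv_all_nth simp del: ebs.simps)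
  show ?case using den_Cot_pair[OF ct_case.IH(1) _ len M D] len vty_eq[OF ct_case.hyps(1)]
    by (simp add: map_tyI ctxI_eo Let_def del: ebs.simps)
next
  case (ct_op \<T> op A B \<Gamma> V)
  then show ?case using den_Cmp[OF den_Opn[OF ct_op.hyps(1)] ct_op.IH] gctyp_argty[OF ct_op.hyps(1)] by simp
next
  case (ht H \<T> X \<T>' \<Gamma>)
  show ?case using ht.IH(1)[OF ht.prems] by simp
next
  case (ct_handle \<Gamma> M A \<T> H C \<T>' N)
  let ?E = "ctxT UT \<Gamma>" and ?s = "ebs (length \<Gamma>) (VVar 0)"
  let ?clause = "\<lambda>op. let P = ty_of (argty \<T> op); K = TFun (ty_of (resty \<T> op)) C \<T>' in
            KCur \<MM> \<T>' (envI \<MM> \<Gamma>) (clause_dom \<MM> \<T> \<T>' (tyI \<MM> C) op) (tyI \<MM> C)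
              (Cmp \<MM> (the (fmlookup (fmmap (cI \<MM>) H) op) (K # P # \<Gamma>) C \<T>')
               (assoc_l \<MM> (envI \<MM> \<Gamma>) (tyI \<MM> P) (tyI \<MM> K)))"
  define Vs where "Vs = map (\<lambda>op. clauseV \<T> \<T>' C (length \<Gamma>) op (the (fmlookup H op))) (ops \<T>)"
  have cl: "den (?clause op) ?E (clauseT \<T> \<T>' C op) (clauseV \<T> \<T>' C (length \<Gamma>) op (the (fmlookup H op)))"
    if op: "op \<in> set (ops \<T>)" for op
  proof -
    obtain A' B' where op: "fmlookup (sig \<T>) op = Some (A', B')"
      using op by (auto simp: ops_spec fmlookup_dom_iff)
    obtain P where P: "fmlookup H op = Some P" by (rule htyp_clauseE[OF ct_handle.hyps(2) op])
    have "envI \<MM> \<Gamma> = eo ?E" by (simp add: map_tyI ctxI_eo)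
    then show ?thesis
      using den_KCur[OF den_Cmp[OF ct_handle.IH(2)[OF op P, simplified ctxT.simps] den_assoc_l]]
      by (simp add: Let_def P gctyp_argty[OF op] clause_dom_eo clauseT_def clauseV_def del: ebs.simps inst_simps)
  qed
  have Vs: "list_all2 (vtyp [?E]) Vs (map (clauseT \<T> \<T>' C) (ops \<T>))"
    using den_typed[OF cl] by (auto simp: Vs_def list_all2_conv_all_nth)
  have T: "den (Tup \<MM> (envI \<MM> \<Gamma>) (map ?clause (ops \<T>))) ?E (handlerT \<T> \<T>' C) (VTup Vs)"
    unfolding map_tyI obs ctxI_eo handlerT_def
    by (rule den_Tup) (use cl in \<open>simp_all add: Vs_def map_tyI ctxI_eo\<close>)
  have heq: "heq [?E] (hof \<T> (VTup Vs)) (hsubst ?s H) \<T> C \<T>'"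
    by (rule hof_clauseV[OF ct_handle.hyps(2) Vs]) (simp add: Vs_def)
  \<comment> \<open>Typability is known for the substituted syntactic handler and has to be carried
    over to the tuple, hence the reversed direction.\<close>
  have heq': "heq [?E] (hsubst ?s H) (hof \<T> (VTup Vs)) \<T> C \<T>'"
    using heq unfolding heq_def by (auto intro: ce_sym)
  have Hs: "htyp [?E] (hsubst ?s H) \<T> C \<T>'"
    by (rule htyp_subst[OF styp_ebs] htyp_append ct_handle.hyps tt)+
  have Hof: "htyp [?E] (hof \<T> (VTup Vs)) \<T> C \<T>'" by (rule htyp_heq[OF Hs heq'])
  have S: "den (strmap \<MM> \<T> (envI \<MM> \<Gamma>) (tyI \<MM> A) (cI \<MM> M \<Gamma> A \<T>) (cI \<MM> N (A # \<Gamma>) C \<T>')) ?E (TT \<T> (TT \<T>' C))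
      (thunk \<T> (TT \<T>' C) (CLet A (force (thunk \<T> A (csubst ?s M)))
        (CRet (inst (thunk \<T>' C (csubst (ebs (Suc (length \<Gamma>)) (VVar 0)) N)) (VTup [VVar (Suc 0), VVar 0])))))"
    using den_strmap[OF ct_handle.IH(1)] ct_handle.IH(3)
    by (simp add: map_tyI ctxI_eo del: ebs.simps inst_simps)
  have "den (cI \<MM> (CHandle A \<T> M H N) \<Gamma> C \<T>') ?E (TT \<T>' C) (hdlV \<T> \<T>' C (VTup Vs)
      (thunk \<T> (TT \<T>' C) (CLet A (force (thunk \<T> A (csubst ?s M)))
        (CRet (inst (thunk \<T>' C (csubst (ebs (Suc (length \<Gamma>)) (VVar 0)) N)) (VTup [VVar (Suc 0), VVar 0]))))))"
    unfolding cI.simps tyI_eo[of C] using den_Hdl[OF T Hof S] by (simp only: tyI_eo)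
  then show ?case
  proof (rule den_cong)
    let ?V = "inst (thunk \<T>' C (csubst (ebs (Suc (length \<Gamma>)) (VVar 0)) N)) (VTup [VVar (Suc 0), VVar 0])"
    have Ms: "ctyp [?E] (csubst ?s M) A \<T>"
      by (rule ctyp_subst[OF styp_ebs] ctyp_append ct_handle.hyps tt)+
    have V: "vtyp [A, ?E] ?V (TT \<T>' C)"
      using tt_inst[OF den_typed[OF ct_handle.IH(3)], of "[A, ?E]" "VTup [VVar (Suc 0), VVar 0]"]
      by (simp add: vtyp_VTup2 tt_Var0 tt_VarSuc del: ebs.simps inst_simps)
    have V': "ceq [A, ?E] (force ?V) (csubst (up ?s) N) C \<T>'"
      by (rule body_eq[OF ctyp_append[OF ct_handle.hyps(3), of "[UT]", simplified]]) (simp, (rule ve_refl tt)+ | rule tt)+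
    have L: "ctyp [?E] (CLet A (force (thunk \<T> A (csubst ?s M))) (CRet ?V)) (TT \<T>' C) \<T>"
      by (rule tt V Ms)+
    have 1: "ceq [?E] (CHandle (TT \<T>' C) \<T> (force (thunk \<T> (TT \<T>' C) (CLet A (force (thunk \<T> A (csubst ?s M))) (CRet ?V)))) (hof \<T> (VTup Vs)) (force (VVar 0)))
        (CHandle (TT \<T>' C) \<T> (CLet A (force (thunk \<T> A (csubst ?s M))) (CRet ?V)) (hof \<T> (VTup Vs)) (force (VVar 0))) C \<T>'"
      by (rule ceq_handle force_thunk L Hof hof_heq ve_refl den_typed[OF T] ce_refl tt)+
    have 2: "ceq [?E] (CHandle (TT \<T>' C) \<T> (CLet A (force (thunk \<T> A (csubst ?s M))) (CRet ?V)) (hof \<T> (VTup Vs)) (force (VVar 0)))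
        (CHandle A \<T> (force (thunk \<T> A (csubst ?s M))) (hof \<T> (VTup Vs)) (csubst (up ?s) N)) C \<T>'"
      by (rule handle_let_ret[OF den_typed[OF T] Hof _ V V']) (rule tt Ms)+
    have 3: "ceq [?E] (CHandle A \<T> (force (thunk \<T> A (csubst ?s M))) (hof \<T> (VTup Vs)) (csubst (up ?s) N))
        (CHandle A \<T> (csubst ?s M) (hsubst ?s H) (csubst (up ?s) N)) C \<T>'"
      by (rule ceq_handle force_thunk Ms Hof heq ce_refl ceq_typed(2)[OF V'])+
    show "veq [?E] (hdlV \<T> \<T>' C (VTup Vs) (thunk \<T> (TT \<T>' C) (CLet A (force (thunk \<T> A (csubst ?s M))) (CRet ?V))))
        (thunk \<T>' C (csubst ?s (CHandle A \<T> M H N))) (TT \<T>' C)"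
      unfolding hdlV_def csubst_handle by (rule veq_thunk[OF ce_trans[OF 1 ce_trans[OF 2 3]]])
  qed
qed simp_all

end

section \<open>Semantic handlers are typable handlers\<close>

lemma styp_prefix: "styp (\<Gamma> @ \<Delta>) \<sigma> \<Gamma>' \<Longrightarrow> styp \<Gamma> \<sigma> \<Gamma>'"
  unfolding styp_def by (metis length_append nth_append trans_less_add1)

lemma seq_prefix: "seq (\<Gamma> @ \<Delta>) \<sigma> \<tau> \<Gamma>' \<Longrightarrow> seq \<Gamma> \<sigma> \<tau> \<Gamma>'"
  unfolding seq_def by (metis length_append nth_append trans_less_add1)

lemma fmdom_hof: "fmdom (hof \<T> h) = fmdom (sig \<T>)"
  by (simp add: hof_def)

lemma ctyp_hinst:
  assumes "gctyp (sig \<T>) \<Delta> M A" "vtyp (map ty_of \<Delta> @ \<Gamma>) h (handlerT \<T> \<T>' X)"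
    "vtyp (map ty_of \<Delta> @ \<Gamma>) k (TFun (ty_of A) X \<T>')"
  shows "ctyp (map ty_of \<Delta> @ \<Gamma>) (hinst \<T> X \<T>' (hof \<T> h) k M) X \<T>'"
  using ceq_typed(1)[OF hinst_cong[OF assms(1) hof_heq[OF ve_refl[OF assms(2)]] ve_refl[OF assms(3)]]] .

context term_model
begin

text \<open>In the context \<open>map ty_of \<Delta> @ [Z]\<close> the base variable has index
  \<open>length \<Delta>\<close>; \<open>H\<close> and \<open>K\<close> are evaluated there, which
  corresponds to weakening them under the variables of the axiom. Evaluating a component of
  \<open>h\<close> at a pair is exactly an application made by a clause of
  \<open>hof\<close>.\<close>

lemma den_hcI:
  assumes h: "den h Z (handlerT \<T> \<T>' X) H"
  shows "gctyp (sig \<T>) \<Delta> M C \<Longrightarrow> den k Z (TFun (ty_of C) X \<T>') K \<Longrightarrow>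
    den (hcI \<MM> \<T> \<T>' (eo X) (eo Z) h k C M \<Delta>) (ctxT Z (map ty_of \<Delta>)) (TT \<T>' X)
      (thunk \<T>' X (csubst (ebs (length \<Delta>) (VVar 0))
        (hinst \<T> X \<T>' (hof \<T> (inst H (VVar (length \<Delta>)))) (inst K (VVar (length \<Delta>))) M)))"
proof (induction rule: gctyp.induct)
  case (gc_ret \<Delta> V A)
  then show ?case
    using den_app[OF den_Cmp[OF gc_ret.prems den_baseI[of Z "map ty_of \<Delta>"]] den_gvI[OF gc_ret.hyps, of Z]]
    by (simp add: comp_def)
next
  case (gc_let op A B \<Delta> V M C)
  let ?m = "length \<Delta>" and ?\<Delta> = "map ty_of \<Delta>" and ?i = "op_index \<T> op"
  define N where "N = hinst \<T> X \<T>' (hof \<T> (inst H (VVar (Suc ?m)))) (inst K (VVar (Suc ?m))) M"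
  have Z: "vtyp (?\<Delta> @ [Z]) (VVar ?m) Z" by (rule vtyp_VVarI) (simp_all add: nth_append)
  have Z': "vtyp (map ty_of (B # \<Delta>) @ [Z]) (VVar (Suc ?m)) Z" using tt_VarSuc[OF Z] by simp
  have N: "ctyp (ty_of B # ?\<Delta> @ [Z]) N X \<T>'" unfolding N_def
    using ctyp_hinst[OF gc_let.hyps(3) tt_inst[OF den_typed[OF h] Z'] tt_inst[OF den_typed[OF gc_let.prems] Z']]
    by simp
  have L: "den (KCur \<MM> \<T>' (eo (ctxT Z ?\<Delta>)) (eo (ty_of B)) (eo X) (hcI \<MM> \<T> \<T>' (eo X) (eo Z) h k C M (B # \<Delta>)))
      (ctxT Z ?\<Delta>) (TFun (ty_of B) X \<T>') (VLam (ty_of B) X \<T>' (csubst (up (ebs ?m (VVar 0))) N))"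
    using den_lam[OF N, of "hcI \<MM> \<T> \<T>' (eo X) (eo Z) h k C M (B # \<Delta>)"] gc_let.IH[OF gc_let.prems]
    by (simp add: N_def del: ebs.simps)
  have P: "den (Cmp \<MM> (handler_proj \<MM> \<T> \<T>' (eo X) op) (Cmp \<MM> h (baseI \<MM> (eo Z) (map eo ?\<Delta>)))) (ctxT Z ?\<Delta>)
     (TFun (TProd [ty_of A, TFun (ty_of B) X \<T>']) X \<T>') (VProj ?i (inst H (ebs ?m (VVar 0) ?m)))"
    using den_Cmp[OF den_handler_proj[OF gc_let.hyps(1)] den_Cmp[OF h den_baseI[of Z ?\<Delta>]]] by simp
  have "hcI \<MM> \<T> \<T>' (eo X) (eo Z) h k C (GLet op V M) \<Delta> =
     Cmp \<MM> (KEv \<MM> \<T>' (eo (TProd [ty_of A, TFun (ty_of B) X \<T>'])) (eo X))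
       (pair \<MM> (Cmp \<MM> (handler_proj \<MM> \<T> \<T>' (eo X) op) (Cmp \<MM> h (baseI \<MM> (eo Z) (map eo ?\<Delta>))))
         (pair \<MM> (gvI \<MM> (eo Z) \<Delta> V) (KCur \<MM> \<T>' (eo (ctxT Z ?\<Delta>)) (eo (ty_of B)) (eo X) (hcI \<MM> \<T> \<T>' (eo X) (eo Z) h k C M (B # \<Delta>)))))"
    using gctyp_argty[OF gc_let.hyps(1)] unfolding hcI.simps clause_dom_eo map_tyI ctxI_eo by simp
  moreover have "csubst (ebs ?m (VVar 0)) (hinst \<T> X \<T>' (hof \<T> (inst H (VVar ?m))) (inst K (VVar ?m)) (GLet op V M)) =
      CApp (VProj ?i (inst H (ebs ?m (VVar 0) ?m)))
        (VTup [vsubst (ebs ?m (VVar 0)) (val_of V), VLam (ty_of B) X \<T>' (csubst (up (ebs ?m (VVar 0))) N)])"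
    using gctyp_argty[OF gc_let.hyps(1)]
    by (simp add: hof_lookup[OF gc_let.hyps(1)] clause_subst_def N_def del: inst_simps)
  ultimately show ?case
    using den_app[OF P den_pair[OF den_gvI[OF gc_let.hyps(2)] L]] by simp
next
  case (gc_case \<Delta> V As C Ms)
  let ?m = "length \<Delta>" and ?\<Delta> = "map ty_of \<Delta>" and ?As = "map ty_of As"
  let ?N = "hinst \<T> X \<T>' (hof \<T> (inst H (VVar (Suc ?m)))) (inst K (VVar (Suc ?m)))"
  let ?fs = "map2 (\<lambda>A m. m (A # \<Delta>)) As (map (hcI \<MM> \<T> \<T>' (eo X) (eo Z) h k C) Ms)"
  have len: "length Ms = length As" using gc_case.IH by (auto dest: list_all2_lengthD)
  have Z': "vtyp (map ty_of (B # \<Delta>) @ [Z]) (VVar (Suc ?m)) Z" for B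
    by (rule vtyp_VVarI) (simp_all add: nth_append)
  have M: "ctyp (?As ! i # ?\<Delta> @ [Z]) (map ?N Ms ! i) X \<T>'"
    and D: "den (?fs ! i) (ctxT Z (?As ! i # ?\<Delta>)) (TT \<T>' X)
      (thunk \<T>' X (csubst (ebs (Suc (length ?\<Delta>)) (VVar 0)) (map ?N Ms ! i)))" if i: "i < length ?As" for i
  proof -
    have g: "gctyp (sig \<T>) (As ! i # \<Delta>) (Ms ! i) C"
      using gc_case.IH i by (auto simp: list_all2_conv_all_nth)
    from ctyp_hinst[OF g tt_inst[OF den_typed[OF h] Z'] tt_inst[OF den_typed[OF gc_case.prems] Z']]
    show "ctyp (?As ! i # ?\<Delta> @ [Z]) (map ?N Ms ! i) X \<T>'" using i len by simp
    have "den (hcI \<MM> \<T> \<T>' (eo X) (eo Z) h k C (Ms ! i) (As ! i # \<Delta>)) (ctxT Z (map ty_of (As ! i # \<Delta>))) (TT \<T>' X)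
      (thunk \<T>' X (csubst (ebs (length (As ! i # \<Delta>)) (VVar 0))
        (hinst \<T> X \<T>' (hof \<T> (inst H (VVar (length (As ! i # \<Delta>))))) (inst K (VVar (length (As ! i # \<Delta>)))) (Ms ! i))))"
      using gc_case.IH gc_case.prems i by (auto simp: list_all2_conv_all_nth simp del: ebs.simps)
    then show "den (?fs ! i) (ctxT Z (?As ! i # ?\<Delta>)) (TT \<T>' X)
      (thunk \<T>' X (csubst (ebs (Suc (length ?\<Delta>)) (VVar 0)) (map ?N Ms ! i)))"
      using i len by (simp del: ebs.simps)
  qed
  have V: "den (gvI \<MM> (eo Z) \<Delta> V) (ctxT Z ?\<Delta>) (TSum ?As) (vsubst (ebs ?m (VVar 0)) (val_of V))"
    using den_gvI[OF gc_case.hyps] by simp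
  have "hcI \<MM> \<T> \<T>' (eo X) (eo Z) h k C (GCase V Ms) \<Delta> =
     Cmp \<MM> (Cot \<MM> \<T>' (eo (ctxT Z ?\<Delta>)) (map eo ?As) (eo X) ?fs) (pair \<MM> (Ide \<MM> (eo (ctxT Z ?\<Delta>))) (gvI \<MM> (eo Z) \<Delta> V))"
    using gvty_eq[OF gc_case.hyps] unfolding hcI.simps map_tyI ctxI_eo Let_def by simp
  moreover have "csubst (ebs ?m (VVar 0)) (hinst \<T> X \<T>' (hof \<T> (inst H (VVar ?m))) (inst K (VVar ?m)) (GCase V Ms)) =
      CCase (vsubst (ebs ?m (VVar 0)) (val_of V)) (map (csubst (up (ebs ?m (VVar 0)))) (map ?N Ms))"
    by simp
  ultimately show ?case
    using den_Cot_pair[OF V _ _ M D] len by simp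
qed

text \<open>By \<open>den_hcI\<close> the semantic axiom equation is a provable equality of thunks
  in one variable, a nested tuple. Substituting the tuple of the variables of
  \<open>?\<Gamma>\<close> and forcing yields the flat equation that \<open>htyp\<close>
  requires.\<close>

lemma handlers_htyp:
  assumes "h \<in> handlers \<MM> \<T> \<T>' (eo X) (eo Z)" and h: "den h Z (handlerT \<T> \<T>' X) H"
  shows "htyp [Z] (hof \<T> H) \<T> X \<T>'"
proof (rule ht)
  note H = den_typed[OF h]
  show "fmdom (hof \<T> H) = fmdom (sig \<T>)" by (simp add: hof_def)
  show "ctyp (TFun (ty_of B) X \<T>' # ty_of A # [Z]) P X \<T>'"
    if op: "fmlookup (sig \<T>) op = Some (A, B)" and P: "fmlookup (hof \<T> H) op = Some P" for op A B P
    using hof_heq[OF ve_refl[OF H]] op P ceq_typed(1) unfolding heq_def by blast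
  fix \<Delta> M N A assume ax: "(\<Delta>, M, N, A) \<in> axs \<T>"
  let ?K = "TFun (ty_of A) X \<T>'" and ?m = "length \<Delta>" and ?\<Delta> = "map ty_of \<Delta>"
  let ?Z = "TProd [Z, ?K]" and ?\<Gamma> = "?\<Delta> @ ?K # [Z]"
  let ?I = "hinst \<T> X \<T>' (hof \<T> (inst (inst H (VProj 0 (VVar 0))) (VVar ?m))) (inst (VProj (Suc 0) (VVar 0)) (VVar ?m))"
  let ?J = "hinst \<T> X \<T>' (hren ((+) (Suc ?m)) (hof \<T> H)) (VVar ?m)"
  \<comment> \<open>In \<open>?\<Gamma>\<close> the continuation has index \<open>?m\<close> and the
    domain of \<open>h\<close> comes right after it; \<open>?U\<close> pairs them in the order of
    the base \<open>?Z\<close>.\<close>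
  let ?U = "VTup [VVar (Suc ?m), VVar ?m] :: ('b, 'op) val"
  let ?T = "vtup ?m 0 ?U"
  have d1: "den (Cmp \<MM> h (Prj \<MM> [eo Z, eo ?K] 0)) ?Z (handlerT \<T> \<T>' X) (inst H (VProj 0 (VVar 0)))"
    by (rule dd h)+
  have d2: "den (Prj \<MM> [eo Z, eo ?K] 1) ?Z ?K (VProj (Suc 0) (VVar 0))" by (rule dd)
  have D: "den (hcI \<MM> \<T> \<T>' (eo X) (eo ?Z) (Cmp \<MM> h (Prj \<MM> [eo Z, eo ?K] 0)) (Prj \<MM> [eo Z, eo ?K] 1) A L \<Delta>)
      (ctxT ?Z ?\<Delta>) (TT \<T>' X) (thunk \<T>' X (csubst (ebs ?m (VVar 0)) (?I L)))"
    if "gctyp (sig \<T>) \<Delta> L A" for L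
    by (rule den_hcI[OF d1 that d2])
  have eq: "hcI \<MM> \<T> \<T>' (eo X) (eo ?Z) (Cmp \<MM> h (Prj \<MM> [eo Z, eo ?K] 0)) (Prj \<MM> [eo Z, eo ?K] 1) A M \<Delta> =
      hcI \<MM> \<T> \<T>' (eo X) (eo ?Z) (Cmp \<MM> h (Prj \<MM> [eo Z, eo ?K] 0)) (Prj \<MM> [eo Z, eo ?K] 1) A N \<Delta>"
    using assms(1) ax by (auto simp: handlers_def Let_def)
  have ZV: "vtyp ?\<Gamma> (VVar (Suc ?m)) Z" "vtyp ?\<Gamma> (VVar ?m) ?K"
    by (rule vtyp_VVarI; simp add: nth_append)+
  have U: "vtyp ?\<Gamma> ?U ?Z" by (rule tt ZV)+
  have T: "vtyp ?\<Gamma> ?T (ctxT ?Z ?\<Delta>)"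
    "seq (?\<Delta> @ [?Z]) (ebs ?m ?T) (\<lambda>n. if n < ?m then VVar n else ?U) ?\<Gamma>"
    using vtup[OF U, of ?\<Delta> 0, unfolded add_0] by (simp_all add: nth_append)
  have red: "ceq ?\<Gamma> (csubst (ebs ?m ?T) (?I L)) (?J L) X \<T>'" if L: "gctyp (sig \<T>) \<Delta> L A" for L
  proof -
    have mZ: "vtyp (?\<Delta> @ [?Z]) (VVar ?m) ?Z" by (rule vtyp_VVarI) (simp_all add: nth_append)
    have "ctyp (?\<Delta> @ [?Z]) (?I L) X \<T>'"
      by (rule ctyp_hinst[OF L]) (rule tt mZ H)+
    from csubst_cong[OF this T(2)]
    have 1: "ceq ?\<Gamma> (csubst (ebs ?m ?T) (?I L)) (csubst (\<lambda>n. if n < ?m then VVar n else ?U) (?I L)) X \<T>'" .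
    have 2: "csubst (\<lambda>n. if n < ?m then VVar n else ?U) (?I L) =
       hinst \<T> X \<T>' (hof \<T> (inst H (VProj 0 ?U))) (VProj (Suc 0) ?U) L"
      by (subst csubst_hinst[OF L]) (simp_all add: fmdom_hof)
    have "veq ?\<Gamma> (inst H (VProj 0 ?U)) (vsubst (\<lambda>_. VVar (Suc ?m)) H) (handlerT \<T> \<T>' X)"
      unfolding inst_def[symmetric] by (rule veq_inst2[OF H] proj0_tup ZV)+
    \<comment> \<open>The constant substitution and the shift agree on index 0, the only one that
      \<open>H\<close> may use in \<open>[Z]\<close>.\<close>
    moreover have "veq ?\<Gamma> (vsubst (\<lambda>_. VVar (Suc ?m)) H) (vsubst (\<lambda>n. VVar (Suc ?m + n)) H) (handlerT \<T> \<T>' X)"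
      by (rule vsubst_cong[OF H]) (simp add: seq_def ve_refl ZV)
    ultimately have "veq ?\<Gamma> (inst H (VProj 0 ?U)) (vren ((+) (Suc ?m)) H) (handlerT \<T> \<T>' X)"
      unfolding vsubst_var by (rule ve_trans)
    from hinst_cong[OF L hof_heq[OF this] proj1_tup[OF ZV]]
    show ?thesis using 1 unfolding 2 by (simp add: hren_hof) (rule ce_trans)
  qed
  note MN = axs_typed[OF ax]
  have "veq [ctxT ?Z ?\<Delta>] (thunk \<T>' X (csubst (ebs ?m (VVar 0)) (?I M))) (thunk \<T>' X (csubst (ebs ?m (VVar 0)) (?I N))) (TT \<T>' X)"
    using den_eqD[OF D[OF MN(1)]] D[OF MN(2)] eq by simp
  from ceq_force[OF veq_inst[OF this ve_refl[OF T(1)]]]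
  have e: "ceq ?\<Gamma> (force (thunk \<T>' X (csubst (ebs ?m ?T) (?I M)))) (force (thunk \<T>' X (csubst (ebs ?m ?T) (?I N)))) X \<T>'"
    by (simp del: inst_simps(1-4,6))
  have "ceq ?\<Gamma> (force (thunk \<T>' X (csubst (ebs ?m ?T) (?I L)))) (?J L) X \<T>'" if "gctyp (sig \<T>) \<Delta> L A" for L
    by (rule force_thunk'[OF red[OF that]])
  from this[OF MN(1)] this[OF MN(2)] e show "ceq ?\<Gamma> (?J M) (?J N) X \<T>'"
    by (meson ce_sym ce_trans)
qed

text \<open>With \<open>handlers_htyp\<close> at hand, each clause is an equation about
  \<open>hdlV\<close>: naturality is substitution into \<open>hdlV\<close>, and unit, multiplication
  and operation are the three handler laws.\<close>

lemma has_handle: "has_handle \<MM> \<T> \<T>'"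
  unfolding has_handle_def
proof (intro ballI)
  fix X0 Z0 h assume ob: "X0 \<in> Ob \<MM>" "Z0 \<in> Ob \<MM>" and hh: "h \<in> handlers \<MM> \<T> \<T>' X0 Z0"
  obtain X Z where XZ: "X0 = eo X" "Z0 = eo Z" using ob by (auto simp: Ob_iff)
  obtain H where h: "den h Z (handlerT \<T> \<T>' X) H"
    using hh by (auto simp: handlers_def XZ handler_ob_eo hom_iff)
  have T: "htyp [Z] (hof \<T> H) \<T> X \<T>'" by (rule handlers_htyp[OF hh[unfolded XZ] h])
  note H = den_typed[OF h]
  let ?h = "Hdl \<MM> \<T> \<T>' X0"
  have typed: "?h h f \<in> hom \<MM> Z0 (TO \<MM> \<T>' X0) \<and>
      (\<forall>Z'. \<forall>g \<in> hom \<MM> Z' Z0. ?h (Cmp \<MM> h g) (Cmp \<MM> f g) = Cmp \<MM> (?h h f) g)"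
    if f0: "f \<in> hom \<MM> Z0 (TO \<MM> \<T> (TO \<MM> \<T>' X0))" for f
  proof -
    obtain F where f: "den f Z (TT \<T> (TT \<T>' X)) F" using f0 by (auto simp: XZ hom_iff)
    note D = den_Hdl[OF h T f]
    have "?h (Cmp \<MM> h g) (Cmp \<MM> f g) = Cmp \<MM> (?h h f) g" if g0: "g \<in> hom \<MM> Z' Z0" for Z' g
    proof -
      obtain Y G where g: "den g Y Z G" using g0 by (auto simp: XZ hom_iff)
      have "den (Hdl \<MM> \<T> \<T>' (eo X) (Cmp \<MM> h g) (Cmp \<MM> f g)) Y (TT \<T>' X) (hdlV \<T> \<T>' X (inst H G) (inst F G))"
        by (rule den_Hdl den_Cmp hof_htyp_inst T h f g den_typed)+
      then show ?thesis
        using den_Cmp[OF D g] unfolding XZ inst_hdlV[OF H T] by (simp add: den_def)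
    qed
    then show ?thesis using den_hom[OF D] by (simp add: XZ)
  qed
  have unit: "?h h (Cmp \<MM> (Eta \<MM> \<T> (TO \<MM> \<T>' X0)) f) = f" if f0: "f \<in> hom \<MM> Z0 (TO \<MM> \<T>' X0)" for f
  proof -
    obtain F where f: "den f Z (TT \<T>' X) F" using f0 by (auto simp: XZ hom_iff)
    show ?thesis unfolding XZ obs
      by (rule den_eq[OF den_Hdl[OF h T den_Cmp[OF den_Eta f]] f hdlV_unit[OF H T den_typed[OF f]]])
  qed
  have mult: "let Y = TO \<MM> \<T> (TO \<MM> \<T>' X0) in
        ?h h (Cmp \<MM> (Mu \<MM> \<T> (TO \<MM> \<T>' X0)) f) =
        ?h h (strmap \<MM> \<T> Z0 Y f (?h (Cmp \<MM> h (Prj \<MM> [Z0, Y] 0)) (Prj \<MM> [Z0, Y] 1)))"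
    if f0: "f \<in> hom \<MM> Z0 (TO \<MM> \<T> (TO \<MM> \<T> (TO \<MM> \<T>' X0)))" for f
  proof -
    obtain F where f: "den f Z (TT \<T> (TT \<T> (TT \<T>' X))) F" using f0 by (auto simp: XZ hom_iff)
    let ?Y = "TT \<T> (TT \<T>' X)"
    have g: "den (Hdl \<MM> \<T> \<T>' (eo X) (Cmp \<MM> h (Prj \<MM> [eo Z, eo ?Y] 0)) (Prj \<MM> [eo Z, eo ?Y] 1)) (TProd [Z, ?Y]) (TT \<T>' X)
        (hdlV \<T> \<T>' X (inst H (VProj 0 (VVar 0))) (VProj (Suc 0) (VVar 0)))"
      by (rule den_Hdl hof_htyp_inst T dd h tt)+
    show ?thesis unfolding XZ obs Let_def
      by (rule den_eq[OF den_Hdl[OF h T den_Cmp[OF den_Mu f]] den_Hdl[OF h T den_strmap[OF f g]]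
        hdlV_mu[OF H T den_typed[OF f]]])
  qed
  have oper: "let K = KExp \<MM> \<T>' (gtyI \<MM> B) X0 in
         \<forall>f \<in> hom \<MM> Z0 (Prd \<MM> [gtyI \<MM> A, K]).
          ?h h
            (Cmp \<MM> (TM \<MM> \<T> (KEv \<MM> \<T>' (gtyI \<MM> B) X0)) (Cmp \<MM> (St \<MM> \<T> K (gtyI \<MM> B))
              (Cmp \<MM> (swap \<MM> (TO \<MM> \<T> (gtyI \<MM> B)) K) (Cmp \<MM> (cross \<MM> (Opn \<MM> \<T> op) (Ide \<MM> K)) f)))) =
          Cmp \<MM> (KEv \<MM> \<T>' (Prd \<MM> [gtyI \<MM> A, K]) X0) (pair \<MM> (Cmp \<MM> (handler_proj \<MM> \<T> \<T>' X0 op) h) f)"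
    if op: "fmlookup (sig \<T>) op = Some (A, B)" for op A B
    unfolding Let_def XZ tyI_eo obs
  proof
    fix f assume "f \<in> hom \<MM> (eo Z) (eo (TProd [ty_of A, TFun (ty_of B) X \<T>']))"
    then obtain F where f: "den f Z (TProd [ty_of A, TFun (ty_of B) X \<T>']) F" by (rule homE)
    let ?K = "TFun (ty_of B) X \<T>'"
    have l: "den (Cmp \<MM> (TM \<MM> \<T> (KEv \<MM> \<T>' (eo (ty_of B)) (eo X))) (Cmp \<MM> (St \<MM> \<T> (eo ?K) (eo (ty_of B)))
        (Cmp \<MM> (swap \<MM> (eo (TT \<T> (ty_of B))) (eo ?K)) (Cmp \<MM> (cross \<MM> (Opn \<MM> \<T> op) (Ide \<MM> (eo ?K))) f))))
        Z (TT \<T> (TT \<T>' X))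
        (inst (tmV \<T> (TProd [?K, ty_of B]) (TT \<T>' X) (kevV \<T>' X)) (inst (stV \<T> ?K (ty_of B))
        (inst (VTup [VProj (Suc 0) (VVar 0), VProj 0 (VVar 0)]) (inst (crossV (opnV \<T> op) (VVar 0)) F))))"
      by (rule dd f den_Opn op)+
    have r: "den (Cmp \<MM> (KEv \<MM> \<T>' (eo (TProd [ty_of A, ?K])) (eo X)) (pair \<MM> (Cmp \<MM> (handler_proj \<MM> \<T> \<T>' (eo X) op) h) f))
        Z (TT \<T>' X) (inst (kevV \<T>' X) (VTup [VProj (op_index \<T> op) H, F]))"
      using den_Cmp[OF den_KEv den_pair[OF den_Cmp[OF den_handler_proj[OF op] h] f]] by (simp only: inst_simps)
    show "Hdl \<MM> \<T> \<T>' (eo X) h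
        (Cmp \<MM> (TM \<MM> \<T> (KEv \<MM> \<T>' (eo (ty_of B)) (eo X))) (Cmp \<MM> (St \<MM> \<T> (eo ?K) (eo (ty_of B)))
        (Cmp \<MM> (swap \<MM> (eo (TT \<T> (ty_of B))) (eo ?K)) (Cmp \<MM> (cross \<MM> (Opn \<MM> \<T> op) (Ide \<MM> (eo ?K))) f)))) =
        Cmp \<MM> (KEv \<MM> \<T>' (eo (TProd [ty_of A, ?K])) (eo X)) (pair \<MM> (Cmp \<MM> (handler_proj \<MM> \<T> \<T>' (eo X) op) h) f)"
      by (rule den_eq[OF den_Hdl[OF h T l] r hdlV_op[OF H T op den_typed[OF f]]])
  qed
  from typed unit mult oper show "(\<forall>f \<in> hom \<MM> Z0 (TO \<MM> \<T> (TO \<MM> \<T>' X0)).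
        Hdl \<MM> \<T> \<T>' X0 h f \<in> hom \<MM> Z0 (TO \<MM> \<T>' X0) \<and>
        (\<forall>Z'. \<forall>g \<in> hom \<MM> Z' Z0. Hdl \<MM> \<T> \<T>' X0 (Cmp \<MM> h g) (Cmp \<MM> f g) = Cmp \<MM> (Hdl \<MM> \<T> \<T>' X0 h f) g)) \<and>
      (\<forall>f \<in> hom \<MM> Z0 (TO \<MM> \<T>' X0). Hdl \<MM> \<T> \<T>' X0 h (Cmp \<MM> (Eta \<MM> \<T> (TO \<MM> \<T>' X0)) f) = f) \<and>
      (\<forall>f \<in> hom \<MM> Z0 (TO \<MM> \<T> (TO \<MM> \<T> (TO \<MM> \<T>' X0))).
        let Y = TO \<MM> \<T> (TO \<MM> \<T>' X0) in
        Hdl \<MM> \<T> \<T>' X0 h (Cmp \<MM> (Mu \<MM> \<T> (TO \<MM> \<T>' X0)) f) =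
        Hdl \<MM> \<T> \<T>' X0 h (strmap \<MM> \<T> Z0 Y f (Hdl \<MM> \<T> \<T>' X0 (Cmp \<MM> h (Prj \<MM> [Z0, Y] 0)) (Prj \<MM> [Z0, Y] 1)))) \<and>
      (\<forall>op A B. fmlookup (sig \<T>) op = Some (A, B) \<longrightarrow>
        (let K = KExp \<MM> \<T>' (gtyI \<MM> B) X0 in
         \<forall>f \<in> hom \<MM> Z0 (Prd \<MM> [gtyI \<MM> A, K]).
          Hdl \<MM> \<T> \<T>' X0 h
            (Cmp \<MM> (TM \<MM> \<T> (KEv \<MM> \<T>' (gtyI \<MM> B) X0)) (Cmp \<MM> (St \<MM> \<T> K (gtyI \<MM> B))
              (Cmp \<MM> (swap \<MM> (TO \<MM> \<T> (gtyI \<MM> B)) K) (Cmp \<MM> (cross \<MM> (Opn \<MM> \<T> op) (Ide \<MM> K)) f)))) =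
          Cmp \<MM> (KEv \<MM> \<T>' (Prd \<MM> [gtyI \<MM> A, K]) X0) (pair \<MM> (Cmp \<MM> (handler_proj \<MM> \<T> \<T>' X0 op) h) f)))"
    by blast
qed

end

section \<open>Validity of the axioms, and completeness\<close>

lemma vty_val_of: "gvtyp \<Delta> V A \<Longrightarrow> vty (map ty_of \<Delta>) (val_of V) = ty_of A"
  using vty_eq[OF vtyp_val_of[of \<Delta> V A "[]"]] by simp

lemma gvI_vI: "gvtyp \<Delta> V A \<Longrightarrow> gvI \<MM> (Prd \<MM> []) \<Delta> V = vI \<MM> (val_of V) (map ty_of \<Delta>)"
proof (induction rule: gvtyp.induct)
  case (gv_tup Vs As)
  then show ?case by (auto simp: comp_def list_all2_conv_all_nth in_set_conv_nth intro!: arg_cong2[where f = "Tup \<MM>"])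
next
  case (gv_proj V As i)
  then show ?case by (simp add: comp_def vty_val_of gvty_eq)
qed (simp_all add: comp_def)

text \<open>Holds in every structure, since \<open>comp_of\<close> mirrors the monadic
  interpretation clause by clause. Validity of an axiom thus becomes a statement about the
  interpretation of the calculus.\<close>

lemma gcI_cI:
  "gctyp (sig \<T>) \<Delta> M C \<Longrightarrow> gcI \<MM> \<T> C M \<Delta> = cI \<MM> (comp_of \<T> M) (map ty_of \<Delta>) (ty_of C) \<T>"
proof (induction rule: gctyp.induct)
  case (gc_case \<Delta> V As C Ms)
  have "map2 (\<lambda>A m. m (A # \<Delta>)) As (map (gcI \<MM> \<T> C) Ms) =
     map2 (\<lambda>A m. m (A # map ty_of \<Delta>) (ty_of C) \<T>) (map ty_of As) (map (cI \<MM>) (map (comp_of \<T>) Ms))"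
    using gc_case.IH by (intro nth_equalityI) (auto simp: list_all2_conv_all_nth)
  then show ?case using gc_case.hyps by (simp add: comp_def Let_def vty_val_of gvty_eq gvI_vI)
qed (simp_all add: comp_def gvI_vI gctyp_argty)

context term_model
begin

lemma interprets_ops: "interprets_ops \<MM> \<T>"
  unfolding interprets_ops_def
proof (intro conjI allI impI ballI, goal_cases)
  case (1 op A B)
  then show ?case using den_hom[OF den_Opn] by simp
next
  case (2 ax)
  obtain \<Delta> M N A where ax: "ax = (\<Delta>, M, N, A)" by (metis prod_cases4)
  note MN = axs_typed[OF 2[unfolded ax]]
  let ?\<Delta> = "map ty_of \<Delta>"
  \<comment> \<open>The base component at index \<open>length \<Delta>\<close> is cut off, leaving
    the instantiation of the variables of the axiom needed for \<open>ce_axiom\<close>.\<close>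
  have "styp ?\<Delta> (ebs (length \<Delta>) (VVar 0)) [ctxT UT ?\<Delta>]"
    using styp_prefix[OF styp_ebs[OF tt_Var0[of "ctxT UT ?\<Delta>" "[]"]]] by simp
  then have "veq [ctxT UT ?\<Delta>] (thunk \<T> (ty_of A) (csubst (ebs (length \<Delta>) (VVar 0)) (comp_of \<T> M)))
      (thunk \<T> (ty_of A) (csubst (ebs (length \<Delta>) (VVar 0)) (comp_of \<T> N))) (TT \<T> (ty_of A))"
    by (intro veq_thunk ce_axiom[OF 2[unfolded ax]]) (auto simp: styp_def)
  from den_eq[OF den_cI[OF ctyp_comp_of[OF MN(1)]] den_cI[OF ctyp_comp_of[OF MN(2)]]] this
  show ?case by (simp add: ax gcI_cI[OF MN(1)] gcI_cI[OF MN(2)])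
qed

lemma eff_model: "eff_model \<MM>"
  unfolding eff_model_def
  by (intro conjI allI is_category has_products has_kleisli_coproducts is_strong_monad
    has_kleisli_exponentials interprets_ops has_handle) simp

lemma complete:
  assumes M: "ctyp \<Gamma> M A \<T>" and N: "ctyp \<Gamma> N A \<T>" and eq: "cI \<MM> M \<Gamma> A \<T> = cI \<MM> N \<Gamma> A \<T>"
  shows "ceq \<Gamma> M N A \<T>"
proof -
  let ?m = "length \<Gamma>"
  \<comment> \<open>The empty tuple fills the unit base. It is read only at index \<open>?m\<close>,
    beyond the variables of \<open>\<Gamma>\<close>, so on \<open>\<Gamma>\<close> the substitution
    is provably the identity.\<close>
  let ?T = "vtup ?m 0 (VTup [])"
  have T: "vtyp \<Gamma> ?T (ctxT UT \<Gamma>)"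
    and s: "seq (\<Gamma> @ [UT]) (ebs ?m ?T) (\<lambda>n. if n < ?m then VVar n else VTup []) \<Gamma>"
    using vtup[OF vtyp_VTup0, of \<Gamma> 0 \<Gamma>, unfolded add_0] by simp_all
  have s': "seq \<Gamma> (ebs ?m ?T) VVar \<Gamma>"
    using seq_prefix[OF s] by (simp add: seq_def)
  have red: "ceq \<Gamma> (force (thunk \<T> A (csubst (ebs ?m ?T) L))) L A \<T>" if "ctyp \<Gamma> L A \<T>" for L
    using force_thunk'[OF csubst_cong[OF that s']] by simp
  have "veq [ctxT UT \<Gamma>] (thunk \<T> A (csubst (ebs ?m (VVar 0)) M)) (thunk \<T> A (csubst (ebs ?m (VVar 0)) N)) (TT \<T> A)"
    using den_eqD[OF den_cI[OF M]] den_cI[OF N] eq by simp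
  from ceq_force[OF veq_inst[OF this ve_refl[OF T]]]
  have "ceq \<Gamma> (force (thunk \<T> A (csubst (ebs ?m ?T) M))) (force (thunk \<T> A (csubst (ebs ?m ?T) N))) A \<T>"
    by simp
  with red[OF M] red[OF N] show ?thesis by (meson ce_sym ce_trans)
qed

end

text \<open>Carrier types cannot be quantified inside a HOL statement, so they are fixed, and the
  two injections say that they are large enough to hold the term model. The identity maps serve when
  \<open>'o\<close> is \<open>('b, 'op) ty\<close> and \<open>'m\<close> is
  \<open>('b, 'op) val\<close>.\<close>

theorem theorem6p15:
  fixes \<Gamma> :: "('b, 'op) ty list"
    and M N :: "('b, 'op) comp"
    and A :: "('b, 'op) ty"
    and \<T> :: "('b, 'op) effthy"
  assumes ob_size: "\<exists>e :: ('b, 'op) ty \<Rightarrow> 'o. inj e"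
    and arr_size: "\<exists>e :: ('b, 'op) val \<Rightarrow> 'm. inj e"
    and typM: "ctyp \<Gamma> M A \<T>"
    and typN: "ctyp \<Gamma> N A \<T>"
    and sem_eq: "\<And>\<MM> :: ('o, 'm, 'b, 'op) eff_structure.
      eff_model \<MM> \<Longrightarrow> cI \<MM> M \<Gamma> A \<T> = cI \<MM> N \<Gamma> A \<T>"
  shows "ceq \<Gamma> M N A \<T>"
proof -
  obtain eo :: "('b, 'op) ty \<Rightarrow> 'o" and em :: "('b, 'op) val \<Rightarrow> 'm" where "inj eo" "inj em"
    using ob_size arr_size by blast
  then interpret term_model eo em by unfold_locales
  show ?thesis by (rule complete[OF typM typN sem_eq[OF eff_model]])
qed

end
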